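(* Let $\mu>0$, $a\in\mathbb{R}$, and let $\nu>0$ be determined by $\mu\,\psi_\nu(0)=1$. For any $f\in L_2(\mathbb{R})$, $$L_2\text{-}\lim_{t\to\infty}e^{-\nu t}\,\mathbf{E}\,f(\xi_x(t))\,e^{\mu L(t,x-a)}=\frac{(f,\psi_\nu(\cdot-a))}{\|\psi_\nu\|_2^2}\,\psi_\nu(x-a),$$ where both sides are regarded as functions of $x\in\mathbb{R}$ and the limit is in $L_2(\mathbb{R})$.
   Context: $\xi(t)$, $t\ge 0$, is a one-dimensional symmetric Lévy process with $\mathbf{E}e^{ip\xi(t)}=e^{-t\Psi(p)}$, $\Psi(p)=\frac{\sigma^2p^2}{2}+\int_{|y|>0}(1-\cos(py))\,\Pi(dy)$, where $\sigma^2\ge0$ and $\Pi$ is a symmetric $\sigma$-finite measure with $\int_{|y|>0}\min(1,y^2)\,\Pi(dy)<\infty$. Standing assumption: $\int_{\mathbb{R}}\frac{dp}{1+\Psi(p)}<\infty$, equivalently the local time exists. $L(t,\cdot)$ is the local time, i.e. the density with respect to Lebesgue measure of the occupation measure $\Gamma\mapsto\mathrm{mes}\{\tau<t:\xi(\tau)\in\Gamma\}$; it is taken to be continuous in $(t,x)$ with probability 1. $\xi_x(t)=x-\xi(t)$. $(f,g)=\int f\bar g$ is the inner product of $L_2(\mathbb{R})$. For $\lambda\in\mathbb{C}\setminus(-\infty,0]$, $\psi_\lambda(x)=\frac1{2\pi}\int_{\mathbb{R}}\frac{e^{-ipx}}{\Psi(p)+\lambda}\,dp$. *)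

theory Defs
  imports "HOL-Probability.Probability"
begin

locale levy_process = prob_space M for M :: "'a measure" +
  fixes \<xi> :: "real \<Rightarrow> 'a \<Rightarrow> real"
  assumes random_variable: "t \<ge> 0 \<Longrightarrow> \<xi> t \<in> borel_measurable M"
    and starts_at_0: "AE \<omega> in M. \<xi> 0 \<omega> = 0"
    and indep_increments:
      "0 \<le> s 0 \<Longrightarrow> mono s \<Longrightarrow>
        indep_vars (\<lambda>_. borel) (\<lambda>i \<omega>. \<xi> (s (Suc i)) \<omega> - \<xi> (s i) \<omega>) {..<n::nat}"
    and stationary_increments:
      "0 \<le> r \<Longrightarrow> r \<le> t \<Longrightarrow> distr M borel (\<lambda>\<omega>. \<xi> t \<omega> - \<xi> r \<omega>) = distr M borel (\<xi> (t - r))"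
    and stochastically_continuous:
      "t \<ge> 0 \<Longrightarrow> \<epsilon> > 0 \<Longrightarrow>
        ((\<lambda>r. prob {\<omega> \<in> space M. \<epsilon> < \<bar>\<xi> r \<omega> - \<xi> t \<omega>\<bar>}) \<longlongrightarrow> 0) (at t within {0..})"
    and cadlag_paths:
      "AE \<omega> in M. (\<forall>t\<ge>0. ((\<lambda>r. \<xi> r \<omega>) \<longlongrightarrow> \<xi> t \<omega>) (at_right t)) \<and>
                  (\<forall>t>0. \<exists>l. ((\<lambda>r. \<xi> r \<omega>) \<longlongrightarrow> l) (at_left t))"

text \<open>
  A symmetric measure on the punctured line with finite truncated second moment.
  The measure is carried on all of the real line, but every integral below excludes the
  origin, so a possible (finite) mass there plays no role.
\<close>
definition symmetric_levy_measure :: "real measure \<Rightarrow> bool" where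
  "symmetric_levy_measure \<Lambda> \<longleftrightarrow>
     sets \<Lambda> = sets borel \<and> sigma_finite_measure \<Lambda> \<and> distr \<Lambda> borel uminus = \<Lambda> \<and>
     set_integrable \<Lambda> {y. \<bar>y\<bar> > 0} (\<lambda>y. min 1 (y\<^sup>2))"

definition levy_exponent :: "real \<Rightarrow> real measure \<Rightarrow> real \<Rightarrow> real" where
  "levy_exponent \<sigma> \<Lambda> p =
     \<sigma>\<^sup>2 * p\<^sup>2 / 2 + (LINT y:{y. \<bar>y\<bar> > 0}|\<Lambda>. 1 - cos (p * y))"

definition occupation_measure :: "(real \<Rightarrow> 'a \<Rightarrow> real) \<Rightarrow> real \<Rightarrow> 'a \<Rightarrow> real measure" where
  "occupation_measure \<xi> t \<omega> = distr (restrict_space lborel {0..<t}) borel (\<lambda>\<tau>. \<xi> \<tau> \<omega>)"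

text \<open>
  The version of the local time that is jointly continuous in time and space.
  Nonnegativity is explicit because \<open>ennreal\<close> truncates negative reals to zero.
\<close>
definition continuous_local_time ::
  "'a measure \<Rightarrow> (real \<Rightarrow> 'a \<Rightarrow> real) \<Rightarrow> (real \<Rightarrow> real \<Rightarrow> 'a \<Rightarrow> real) \<Rightarrow> bool" where
  "continuous_local_time M \<xi> L \<longleftrightarrow>
     (\<forall>t\<ge>0. \<forall>x. L t x \<in> borel_measurable M) \<and>
     (AE \<omega> in M. \<forall>t\<ge>0. (\<forall>x. 0 \<le> L t x \<omega>) \<and>
        occupation_measure \<xi> t \<omega> = density lborel (\<lambda>x. ennreal (L t x \<omega>))) \<and>
     (AE \<omega> in M. continuous_on ({0..} \<times> UNIV) (\<lambda>(t, x). L t x \<omega>))"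

definition psi :: "(real \<Rightarrow> real) \<Rightarrow> complex \<Rightarrow> real \<Rightarrow> complex" where
  "psi \<Psi> z x =
     1 / (2 * of_real pi) *
       (CLBINT p. exp (- \<i> * of_real (p * x)) / (of_real (\<Psi> p) + z))"

text \<open>Elements of \<open>L\<^sub>2(\<real>)\<close> are represented by Borel functions.\<close>
definition square_integrable :: "(real \<Rightarrow> complex) \<Rightarrow> bool" where
  "square_integrable f \<longleftrightarrow>
     f \<in> borel_measurable lborel \<and> integrable lborel (\<lambda>x. (cmod (f x))\<^sup>2)"

definition L2_inner :: "(real \<Rightarrow> complex) \<Rightarrow> (real \<Rightarrow> complex) \<Rightarrow> complex" where
  "L2_inner f g = (CLBINT x. f x * cnj (g x))"

definition L2_norm :: "(real \<Rightarrow> complex) \<Rightarrow> real" where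
  "L2_norm f = sqrt (LBINT x. (cmod (f x))\<^sup>2)"

text \<open>
  Membership in \<open>L\<^sub>2(\<real>)\<close> is part of the definition because
  \<open>L2_norm\<close> is zero on functions that are not square integrable.
\<close>
definition tendsto_L2 ::
  "('t \<Rightarrow> real \<Rightarrow> complex) \<Rightarrow> (real \<Rightarrow> complex) \<Rightarrow> 't filter \<Rightarrow> bool" where
  "tendsto_L2 u v F \<longleftrightarrow>
     (\<forall>\<^sub>F t in F. square_integrable (u t)) \<and> square_integrable v \<and>
     ((\<lambda>t. L2_norm (\<lambda>x. u t x - v x)) \<longlongrightarrow> 0) F"

end

theory Submission
  imports Defs
begin

text \<open>
  Write \<open>U\<^sub>t f(x)\<close> for the expectation in the theorem. For the bounded potential \<open>V = \<mu> * bump\<close> concentrated near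
  \<open>a\<close>, the Feynman--Kac operators form a symmetric semigroup, and for \<open>\<phi> = R\<^sub>l k\<close> (the resolvent of the free
  process, convolution with \<open>\<psi>\<^sub>l\<close>) Duhamel's formula
  \<open>e\<^sup>-\<^sup>l\<^sup>t U\<^sub>t \<phi> + \<integral>\<^sub>0\<^sup>t e\<^sup>-\<^sup>l\<^sup>s U\<^sub>s (k - V \<phi>) ds = \<phi>\<close> holds. It is used three times, no spectral theory is needed.
  For \<open>l > \<nu>\<close> and \<open>k\<close> the bump plus a small constant, \<open>\<phi>\<close> is a positive supersolution, so Schur's test gives
  \<open>\<parallel>U\<^sub>t\<parallel> \<le> e\<^sup>\<nu>\<^sup>t\<close>, and exponential moments of the local time are bounded uniformly in the width of the bump.
  For \<open>l = \<nu>\<close> and \<open>k\<close> the bump, the source \<open>k - V \<phi>\<close> vanishes in the limit because \<open>\<mu> \<psi>\<^sub>\<nu>(0) = 1\<close>, hence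
  \<open>U\<^sub>t \<psi>\<^sub>\<nu> = e\<^sup>\<nu>\<^sup>t \<psi>\<^sub>\<nu>\<close>. If \<open>f\<close> is orthogonal to \<open>\<psi>\<^sub>\<nu>(\<cdot> - a)\<close>, then \<open>\<phi> = R\<^sub>\<nu> f\<close> vanishes at
  \<open>a\<close>, so the term \<open>V \<phi>\<close> disappears in the limit and \<open>\<integral>\<^sub>0\<^sup>t (T\<^sub>s f, f) ds\<close> with \<open>T\<^sub>s = e\<^sup>-\<^sup>\<nu>\<^sup>s U\<^sub>s\<close> stays bounded.
  As \<open>(T\<^sub>s f, f) = \<parallel>T\<^sub>s\<^sub>/\<^sub>2 f\<parallel>\<^sup>2\<close> is nonincreasing in \<open>s\<close>, it tends to \<open>0\<close>.
\<close>

section \<open>Preliminaries\<close>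

text \<open>Bumps replace the point potential because Riemann sums along the paths need a bounded
  continuous V. All bounds at a fixed time are uniform in the width of the bump; the width is sent
  to 0 first, with Fatou's lemma for the norms, and only then does t grow. The order matters: the
  error left by the source V \<phi> is at most \<eta> C, where \<eta> vanishes with the width, but
  C, an exponential moment, depends on t. Convergence of the expectations rests on second moments,
  hence on exponential moments for the coupling 2 \<mu>. That coupling is supercritical at \<nu>,
  but every coupling q satisfies q \<psi>_l(0) < 1 once l is large, and then a supersolution exists.
  Positivity and integrability of \<psi>_l cannot be read off its Fourier integral. They hold
  because l \<psi>_l is the density of the process at an independent exponential time of rate l. For
  f in L_2 the expectation is shown to exist for almost every x, so linearity in f is used almost
  everywhere only.\<close>

definition bounded_borel :: "(real \<Rightarrow> real) \<Rightarrow> bool" where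
  "bounded_borel f \<longleftrightarrow> f \<in> borel_measurable borel \<and> (\<exists>C. \<forall>x. \<bar>f x\<bar> \<le> C)"

lemma bounded_borelI:
  "f \<in> borel_measurable borel \<Longrightarrow> (\<And>x. \<bar>f x\<bar> \<le> C) \<Longrightarrow> bounded_borel f"
  by (auto simp: bounded_borel_def)

lemma bounded_borel_measurable [measurable_dest]:
  "bounded_borel f \<Longrightarrow> f \<in> borel_measurable borel"
  by (auto simp: bounded_borel_def)

lemma bounded_borelE:
  assumes "bounded_borel f"
  obtains C where "C \<ge> 0" "\<And>x. \<bar>f x\<bar> \<le> C"
  using assms unfolding bounded_borel_def by (metis abs_ge_zero order_trans)

lemma bounded_borel_const [simp]: "bounded_borel (\<lambda>x. c)"
  by (rule bounded_borelI[of _ "\<bar>c\<bar>"]) auto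

lemma bounded_borel_add [simp]:
  assumes "bounded_borel f" "bounded_borel g"
  shows "bounded_borel (\<lambda>x. f x + g x)"
proof -
  obtain C D where "\<And>x. \<bar>f x\<bar> \<le> C" "\<And>x. \<bar>g x\<bar> \<le> D"
    using assms by (metis bounded_borelE)
  then have "\<bar>f x + g x\<bar> \<le> C + D" for x
    using abs_triangle_ineq[of "f x" "g x"] by (meson add_mono order_trans)
  then show ?thesis
    using assms by (intro bounded_borelI[of _ "C + D"]) (auto dest: bounded_borel_measurable)
qed

lemma bounded_borel_mult [simp]:
  assumes "bounded_borel f" "bounded_borel g"
  shows "bounded_borel (\<lambda>x. f x * g x)"
proof -
  obtain C D where "C \<ge> 0" "\<And>x. \<bar>f x\<bar> \<le> C" "\<And>x. \<bar>g x\<bar> \<le> D"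
    using assms by (metis bounded_borelE)
  then have "\<bar>f x * g x\<bar> \<le> C * D" for x
    by (simp add: abs_mult mult_mono)
  then show ?thesis
    using assms by (intro bounded_borelI[of _ "C * D"]) (auto dest: bounded_borel_measurable)
qed

lemma bounded_borel_divide [simp]: "bounded_borel f \<Longrightarrow> bounded_borel (\<lambda>x. f x / c)"
  using bounded_borel_mult[of f "\<lambda>_. inverse c"] by (simp add: divide_inverse)

lemma bounded_borel_minus [simp]:
  assumes "bounded_borel f" "bounded_borel g"
  shows "bounded_borel (\<lambda>x. f x - g x)"
  using bounded_borel_add[OF assms(1) bounded_borel_mult[OF bounded_borel_const[of "-1"] assms(2)]]
  by simp

lemma bounded_borel_exp [simp]:
  assumes "bounded_borel f"
  shows "bounded_borel (\<lambda>x. exp (f x))"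
proof -
  obtain C where "\<And>x. \<bar>f x\<bar> \<le> C"
    using assms by (metis bounded_borelE)
  then have "\<bar>exp (f x)\<bar> \<le> exp C" for x
    by (simp add: abs_le_D1)
  then show ?thesis
    using assms by (intro bounded_borelI[of _ "exp C"]) (auto dest: bounded_borel_measurable)
qed

lemma bounded_borel_integrable_power2:
  assumes f: "bounded_borel f" "integrable lborel f"
  shows "integrable lborel (\<lambda>x. (f x)\<^sup>2)"
proof -
  obtain C where C: "C \<ge> 0" "\<And>x. \<bar>f x\<bar> \<le> C"
    using f(1) by (metis bounded_borelE)
  have "integrable lborel (\<lambda>x. C * f x)"
    using f by simp
  then show ?thesis
  proof (rule Bochner_Integration.integrable_bound)
    show "AE x in lborel. norm ((f x)\<^sup>2) \<le> norm (C * f x)"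
    proof (rule AE_I2)
      fix x show "norm ((f x)\<^sup>2) \<le> norm (C * f x)"
        using mult_right_mono[OF C(2)[of x], of "\<bar>f x\<bar>"] C(1) by (simp add: power2_eq_square abs_mult)
    qed
  qed (use f bounded_borel_measurable in auto)
qed

section \<open>Integral estimates and Fubini for a bounded kernel\<close>

lemma integral_abs_le:
  fixes f g :: "'a \<Rightarrow> real"
  assumes "integrable M f" "integrable M g" "\<And>x. \<bar>f x\<bar> \<le> g x"
  shows "\<bar>\<integral>x. f x \<partial>M\<bar> \<le> (\<integral>x. g x \<partial>M)"
proof -
  have "\<bar>\<integral>x. f x \<partial>M\<bar> \<le> (\<integral>x. \<bar>f x\<bar> \<partial>M)"
    using integral_norm_bound[of M f] by simp
  also have "\<dots> \<le> (\<integral>x. g x \<partial>M)"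
    using assms by (intro integral_mono) auto
  finally show ?thesis .
qed

lemma integrable_dominated:
  fixes f g :: "'a \<Rightarrow> real"
  assumes "integrable M g" "f \<in> borel_measurable M" "\<And>x. \<bar>f x\<bar> \<le> g x"
  shows "integrable M f"
  using assms order_trans[OF assms(3) abs_ge_self] by (intro Bochner_Integration.integrable_bound[OF assms(1,2)]) auto

lemma (in pair_sigma_finite) integrable_product_bounded:
  fixes f1 f2 :: "_ \<Rightarrow> real"
  assumes f1: "integrable M1 f1" and f2: "integrable M2 f2"
    and G: "case_prod G \<in> borel_measurable (M1 \<Otimes>\<^sub>M M2)"
    and C: "\<And>x y. \<bar>G x y\<bar> \<le> C"
  shows "integrable (M1 \<Otimes>\<^sub>M M2) (\<lambda>(x, y). f1 x * f2 y * G x y)"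
proof -
  note [measurable] = borel_measurable_integrable[OF f1] borel_measurable_integrable[OF f2] G
  have C0: "C \<ge> 0"
    using C abs_ge_zero order_trans by blast
  have "integrable (M1 \<Otimes>\<^sub>M M2) (\<lambda>(x, y). f1 x * f2 y)"
  proof (rule integrableI_bounded)
    have "(\<integral>\<^sup>+ z. norm (case z of (x, y) \<Rightarrow> f1 x * f2 y) \<partial>(M1 \<Otimes>\<^sub>M M2))
        = (\<integral>\<^sup>+ x. \<integral>\<^sup>+ y. ennreal \<bar>f1 x\<bar> * ennreal \<bar>f2 y\<bar> \<partial>M2 \<partial>M1)"
      by (subst M2.nn_integral_fst[symmetric]) (auto simp: abs_mult ennreal_mult)
    also have "\<dots> = (\<integral>\<^sup>+ x. ennreal \<bar>f1 x\<bar> \<partial>M1) * (\<integral>\<^sup>+ y. ennreal \<bar>f2 y\<bar> \<partial>M2)"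
      by (simp add: nn_integral_cmult nn_integral_multc)
    also have "\<dots> < \<infinity>"
      using f1 f2 by (auto simp: integrable_iff_bounded ennreal_mult_less_top)
    finally show "(\<integral>\<^sup>+ z. norm (case z of (x, y) \<Rightarrow> f1 x * f2 y) \<partial>(M1 \<Otimes>\<^sub>M M2)) < \<infinity>" .
  qed simp
  then have "integrable (M1 \<Otimes>\<^sub>M M2) (\<lambda>z. C * (case z of (x, y) \<Rightarrow> f1 x * f2 y))"
    by simp
  then show ?thesis
  proof (rule Bochner_Integration.integrable_bound)
    show "AE z in M1 \<Otimes>\<^sub>M M2. norm (case z of (x, y) \<Rightarrow> f1 x * f2 y * G x y)
        \<le> norm (C * (case z of (x, y) \<Rightarrow> f1 x * f2 y))"
    proof (rule AE_I2, clarify)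
      fix x y
      show "norm (f1 x * f2 y * G x y) \<le> norm (C * (f1 x * f2 y))"
        using mult_left_mono[OF C[of x y], of "\<bar>f1 x * f2 y\<bar>"] C0 by (simp add: abs_mult ac_simps)
    qed
  qed simp
qed

text \<open>The form in which most exchanges of integrals are done below: two integrable weights and
  a bounded kernel, so that integrability on the product space follows from the shape of the
  integrand.\<close>

lemma (in pair_sigma_finite) fubini_bounded:
  fixes f1 f2 :: "_ \<Rightarrow> real"
  assumes f1: "integrable M1 f1" and f2: "integrable M2 f2"
    and G: "case_prod G \<in> borel_measurable (M1 \<Otimes>\<^sub>M M2)"
    and C: "\<And>x y. \<bar>G x y\<bar> \<le> C"
  shows "(\<integral>x. f1 x * (\<integral>y. f2 y * G x y \<partial>M2) \<partial>M1) = (\<integral>y. f2 y * (\<integral>x. f1 x * G x y \<partial>M1) \<partial>M2)"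
proof -
  have "(\<integral>y. (\<integral>x. f1 x * f2 y * G x y \<partial>M1) \<partial>M2) = (\<integral>x. (\<integral>y. f1 x * f2 y * G x y \<partial>M2) \<partial>M1)"
    by (rule Fubini_integral, rule integrable_product_bounded[OF assms])
  moreover have "(\<integral>y. (\<integral>x. f1 x * f2 y * G x y \<partial>M1) \<partial>M2) = (\<integral>y. f2 y * (\<integral>x. f1 x * G x y \<partial>M1) \<partial>M2)"
    by (simp add: mult.left_commute[of "f1 _"] mult.assoc)
  moreover have "(\<integral>x. (\<integral>y. f1 x * f2 y * G x y \<partial>M2) \<partial>M1) = (\<integral>x. f1 x * (\<integral>y. f2 y * G x y \<partial>M2) \<partial>M1)"
    by (simp add: mult.assoc)
  ultimately show ?thesis
    by simp
qed

text \<open>Over n equal steps, increments of order \<open>(t - s)\<^sup>2\<close> add up to O(1/n).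
  This takes the place of a vanishing derivative: the functions concerned are integrals of merely
  measurable densities and need not be differentiable at every point.\<close>

lemma second_order_increments_const:
  fixes H :: "real \<Rightarrow> real"
  assumes T: "T \<ge> 0"
    and H: "\<And>s t. 0 \<le> s \<Longrightarrow> s \<le> t \<Longrightarrow> t \<le> T \<Longrightarrow> \<bar>H t - H s\<bar> \<le> C * (t - s)\<^sup>2"
  shows "H T = H 0"
proof -
  have "\<bar>H T - H 0\<bar> \<le> C * T\<^sup>2 / real n" if "n > 0" for n :: nat
  proof -
    have "H T - H 0 = (\<Sum>i<n. H (real (Suc i) * (T / n)) - H (real i * (T / n)))"
      using that by (subst sum_lessThan_telescope) auto
    also have "\<bar>\<dots>\<bar> \<le> (\<Sum>i<n. C * (T / n)\<^sup>2)"
    proof (rule order_trans[OF sum_abs sum_mono])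
      fix i assume "i \<in> {..<n}"
      then have i: "real (Suc i) \<le> real n"
        by auto
      have "real (Suc i) * (T / n) \<le> T"
        using mult_right_mono[OF i, of "T / n"] T that by simp
      moreover have "real i * (T / n) \<le> real (Suc i) * (T / n)"
        using T by (intro mult_right_mono) auto
      moreover have "real (Suc i) * (T / n) - real i * (T / n) = T / n"
        by (simp add: algebra_simps add_divide_distrib)
      ultimately show "\<bar>H (real (Suc i) * (T / n)) - H (real i * (T / n))\<bar> \<le> C * (T / n)\<^sup>2"
        using H[of "real i * (T / n)" "real (Suc i) * (T / n)"] T that by simp
    qed
    also have "\<dots> = C * T\<^sup>2 / real n"
      using that by (simp add: power2_eq_square)
    finally show ?thesis .
  qed
  then have "\<forall>\<^sub>F n in sequentially. \<bar>H T - H 0\<bar> \<le> C * T\<^sup>2 / real n"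
    by (auto simp: eventually_sequentially intro!: exI[of _ 1])
  moreover have "(\<lambda>n. C * T\<^sup>2 / real n) \<longlonglongrightarrow> 0"
    by real_asymp
  ultimately have "\<bar>H T - H 0\<bar> \<le> 0"
    by (intro tendsto_lowerbound[of "\<lambda>n. C * T\<^sup>2 / real n" 0 sequentially]) auto
  then show ?thesis by simp
qed

section \<open>Calculus for integrals of bounded densities over half-open intervals\<close>

lemma emeasure_Ioc_finite: "emeasure lborel {s<..t::real} < \<top>"
  by (cases "s \<le> t") auto

lemma integrable_indicator_Ioc [simp]: "integrable lborel (indicat_real {s<..t::real})"
  using emeasure_Ioc_finite[of s t] by (simp add: top.not_eq_extremum)

lemma set_integrable_bounded_Ioc:
  fixes f :: "real \<Rightarrow> real"
  assumes "f \<in> borel_measurable borel" "\<And>x. s < x \<Longrightarrow> x \<le> t \<Longrightarrow> \<bar>f x\<bar> \<le> C"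
  shows "set_integrable lborel {s<..t} f"
  unfolding set_integrable_def
  using assms by (intro integrableI_bounded_set_indicator[where B = C]) (auto simp: emeasure_Ioc_finite)

lemma set_integral_Ioc_bound:
  fixes f :: "real \<Rightarrow> real"
  assumes f: "\<And>x. s < x \<Longrightarrow> x \<le> t \<Longrightarrow> \<bar>f x\<bar> \<le> C" and "s \<le> t"
  shows "\<bar>LBINT x:{s<..t}. f x\<bar> \<le> C * (t - s)"
proof (cases "set_integrable lborel {s<..t} f")
  case True
  have "\<bar>LBINT x:{s<..t}. f x\<bar> \<le> (LBINT x. C * indicator {s<..t} x)"
    unfolding set_lebesgue_integral_def
  proof (rule integral_abs_le)
    show "integrable lborel (\<lambda>x. indicator {s<..t} x *\<^sub>R f x)"
      using True by (simp add: set_integrable_def)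
    show "integrable lborel (\<lambda>x. C * indicator {s<..t} x :: real)"
      by simp
  qed (use f in \<open>auto simp: indicator_def\<close>)
  also have "\<dots> = C * (t - s)"
    using \<open>s \<le> t\<close> by simp
  finally show ?thesis .
next
  \<comment> \<open>A function that is not integrable has integral 0 by convention. What remains is
    0 \<le> C * (t - s), and the bound at the point t supplies C \<ge> 0.\<close>
  case False
  have "0 \<le> C * (t - s)"
    using f[of t] \<open>s \<le> t\<close> by (cases "s = t") auto
  with False show ?thesis
    by (simp add: set_lebesgue_integral_def set_integrable_def not_integrable_integral_eq)
qed

lemma set_integral_Ioc_add:
  fixes f :: "real \<Rightarrow> real"
  assumes "f \<in> borel_measurable borel" "\<And>x. r < x \<Longrightarrow> x \<le> t \<Longrightarrow> \<bar>f x\<bar> \<le> C" "r \<le> s" "s \<le> t"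
  shows "(LBINT x:{r<..t}. f x) = (LBINT x:{r<..s}. f x) + (LBINT x:{s<..t}. f x)"
proof -
  have "{r<..t} = {r<..s} \<union> {s<..t}"
    using assms by auto
  then show ?thesis
    using assms by (auto intro!: set_integral_Un set_integrable_bounded_Ioc[where C = C])
qed

text \<open>Freezing G at t and F at s writes F t * G t - F s * G s as the integral of f * G t + F s
  * g over (s, t]. By Lipschitz continuity this integrand differs from f * G + F * g by O(t - s), so
  the product minus the candidate integral has increments of second order and is constant.\<close>

lemma product_rule_bounded_densities:
  fixes f g :: "real \<Rightarrow> real"
  assumes f: "f \<in> borel_measurable borel" "\<And>x. 0 < x \<Longrightarrow> x \<le> T \<Longrightarrow> \<bar>f x\<bar> \<le> C"
    and g: "g \<in> borel_measurable borel" "\<And>x. 0 < x \<Longrightarrow> x \<le> T \<Longrightarrow> \<bar>g x\<bar> \<le> C"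
    and F: "\<And>t. 0 \<le> t \<Longrightarrow> t \<le> T \<Longrightarrow> F t = F 0 + (LBINT s:{0<..t}. f s)"
    and FB: "F \<in> borel_measurable borel" "\<And>x. 0 \<le> x \<Longrightarrow> x \<le> T \<Longrightarrow> \<bar>F x\<bar> \<le> B"
    and G: "\<And>t. 0 \<le> t \<Longrightarrow> t \<le> T \<Longrightarrow> G t = G 0 + (LBINT s:{0<..t}. g s)"
    and GB: "G \<in> borel_measurable borel" "\<And>x. 0 \<le> x \<Longrightarrow> x \<le> T \<Longrightarrow> \<bar>G x\<bar> \<le> B"
    and T: "T \<ge> 0"
  shows "F T * G T = F 0 * G 0 + (LBINT s:{0<..T}. f s * G s + F s * g s)"
proof (cases "T = 0")
  case True
  then show ?thesis by (simp add: set_lebesgue_integral_def)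
next
  case False
  note [measurable] = f(1) g(1) FB(1) GB(1)
  have C0: "C \<ge> 0" using f(2)[of T] False T by auto
  have B0: "B \<ge> 0" using FB(2)[of 0] T by auto
  define k where "k s = f s * G s + F s * g s" for s
  have k: "k \<in> borel_measurable borel" "\<And>x. 0 < x \<Longrightarrow> x \<le> T \<Longrightarrow> \<bar>k x\<bar> \<le> C * B + B * C"
  proof -
    show "k \<in> borel_measurable borel" unfolding k_def by measurable
    fix x assume x: "0 < x" "x \<le> T"
    have "\<bar>k x\<bar> \<le> \<bar>f x\<bar> * \<bar>G x\<bar> + \<bar>F x\<bar> * \<bar>g x\<bar>"
      unfolding k_def by (metis abs_mult abs_triangle_ineq)
    also have "\<dots> \<le> C * B + B * C"
      using f g FB GB C0 B0 x by (intro add_mono mult_mono) auto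
    finally show "\<bar>k x\<bar> \<le> C * B + B * C" .
  qed
  define H where "H t = F t * G t - (LBINT s:{0<..t}. k s)" for t
  have "H T = H 0"
  proof (rule second_order_increments_const[OF T, where C = "2 * C * C"])
    fix s t assume st: "0 \<le> s" "s \<le> t" "t \<le> T"
    have Fd: "F v - F u = (LBINT s:{u<..v}. f s)" if "0 \<le> u" "u \<le> v" "v \<le> T" for u v
      using F[of u] F[of v] set_integral_Ioc_add[of f 0 v C u] f that by simp
    have Gd: "G v - G u = (LBINT s:{u<..v}. g s)" if "0 \<le> u" "u \<le> v" "v \<le> T" for u v
      using G[of u] G[of v] set_integral_Ioc_add[of g 0 v C u] g that by simp
    have si: "set_integrable lborel {s<..t} (\<lambda>r. f r * G t)" "set_integrable lborel {s<..t} (\<lambda>r. F s * g r)"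
      "set_integrable lborel {s<..t} k"
      using set_integrable_bounded_Ioc[of f s t C] set_integrable_bounded_Ioc[of g s t C]
        set_integrable_bounded_Ioc[of k s t "C * B + B * C"] st f g k
      by auto
    have "H t - H s = (F t - F s) * G t + F s * (G t - G s) - (LBINT s:{s<..t}. k s)"
      unfolding H_def using set_integral_Ioc_add[of k 0 t "C * B + B * C" s] k st by (simp add: algebra_simps)
    also have "\<dots> = (LBINT r:{s<..t}. f r * G t) + (LBINT r:{s<..t}. F s * g r) - (LBINT s:{s<..t}. k s)"
      using Fd[of s t] Gd[of s t] st by simp
    also have "\<dots> = (LBINT r:{s<..t}. f r * G t + F s * g r - k r)"
      using si by (simp add: set_integral_add set_integral_diff)
    also have "\<bar>\<dots>\<bar> \<le> (2 * C * C * (t - s)) * (t - s)"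
    proof (rule set_integral_Ioc_bound)
      fix r assume r: "s < r" "r \<le> t"
      have "f r * G t + F s * g r - k r = f r * (G t - G r) - (F r - F s) * g r"
        by (simp add: k_def algebra_simps)
      also have "\<bar>\<dots>\<bar> \<le> \<bar>f r\<bar> * \<bar>G t - G r\<bar> + \<bar>F r - F s\<bar> * \<bar>g r\<bar>"
        by (metis abs_mult abs_triangle_ineq4)
      also have "\<dots> \<le> C * (C * (t - s)) + (C * (t - s)) * C"
      proof (intro add_mono mult_mono)
        have "\<bar>G t - G r\<bar> \<le> C * (t - r)"
          using Gd[of r t] set_integral_Ioc_bound[of r t g C] g r st by auto
        also have "\<dots> \<le> C * (t - s)" using r C0 by (intro mult_left_mono) auto
        finally show "\<bar>G t - G r\<bar> \<le> C * (t - s)" .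
        have "\<bar>F r - F s\<bar> \<le> C * (r - s)"
          using Fd[of s r] set_integral_Ioc_bound[of s r f C] f r st by auto
        also have "\<dots> \<le> C * (t - s)" using r C0 by (intro mult_left_mono) auto
        finally show "\<bar>F r - F s\<bar> \<le> C * (t - s)" .
      qed (use f g C0 st r in auto)
      finally show "\<bar>f r * G t + F s * g r - k r\<bar> \<le> 2 * C * C * (t - s)"
        by (simp add: algebra_simps)
    qed (use st k(1) in auto)
    finally show "\<bar>H t - H s\<bar> \<le> 2 * C * C * (t - s)\<^sup>2"
      by (simp add: power2_eq_square algebra_simps)
  qed
  then show ?thesis
    by (simp add: H_def k_def set_lebesgue_integral_def)
qed

text \<open>Again by increments of second order: the mean value theorem gives exp (A t) - exp (A s)
  = exp c * (A t - A s) with c between A s and A t, and exp c differs from exp (A r) by O(t - s) for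
  every r in (s, t].\<close>

lemma exp_rule_bounded_density:
  fixes v :: "real \<Rightarrow> real"
  assumes v: "v \<in> borel_measurable borel" "\<And>x. \<bar>v x\<bar> \<le> C"
    and A: "\<And>t. A t = (LBINT s:{0<..t}. v s)" and AB: "A \<in> borel_measurable borel"
    and T: "T \<ge> 0"
  shows "exp (A T) = 1 + (LBINT s:{0<..T}. v s * exp (A s))"
proof -
  note [measurable] = v(1) AB
  have C0: "C \<ge> 0" using v(2) abs_ge_zero order_trans by blast
  have Ad: "A y - A x = (LBINT s:{x<..y}. v s)" if "0 \<le> x" "x \<le> y" for x y
    using A[of x] A[of y] set_integral_Ioc_add[OF v, of 0 x y] that by simp
  have Ad_bound: "\<bar>A y - A x\<bar> \<le> C * (y - x)" if "0 \<le> x" "x \<le> y" for x y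
    unfolding Ad[OF that] by (rule set_integral_Ioc_bound) (use v that in auto)
  have A0: "A 0 = 0" by (simp add: A set_lebesgue_integral_def)
  have Ale: "\<bar>A x\<bar> \<le> C * T" if "0 \<le> x" "x \<le> T" for x
  proof -
    have "\<bar>A x\<bar> \<le> C * x" using Ad_bound[of 0 x] A0 that by simp
    also have "\<dots> \<le> C * T" using C0 that by (intro mult_left_mono) auto
    finally show ?thesis .
  qed
  define E where "E = exp (C * T)"
  have E_Lip: "\<bar>exp x - exp y\<bar> \<le> E * \<bar>x - y\<bar>" if "\<bar>x\<bar> \<le> C * T" "\<bar>y\<bar> \<le> C * T" for x y
  proof (cases x y rule: linorder_cases)
    case less
    then obtain z where "x < z" "z < y" "exp y - exp x = (y - x) * exp z"
      using MVT2[of x y exp exp] by (auto intro: DERIV_exp)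
    moreover have "exp z \<le> E" using calculation that by (simp add: E_def)
    ultimately show ?thesis using less by (simp add: abs_mult mult.commute abs_minus_commute mult_left_mono)
  next
    case greater
    then obtain z where "y < z" "z < x" "exp x - exp y = (x - y) * exp z"
      using MVT2[of y x exp exp] by (auto intro: DERIV_exp)
    moreover have "exp z \<le> E" using calculation that by (simp add: E_def)
    ultimately show ?thesis using greater by (simp add: abs_mult mult.commute mult_left_mono)
  qed simp
  define k where "k s = v s * exp (A s)" for s
  \<comment> \<open>The exponential is controlled only up to time T; the cut-off gives a bound valid
    for all arguments.\<close>
  define k' where "k' s = (if 0 \<le> s \<and> s \<le> T then k s else 0)" for s
  have k': "k' \<in> borel_measurable borel" "\<And>x. \<bar>k' x\<bar> \<le> C * E"
    using v(2) Ale C0 unfolding k'_def k_def E_def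
    by (auto simp: abs_mult intro!: mult_mono dest: abs_le_D1)
  have kk: "(LBINT s:{x<..y}. k s) = (LBINT s:{x<..y}. k' s)" if "0 \<le> x" "y \<le> T" for x y
    by (rule set_lebesgue_integral_cong) (use that in \<open>auto simp: k'_def\<close>)
  define H where "H t = exp (A t) - (LBINT s:{0<..t}. k' s)" for t
  have "H T = H 0"
  proof (rule second_order_increments_const[OF T, where C = "C * C * E"])
    fix s t assume st: "0 \<le> s" "s \<le> t" "t \<le> T"
    obtain c where c: "min (A s) (A t) \<le> c" "c \<le> max (A s) (A t)" "exp (A t) - exp (A s) = exp c * (A t - A s)"
    proof (cases "A s" "A t" rule: linorder_cases)
      case less
      then obtain z where "A s < z" "z < A t" "exp (A t) - exp (A s) = (A t - A s) * exp z"
        using MVT2[of "A s" "A t" exp exp] by (auto intro: DERIV_exp)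
      then show ?thesis using that[of z] by (auto simp: mult.commute)
    next
      case greater
      then obtain z where "A t < z" "z < A s" "exp (A s) - exp (A t) = (A s - A t) * exp z"
        using MVT2[of "A t" "A s" exp exp] by (auto intro: DERIV_exp)
      then show ?thesis using that[of z] by (auto simp: algebra_simps)
    next
      case equal
      then show ?thesis using that[of "A s"] by auto
    qed
    have "H t - H s = exp (A t) - exp (A s) - (LBINT s:{s<..t}. k' s)"
      unfolding H_def using set_integral_Ioc_add[OF k', of 0 s t] st by (simp add: algebra_simps)
    also have "\<dots> = (LBINT r:{s<..t}. exp c * v r) - (LBINT s:{s<..t}. k' s)"
      using c Ad[of s t] st by simp
    also have "\<dots> = (LBINT r:{s<..t}. exp c * v r - k' r)"
      using set_integrable_bounded_Ioc[OF v] set_integrable_bounded_Ioc[OF k']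
      by (subst set_integral_diff) auto
    also have "\<bar>\<dots>\<bar> \<le> (C * C * E * (t - s)) * (t - s)"
    proof (rule set_integral_Ioc_bound)
      fix r assume r: "s < r" "r \<le> t"
      have "exp c * v r - k' r = v r * (exp c - exp (A r))"
        using r st by (simp add: k_def k'_def algebra_simps)
      also have "\<bar>\<dots>\<bar> = \<bar>v r\<bar> * \<bar>exp c - exp (A r)\<bar>"
        by (rule abs_mult)
      also have "\<dots> \<le> C * (E * (C * (t - s)))"
      proof (rule mult_mono)
        have "\<bar>c\<bar> \<le> C * T" using c(1,2) Ale[of s] Ale[of t] st by (auto simp: min_def max_def split: if_splits)
        then have "\<bar>exp c - exp (A r)\<bar> \<le> E * \<bar>c - A r\<bar>"
          using Ale[of r] r st by (intro E_Lip) auto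
        also have "\<dots> \<le> E * (C * (t - s))"
        proof (rule mult_left_mono)
          have "\<bar>A s - A r\<bar> \<le> C * (t - s)"
            using Ad_bound[of s r] r st mult_left_mono[of "r - s" "t - s" C] C0
            by (simp add: abs_minus_commute)
          moreover have "\<bar>A t - A r\<bar> \<le> C * (t - s)"
            using Ad_bound[of r t] r st mult_left_mono[of "t - r" "t - s" C] C0 by simp
          ultimately show "\<bar>c - A r\<bar> \<le> C * (t - s)"
            using c(1,2) by (auto simp: min_def max_def split: if_splits)
        qed (simp add: E_def)
        finally show "\<bar>exp c - exp (A r)\<bar> \<le> E * (C * (t - s))" .
      qed (use v C0 in auto)
      finally show "\<bar>exp c * v r - k' r\<bar> \<le> C * C * E * (t - s)"
        by (simp add: algebra_simps)
    qed (use st k' in auto)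
    finally show "\<bar>H t - H s\<bar> \<le> C * C * E * (t - s)\<^sup>2"
      by (simp add: power2_eq_square algebra_simps)
  qed
  then have "exp (A T) = 1 + (LBINT s:{0<..T}. k' s)"
    by (simp add: H_def A0 set_lebesgue_integral_def)
  then show ?thesis
    using kk[of 0 T] by (simp add: k_def)
qed

text \<open>The sum is the integral of the step function that evaluates \<open>c\<close> at the
  right end of the cell containing s. These sample points approach s from the right, so
  right-continuity suffices, which is the regularity that the paths of the process have.\<close>

lemma right_riemann_sums_tendsto:
  fixes c :: "real \<Rightarrow> real"
  assumes c: "c \<in> borel_measurable borel" "\<And>x. \<bar>c x\<bar> \<le> C"
    and rc: "\<And>s. s \<ge> 0 \<Longrightarrow> (c \<longlongrightarrow> c s) (at_right s)" and t: "t \<ge> 0"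
  shows "(\<lambda>n. \<Sum>j = 1..n. t / real n * c (real j * (t / real n))) \<longlonglongrightarrow> (LBINT s:{0<..t}. c s)"
proof (cases "t = 0")
  case True
  then show ?thesis by (simp add: set_lebesgue_integral_def)
next
  case False
  with t have t: "t > 0" by simp
  define h where "h n = t / real n" for n
  define G where "G n s = (\<Sum>j = 1..n. indicator {real (j - 1) * h n<..real j * h n} s * c (real j * h n))" for n s
  have h0: "h n > 0" if "n > 0" for n
    using t that by (simp add: h_def)
  have G_int: "(LBINT s. G n s) = (\<Sum>j = 1..n. h n * c (real j * h n))" for n
  proof (cases "n = 0")
    case False
    have "(LBINT s. G n s) = (\<Sum>j = 1..n. (LBINT s. indicator {real (j - 1) * h n<..real j * h n} s * c (real j * h n)))"
      unfolding G_def by (intro Bochner_Integration.integral_sum integrable_mult_left) (rule integrable_indicator_Ioc)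
    also have "\<dots> = (\<Sum>j = 1..n. h n * c (real j * h n))"
    proof (rule sum.cong)
      fix j assume j: "j \<in> {1..n}"
      then have "real (j - 1) = real j - 1" by auto
      then show "(LBINT s. indicator {real (j - 1) * h n<..real j * h n} s * c (real j * h n)) = h n * c (real j * h n)"
        using h0[of n] False by (simp add: algebra_simps)
    qed simp
    finally show ?thesis .
  qed (simp add: G_def)
  have G_eq: "G n s = c (real (nat \<lceil>s / h n\<rceil>) * h n)" if "n > 0" "0 < s" "s \<le> t" for n s
  proof -
    have hn: "h n > 0" using h0 that by simp
    define j0 where "j0 = nat \<lceil>s / h n\<rceil>"
    have pos: "\<lceil>s / h n\<rceil> > 0" using hn that by simp
    have "s / h n \<le> real n" using hn that t by (simp add: h_def field_simps)
    then have "\<lceil>s / h n\<rceil> \<le> int n" by (simp add: ceiling_le_iff)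
    with pos have "1 \<le> j0" "j0 \<le> n" unfolding j0_def by linarith+
    then have j0: "j0 \<in> {1..n}" by simp
    have iff: "s \<in> {real (j - 1) * h n<..real j * h n} \<longleftrightarrow> j = j0" if "j \<in> {1..n}" for j
    proof -
      have "real (j - 1) = real j - 1" using that by auto
      then have "s \<in> {real (j - 1) * h n<..real j * h n} \<longleftrightarrow> of_int (int j) - 1 < s / h n \<and> s / h n \<le> of_int (int j)"
        using hn by (simp add: field_simps)
      also have "\<dots> \<longleftrightarrow> \<lceil>s / h n\<rceil> = int j"
        by (simp add: ceiling_eq_iff)
      also have "\<dots> \<longleftrightarrow> j = j0" using pos by (auto simp: j0_def)
      finally show ?thesis .
    qed
    have "G n s = (\<Sum>j = 1..n. if j = j0 then c (real j * h n) else 0)"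
      unfolding G_def using iff by (intro sum.cong) (auto simp: indicator_def)
    also have "\<dots> = c (real j0 * h n)" using j0 by simp
    finally show ?thesis by (simp add: j0_def)
  qed
  have G_out: "G n s = 0" if "\<not> (0 < s \<and> s \<le> t)" "n > 0" for n s
  proof -
    have hn: "h n > 0" using h0 that by simp
    have "s \<notin> {real (j - 1) * h n<..real j * h n}" if j: "j \<in> {1..n}" for j
    proof
      assume "s \<in> {real (j - 1) * h n<..real j * h n}"
      moreover have "real j * h n \<le> t"
        using j t \<open>n > 0\<close> by (simp add: h_def field_simps)
      moreover have "0 \<le> real (j - 1) * h n" using hn by simp
      ultimately show False using that(1) \<open>\<not> (0 < s \<and> s \<le> t)\<close> by auto
    qed
    then show ?thesis unfolding G_def by (intro sum.neutral) auto
  qed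
  \<comment> \<open>The shifted index excludes n = 0, where the mesh t / 0 is 0 by convention and
    the description of \<open>G\<close> fails.\<close>
  have "(\<lambda>n. LBINT s. G (Suc n) s) \<longlonglongrightarrow> (LBINT s. indicator {0<..t} s * c s)"
  proof (rule integral_dominated_convergence[where w = "\<lambda>s. C * indicator {0<..t} s"])
    show "(\<lambda>s. indicator {0<..t} s * c s) \<in> borel_measurable lborel"
      using c by simp
    show "G (Suc n) \<in> borel_measurable lborel" for n
      unfolding G_def by measurable
    show "integrable lborel (\<lambda>s. C * indicator {0<..t} s :: real)"
      by (simp add: emeasure_Ioc_finite)
    show "AE s in lborel. norm (G (Suc n) s) \<le> C * indicator {0<..t} s" for n
    proof (rule AE_I2)
      fix s show "norm (G (Suc n) s) \<le> C * indicator {0<..t} s"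
        using G_eq[of "Suc n" s] G_out[of s "Suc n"] c(2)
        by (cases "0 < s \<and> s \<le> t") (auto simp: indicator_def)
    qed
    show "AE s in lborel. (\<lambda>n. G (Suc n) s) \<longlonglongrightarrow> indicator {0<..t} s * c s"
    proof (rule AE_I2)
      fix s
      show "(\<lambda>n. G (Suc n) s) \<longlonglongrightarrow> indicator {0<..t} s * c s"
      proof (cases "0 < s \<and> s \<le> t")
        case True
        define r where "r n = real (nat \<lceil>s / h (Suc n)\<rceil>) * h (Suc n)" for n
        have r: "s \<le> r n" "r n \<le> s + h (Suc n)" for n
        proof -
          have hn: "h (Suc n) > 0" using h0 by simp
          have "s / h (Suc n) > 0" using hn True by simp
          then have e: "real (nat \<lceil>s / h (Suc n)\<rceil>) = of_int \<lceil>s / h (Suc n)\<rceil>" by simp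
          define z where "z = real_of_int \<lceil>s / h (Suc n)\<rceil>"
          have "s / h (Suc n) \<le> z" "z \<le> s / h (Suc n) + 1"
            unfolding z_def by linarith+
          then show "s \<le> r n" "r n \<le> s + h (Suc n)"
            unfolding r_def e z_def[symmetric] using hn by (auto simp: field_simps)
        qed
        have "(\<lambda>n. s + h (Suc n)) \<longlonglongrightarrow> s + 0"
          unfolding h_def by (intro tendsto_add tendsto_const) real_asymp
        then have "r \<longlonglongrightarrow> s"
          using r by (intro tendsto_sandwich[of "\<lambda>_. s" r sequentially "\<lambda>n. s + h (Suc n)"]) auto
        moreover have "continuous (at s within {s..}) c"
          unfolding continuous_within at_within_Ici_at_right using rc True by simp
        ultimately have "(\<lambda>n. c (r n)) \<longlonglongrightarrow> c s"
          using r by (intro continuous_within_tendsto_compose[of s "{s..}" c r]) auto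
        then show ?thesis
          using True G_eq[of "Suc _" s] by (simp add: r_def indicator_def)
      next
        case False
        then show ?thesis using G_out[of s "Suc _"] by (auto simp: indicator_def)
      qed
    qed
  qed
  then have "(\<lambda>n. \<Sum>j = 1..Suc n. h (Suc n) * c (real j * h (Suc n))) \<longlonglongrightarrow> (LBINT s. indicator {0<..t} s * c s)"
    unfolding G_int .
  then have "(\<lambda>n. \<Sum>j = 1..n. h n * c (real j * h n)) \<longlonglongrightarrow> (LBINT s. indicator {0<..t} s * c s)"
    by (rule LIMSEQ_imp_Suc[where f = "\<lambda>n. \<Sum>j = 1..n. h n * c (real j * h n)"])
  then show ?thesis
    by (simp add: h_def set_lebesgue_integral_def)
qed

text \<open>Bounded second moments give uniform integrability: cutting a variable off at height c
  changes its mean by at most C / c, and the cut-off variables converge in mean by dominated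
  convergence. Fatou's lemma passes the moment bound to the limit.\<close>

lemma (in prob_space) integral_tendsto_of_bounded_second_moments:
  fixes Z :: "nat \<Rightarrow> 'a \<Rightarrow> real"
  assumes Z: "\<And>n. integrable M (\<lambda>\<omega>. (Z n \<omega>)\<^sup>2)" "\<And>n. Z n \<in> borel_measurable M"
    and Z': "Z' \<in> borel_measurable M"
    and lim: "AE \<omega> in M. (\<lambda>n. Z n \<omega>) \<longlonglongrightarrow> Z' \<omega>"
    and C: "\<And>n. (\<integral>\<omega>. (Z n \<omega>)\<^sup>2 \<partial>M) \<le> C"
  shows "integrable M (\<lambda>\<omega>. (Z' \<omega>)\<^sup>2)" "(\<integral>\<omega>. (Z' \<omega>)\<^sup>2 \<partial>M) \<le> C"
    "(\<lambda>n. \<integral>\<omega>. Z n \<omega> \<partial>M) \<longlonglongrightarrow> (\<integral>\<omega>. Z' \<omega> \<partial>M)"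
proof -
  note [measurable] = Z(2) Z'
  have C0: "C \<ge> 0" using C[of 0] by (rule order_trans[rotated]) simp
  have "(\<integral>\<^sup>+\<omega>. ennreal ((Z' \<omega>)\<^sup>2) \<partial>M) = (\<integral>\<^sup>+\<omega>. liminf (\<lambda>n. ennreal ((Z n \<omega>)\<^sup>2)) \<partial>M)"
  proof (rule nn_integral_cong_AE, use lim in eventually_elim)
    fix \<omega> assume "(\<lambda>n. Z n \<omega>) \<longlonglongrightarrow> Z' \<omega>"
    then have "(\<lambda>n. ennreal ((Z n \<omega>)\<^sup>2)) \<longlonglongrightarrow> ennreal ((Z' \<omega>)\<^sup>2)"
      by (intro tendsto_ennrealI tendsto_power)
    from lim_imp_Liminf[OF trivial_limit_sequentially this]
    show "ennreal ((Z' \<omega>)\<^sup>2) = liminf (\<lambda>n. ennreal ((Z n \<omega>)\<^sup>2))"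
      by (rule sym)
  qed
  also have "\<dots> \<le> liminf (\<lambda>n. \<integral>\<^sup>+\<omega>. ennreal ((Z n \<omega>)\<^sup>2) \<partial>M)"
    by (rule nn_integral_liminf) simp
  also have "\<dots> \<le> ennreal C"
  proof (rule Liminf_le)
    show "\<forall>\<^sub>F n in sequentially. (\<integral>\<^sup>+\<omega>. ennreal ((Z n \<omega>)\<^sup>2) \<partial>M) \<le> ennreal C"
      using Z(1) C by (intro always_eventually allI) (simp add: nn_integral_eq_integral ennreal_leI)
  qed simp
  finally have nn: "(\<integral>\<^sup>+\<omega>. ennreal ((Z' \<omega>)\<^sup>2) \<partial>M) \<le> ennreal C" .
  then show int: "integrable M (\<lambda>\<omega>. (Z' \<omega>)\<^sup>2)"
    by (intro integrableI_bounded) (auto intro: le_less_trans)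
  with nn show bd: "(\<integral>\<omega>. (Z' \<omega>)\<^sup>2 \<partial>M) \<le> C"
    using C0 by (simp add: nn_integral_eq_integral)
  have tr: "\<bar>(\<integral>\<omega>. Y \<omega> \<partial>M) - (\<integral>\<omega>. max (-c) (min c (Y \<omega>)) \<partial>M)\<bar> \<le> C / c"
    if [measurable]: "Y \<in> borel_measurable M" and Y: "integrable M (\<lambda>\<omega>. (Y \<omega>)\<^sup>2)" "(\<integral>\<omega>. (Y \<omega>)\<^sup>2 \<partial>M) \<le> C"
      and c: "c > 0" for Y c
  proof -
    have iY: "integrable M Y"
      by (rule square_integrable_imp_integrable) (use Y in auto)
    have iT: "integrable M (\<lambda>\<omega>. max (-c) (min c (Y \<omega>)))"
      by (rule integrable_const_bound[where B = c]) (use c in auto)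
    have "\<bar>(\<integral>\<omega>. Y \<omega> \<partial>M) - (\<integral>\<omega>. max (-c) (min c (Y \<omega>)) \<partial>M)\<bar>
       = \<bar>\<integral>\<omega>. Y \<omega> - max (-c) (min c (Y \<omega>)) \<partial>M\<bar>"
      using iY iT by simp
    also have "\<dots> \<le> (\<integral>\<omega>. (Y \<omega>)\<^sup>2 / c \<partial>M)"
    proof (rule integral_abs_le)
      fix \<omega>
      have "\<bar>Y \<omega> - max (-c) (min c (Y \<omega>))\<bar> * c \<le> (Y \<omega>)\<^sup>2"
      proof (cases "\<bar>Y \<omega>\<bar> \<le> c")
        case True
        then show ?thesis by (auto simp: max_def min_def abs_le_iff)
      next
        case False
        have "\<bar>Y \<omega> - max (-c) (min c (Y \<omega>))\<bar> * c \<le> \<bar>Y \<omega>\<bar> * \<bar>Y \<omega>\<bar>"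
          using False c by (intro mult_mono) (auto simp: max_def min_def abs_if split: if_splits)
        then show ?thesis by (simp add: power2_eq_square)
      qed
      then show "\<bar>Y \<omega> - max (-c) (min c (Y \<omega>))\<bar> \<le> (Y \<omega>)\<^sup>2 / c"
        using c by (simp add: field_simps)
    qed (use iY iT Y in auto)
    also have "\<dots> \<le> C / c"
      using Y c by (simp add: divide_right_mono)
    finally show ?thesis .
  qed
  show "(\<lambda>n. \<integral>\<omega>. Z n \<omega> \<partial>M) \<longlonglongrightarrow> (\<integral>\<omega>. Z' \<omega> \<partial>M)"
  proof (rule LIMSEQ_I)
    fix e :: real assume e: "e > 0"
    \<comment> \<open>The height at which each of the two truncation errors is below e / 3; the
      added 1 keeps it positive when C = 0.\<close>
    define c where "c = 3 * (C + 1) / e"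
    have c: "c > 0" "C / c < e / 3"
      using e C0 by (auto simp: c_def field_simps)
    have "(\<lambda>n. \<integral>\<omega>. max (-c) (min c (Z n \<omega>)) \<partial>M) \<longlonglongrightarrow> (\<integral>\<omega>. max (-c) (min c (Z' \<omega>)) \<partial>M)"
    proof (rule integral_dominated_convergence[where w = "\<lambda>_. c"])
      show "AE \<omega> in M. (\<lambda>n. max (- c) (min c (Z n \<omega>))) \<longlonglongrightarrow> max (- c) (min c (Z' \<omega>))"
        using lim by eventually_elim (intro tendsto_intros)
    qed (use c in auto)
    from LIMSEQ_D[OF this, of "e / 3"] e obtain N where
      N: "\<And>n. n \<ge> N \<Longrightarrow> \<bar>(\<integral>\<omega>. max (-c) (min c (Z n \<omega>)) \<partial>M) - (\<integral>\<omega>. max (-c) (min c (Z' \<omega>)) \<partial>M)\<bar> < e / 3"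
      by auto
    have "\<bar>(\<integral>\<omega>. Z n \<omega> \<partial>M) - (\<integral>\<omega>. Z' \<omega> \<partial>M)\<bar> < e" if "n \<ge> N" for n
      using N[OF that] tr[OF Z(2)[of n] Z(1)[of n] C[of n] c(1)] tr[OF Z' int bd c(1)] c(2) by linarith
    then show "\<exists>N. \<forall>n\<ge>N. norm ((\<integral>\<omega>. Z n \<omega> \<partial>M) - (\<integral>\<omega>. Z' \<omega> \<partial>M)) < e"
      by auto
  qed
qed

section \<open>Discrete-time Markov property\<close>

lemma (in prob_space) integrable_bounded:
  fixes f :: "'a \<Rightarrow> real"
  assumes "f \<in> borel_measurable M" "\<And>x. \<bar>f x\<bar> \<le> C"
  shows "integrable M f"
  by (rule integrable_const_bound[where B = C]) (use assms in auto)

lemma (in prob_space) expectation_abs_le: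
  fixes f :: "'a \<Rightarrow> real"
  assumes "f \<in> borel_measurable M" "\<And>x. \<bar>f x\<bar> \<le> C"
  shows "\<bar>\<integral>\<omega>. f \<omega> \<partial>M\<bar> \<le> C"
  using integral_abs_le[of M f "\<lambda>_. C"] integrable_bounded[OF assms] assms(2) by (simp add: prob_space)

definition bounded_continuous :: "(real \<Rightarrow> real) \<Rightarrow> bool" where
  "bounded_continuous V \<longleftrightarrow> continuous_on UNIV V \<and> (\<exists>C. \<forall>x. \<bar>V x\<bar> \<le> C)"

lemma bounded_continuous_borel [simp]: "bounded_continuous V \<Longrightarrow> bounded_borel V"
  unfolding bounded_continuous_def bounded_borel_def
  by (auto intro: borel_measurable_continuous_onI)

lemma bounded_continuous_const [simp]: "bounded_continuous (\<lambda>_. c)"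
  by (auto simp: bounded_continuous_def)

text \<open>The process after a change on a null set: every path starts at 0 and is
  right-continuous, and X is jointly measurable in time and \<omega>. Pathwise integrals can then be
  handled without exceptional sets. \<open>regular_modification\<close> supplies such a
  version.\<close>

locale symmetric_levy_path = prob_space M for M :: "'a measure" +
  fixes X :: "real \<Rightarrow> 'a \<Rightarrow> real"
  assumes X_pair: "(\<lambda>(t, \<omega>). X t \<omega>) \<in> borel_measurable (borel \<Otimes>\<^sub>M M)"
    and X_0: "X 0 \<omega> = 0"
    and X_right_cont: "t \<ge> 0 \<Longrightarrow> ((\<lambda>r. X r \<omega>) \<longlongrightarrow> X t \<omega>) (at_right t)"
    and X_indep: "0 \<le> s 0 \<Longrightarrow> mono s \<Longrightarrow>
        indep_vars (\<lambda>_. borel) (\<lambda>i \<omega>. X (s (Suc i)) \<omega> - X (s i) \<omega>) {..<n::nat}"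
    and X_stationary: "0 \<le> r \<Longrightarrow> r \<le> t \<Longrightarrow>
        distr M borel (\<lambda>\<omega>. X t \<omega> - X r \<omega>) = distr M borel (X (t - r))"
    and X_symm: "t \<ge> 0 \<Longrightarrow> distr M borel (\<lambda>\<omega>. - X t \<omega>) = distr M borel (X t)"
begin

sublocale PL: pair_sigma_finite lborel M
  by unfold_locales

lemma measurable_X' [measurable (raw)]:
  assumes [measurable]: "f \<in> borel_measurable N" "g \<in> measurable N M"
  shows "(\<lambda>z. X (f z) (g z)) \<in> borel_measurable N"
proof -
  have "(\<lambda>z. (f z, g z)) \<in> measurable N (borel \<Otimes>\<^sub>M M)"
    by measurable
  from measurable_compose[OF this X_pair] show ?thesis
    by simp
qed

definition trans :: "real \<Rightarrow> (real \<Rightarrow> real) \<Rightarrow> real \<Rightarrow> real" where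
  "trans d f x = (\<integral>\<omega>. f (x - X d \<omega>) \<partial>M)"

lemma measurable_trans [measurable (raw)]:
  assumes f: "f \<in> borel_measurable borel" and [measurable]: "d \<in> borel_measurable N" "g \<in> borel_measurable N"
  shows "(\<lambda>z. trans (d z) f (g z)) \<in> borel_measurable N"
  unfolding trans_def using f by measurable

lemma trans_abs_le:
  assumes "bounded_borel f" "\<And>x. \<bar>f x\<bar> \<le> C"
  shows "\<bar>trans d f x\<bar> \<le> C"
  unfolding trans_def using assms by (intro expectation_abs_le) (auto dest: bounded_borel_measurable)

lemma bounded_borel_trans [simp]: "bounded_borel f \<Longrightarrow> bounded_borel (trans d f)"
proof -
  assume f: "bounded_borel f"
  then obtain C where "\<And>x. \<bar>f x\<bar> \<le> C"
    by (metis bounded_borelE)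
  with f show ?thesis
    by (intro bounded_borelI[OF _ trans_abs_le]) (auto dest: bounded_borel_measurable)
qed

text \<open>The values of X at s 0, ..., s n are partial sums of the first n increments. The next
  increment is independent of these and, by stationarity, has the law of X at time s (Suc n) - s n;
  averaging over it alone turns k into \<open>trans\<close>.\<close>

lemma expectation_one_step:
  fixes s :: "nat \<Rightarrow> real"
  assumes s0: "s 0 = 0" and mono: "mono s"
    and g: "\<And>i. i \<le> n \<Longrightarrow> bounded_borel (g i)" and k: "bounded_borel k"
  shows "(\<integral>\<omega>. (\<Prod>i\<le>n. g i (X (s i) \<omega>)) * k (x - X (s (Suc n)) \<omega>) \<partial>M) =
         (\<integral>\<omega>. (\<Prod>i\<le>n. g i (X (s i) \<omega>)) * trans (s (Suc n) - s n) k (x - X (s n) \<omega>) \<partial>M)"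
proof -
  have s_nonneg: "0 \<le> s i" for i
    using monoD[OF mono, of 0 i] s0 by simp
  define D where "D i \<omega> = X (s (Suc i)) \<omega> - X (s i) \<omega>" for i \<omega>
  have [measurable]: "D i \<in> borel_measurable M" for i
    unfolding D_def by measurable
  have X_sum: "X (s i) \<omega> = (\<Sum>j<i. D j \<omega>)" for i \<omega>
    unfolding D_def by (subst sum_lessThan_telescope) (simp add: s0 X_0)
  let ?P = "PiM {..<n} (\<lambda>_. borel :: real measure)"
  \<comment> \<open>The past is coded as the vector of the first n increments, and below the last
    increment as a vector over the singleton {n}, because independence is available for blocks of
    coordinates.\<close>
  define T where "T \<omega> = restrict (\<lambda>i. D i \<omega>) {..<n}" for \<omega>
  have T [measurable]: "T \<in> measurable M ?P"
    unfolding T_def by (intro measurable_restrict) simp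
  let ?Q = "PiM {n} (\<lambda>_. borel :: real measure)"
  define T' where "T' \<omega> = restrict (\<lambda>i. D i \<omega>) {n}" for \<omega>
  have T' [measurable]: "T' \<in> measurable M ?Q"
    unfolding T'_def by (intro measurable_restrict) simp
  define H where "H \<tau> = (\<Prod>i\<le>n. g i (\<Sum>j<i. \<tau> j))" for \<tau> :: "nat \<Rightarrow> real"
  define S where "S \<tau> = (\<Sum>j<n. \<tau> j)" for \<tau> :: "nat \<Rightarrow> real"
  have proj: "(\<lambda>\<tau>. \<tau> j) \<in> borel_measurable ?P" if "j < n" for j
    using that by (intro measurable_component_singleton) auto
  have [measurable]: "S \<in> borel_measurable ?P"
    unfolding S_def using proj by (intro borel_measurable_sum) auto
  have [measurable]: "H \<in> borel_measurable ?P"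
    unfolding H_def
  proof (rule borel_measurable_prod)
    fix i assume i: "i \<in> {..n}"
    have "(\<lambda>\<tau>. \<Sum>j<i. \<tau> j) \<in> borel_measurable ?P"
      using proj i by (intro borel_measurable_sum) auto
    moreover have "g i \<in> borel_measurable borel"
      using g[of i] i by (auto dest: bounded_borel_measurable)
    ultimately show "(\<lambda>\<tau>. g i (\<Sum>j<i. \<tau> j)) \<in> borel_measurable ?P"
      by (rule measurable_compose)
  qed
  have [measurable]: "k \<in> borel_measurable borel"
    using k by (rule bounded_borel_measurable)
  have HT: "H (T \<omega>) = (\<Prod>i\<le>n. g i (X (s i) \<omega>))" for \<omega>
    unfolding H_def X_sum by (intro prod.cong arg_cong[where f = "g _"] sum.cong) (auto simp: T_def)
  have ST: "S (T \<omega>) = X (s n) \<omega>" for \<omega>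
    unfolding S_def X_sum by (intro sum.cong) (auto simp: T_def)
  obtain C where C: "C \<ge> 0" "\<And>x. \<bar>k x\<bar> \<le> C"
    using k by (metis bounded_borelE)
  have "\<forall>i. \<exists>b. i \<le> n \<longrightarrow> (\<forall>x. \<bar>g i x\<bar> \<le> b)"
    using g unfolding bounded_borel_def by blast
  then obtain B where B: "\<And>i x. i \<le> n \<Longrightarrow> \<bar>g i x\<bar> \<le> B i" by metis
  have H_bound: "\<bar>H \<tau>\<bar> \<le> (\<Prod>i\<le>n. B i)" for \<tau>
    unfolding H_def abs_prod using B by (intro prod_mono) auto
  have "indep_vars (\<lambda>_. borel) D {..<Suc n}"
    unfolding D_def using s_nonneg mono by (intro X_indep) auto
  from indep_var_restrict[OF this, of "{..<n}" "{n}"]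
  have indep: "indep_var ?P T ?Q T'"
    unfolding T_def T'_def by auto
  have joint: "distr M (?P \<Otimes>\<^sub>M ?Q) (\<lambda>\<omega>. (T \<omega>, T' \<omega>)) = distr M ?P T \<Otimes>\<^sub>M distr M ?Q T'"
    using indep unfolding indep_var_distribution_eq by simp
  have law: "distr M borel (D n) = distr M borel (X (s (Suc n) - s n))"
    unfolding D_def using s_nonneg mono by (intro X_stationary) (auto simp: mono_def)
  interpret T': prob_space "distr M ?Q T'"
    by (rule prob_space_distr) simp
  interpret T: prob_space "distr M ?P T"
    by (rule prob_space_distr) simp
  interpret TT: pair_prob_space "distr M ?P T" "distr M ?Q T'"
    by unfold_locales
  define h where "h = (\<lambda>(\<tau>, \<tau>' :: nat \<Rightarrow> real). H \<tau> * k (x - S \<tau> - \<tau>' n))"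
  have h_meas [measurable]: "h \<in> borel_measurable (?P \<Otimes>\<^sub>M ?Q)"
    unfolding h_def by measurable
  have h_bound: "\<bar>h z\<bar> \<le> (\<Prod>i\<le>n. B i) * C" for z
    unfolding h_def using H_bound C by (cases z) (auto simp: abs_mult intro!: mult_mono order_trans[OF abs_ge_zero H_bound])
  have h_int: "integrable (distr M ?P T \<Otimes>\<^sub>M distr M ?Q T') h"
    by (rule TT.integrable_bounded[OF _ h_bound]) (simp cong: measurable_cong_sets)
  have "(\<integral>\<omega>. (\<Prod>i\<le>n. g i (X (s i) \<omega>)) * k (x - X (s (Suc n)) \<omega>) \<partial>M) = (\<integral>\<omega>. h (T \<omega>, T' \<omega>) \<partial>M)"
    by (simp add: h_def HT ST T'_def) (simp add: D_def)
  also have "\<dots> = (\<integral>z. h z \<partial>distr M (?P \<Otimes>\<^sub>M ?Q) (\<lambda>\<omega>. (T \<omega>, T' \<omega>)))"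
    by (subst integral_distr) auto
  also have "\<dots> = (\<integral>\<tau>. \<integral>\<tau>'. h (\<tau>, \<tau>') \<partial>distr M ?Q T' \<partial>distr M ?P T)"
    unfolding joint using TT.integral_fst'[OF h_int] by simp
  also have "\<dots> = (\<integral>\<omega>. \<integral>\<tau>'. h (T \<omega>, \<tau>') \<partial>distr M ?Q T' \<partial>M)"
    by (subst integral_distr) auto
  also have "\<dots> = (\<integral>\<omega>. \<integral>\<omega>'. h (T \<omega>, T' \<omega>') \<partial>M \<partial>M)"
  proof -
    have "T \<omega> \<in> space ?P" for \<omega>
      by (simp add: space_PiM T_def)
    from measurable_Pair2[OF h_meas this] show ?thesis
      by (subst integral_distr) auto
  qed
  also have "\<dots> = (\<integral>\<omega>. (\<Prod>i\<le>n. g i (X (s i) \<omega>)) * (\<integral>\<omega>'. k (x - X (s n) \<omega> - D n \<omega>') \<partial>M) \<partial>M)"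
    by (simp add: h_def HT ST T'_def)
  also have "\<dots> = (\<integral>\<omega>. (\<Prod>i\<le>n. g i (X (s i) \<omega>)) * trans (s (Suc n) - s n) k (x - X (s n) \<omega>) \<partial>M)"
  proof -
    have "(\<integral>\<omega>'. k (y - D n \<omega>') \<partial>M) = trans (s (Suc n) - s n) k y" for y
    proof -
      have "(\<integral>\<omega>'. k (y - D n \<omega>') \<partial>M) = (\<integral>d. k (y - d) \<partial>distr M borel (D n))"
        by (subst integral_distr) auto
      also have "\<dots> = trans (s (Suc n) - s n) k y"
        unfolding law trans_def by (subst integral_distr) auto
      finally show ?thesis .
    qed
    then show ?thesis by simp
  qed
  finally show ?thesis .
qed

text \<open>One factor of a Trotter product: multiply by the weight \<open>w\<close>, then let the
  free process run for time \<open>h\<close>. With w = exp (h V) the iterates approximate the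
  Feynman--Kac semigroup.\<close>

definition step :: "real \<Rightarrow> (real \<Rightarrow> real) \<Rightarrow> (real \<Rightarrow> real) \<Rightarrow> real \<Rightarrow> real" where
  "step h w f = trans h (\<lambda>y. w y * f y)"

lemma bounded_borel_step [simp]: "bounded_borel w \<Longrightarrow> bounded_borel f \<Longrightarrow> bounded_borel (step h w f)"
  by (simp add: step_def)

lemma bounded_borel_step_funpow [simp]:
  "bounded_borel w \<Longrightarrow> bounded_borel f \<Longrightarrow> bounded_borel ((step h w ^^ n) f)"
  by (induction n) auto

text \<open>Induction peels off the last time: its weight and k merge into
  \<open>step h w k\<close>, to be evaluated one step earlier. The factors \<open>g\<close> on the
  past are carried along so that the result is a Markov property at time s n and not just a formula
  for an expectation from time 0.\<close>

lemma expectation_multi_step: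
  fixes s :: "nat \<Rightarrow> real"
  assumes s0: "s 0 = 0" and mono: "mono s" and h: "h \<ge> 0"
    and g: "\<And>i. i \<le> n \<Longrightarrow> bounded_borel (g i)" and k: "bounded_borel k" and w: "bounded_borel w"
  shows "(\<integral>\<omega>. (\<Prod>i\<le>n. g i (X (s i) \<omega>)) * ((\<Prod>j = 1..m. w (x - X (s n + real j * h) \<omega>)) * k (x - X (s n + real m * h) \<omega>)) \<partial>M) =
         (\<integral>\<omega>. (\<Prod>i\<le>n. g i (X (s i) \<omega>)) * (step h w ^^ m) k (x - X (s n) \<omega>) \<partial>M)"
  using k
proof (induction m arbitrary: k)
  case (Suc m)
  \<comment> \<open>Old times and the first m new times are merged into one increasing sequence, so
    that the weights already passed count as factors on the past.\<close>
  define s' where "s' i = (if i \<le> n then s i else s n + real (i - n) * h)" for i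
  define g' where "g' i = (if i \<le> n then g i else (\<lambda>y. w (x - y)))" for i
  have [measurable]: "w \<in> borel_measurable borel" using w by (rule bounded_borel_measurable)
  have g'_bd: "bounded_borel (g' i)" for i
  proof -
    obtain C where "\<And>x. \<bar>w x\<bar> \<le> C" using w by (metis bounded_borelE)
    then have "bounded_borel (\<lambda>y. w (x - y))" by (intro bounded_borelI[of _ C]) auto
    then show ?thesis using g by (auto simp: g'_def)
  qed
  have mono': "mono s'"
  proof (rule incseq_SucI)
    fix i
    consider "Suc i \<le> n" | "i = n" | "i > n" by linarith
    then show "s' i \<le> s' (Suc i)"
    proof cases
      case 1 then show ?thesis using mono by (auto simp: s'_def mono_def)
    next
      case 2 then show ?thesis using h by (simp add: s'_def)
    next
      case 3 then show ?thesis using h by (auto simp: s'_def Suc_diff_le intro!: mult_right_mono)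
    qed
  qed
  have prod': "(\<Prod>i\<le>n + m. g' i (X (s' i) \<omega>)) =
      (\<Prod>i\<le>n. g i (X (s i) \<omega>)) * (\<Prod>j = 1..m. w (x - X (s n + real j * h) \<omega>))" for \<omega>
  proof -
    have "{..n + m} = {..n} \<union> {n + 1..n + m}" by auto
    then have "(\<Prod>i\<le>n + m. g' i (X (s' i) \<omega>)) = (\<Prod>i\<le>n. g' i (X (s' i) \<omega>)) * (\<Prod>i = n + 1..n + m. g' i (X (s' i) \<omega>))"
      by (simp add: prod.union_disjoint)
    also have "(\<Prod>i\<le>n. g' i (X (s' i) \<omega>)) = (\<Prod>i\<le>n. g i (X (s i) \<omega>))"
      by (intro prod.cong) (auto simp: g'_def s'_def)
    also have "(\<Prod>i = n + 1..n + m. g' i (X (s' i) \<omega>)) = (\<Prod>j = 1..m. w (x - X (s n + real j * h) \<omega>))"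
      by (rule prod.reindex_bij_witness[of _ "\<lambda>j. n + j" "\<lambda>i. i - n"]) (auto simp: g'_def s'_def)
    finally show ?thesis .
  qed
  have s'_end: "s' (n + m) = s n + real m * h" "s' (Suc (n + m)) = s n + real (Suc m) * h"
    by (auto simp: s'_def)
  then have d: "s' (Suc (n + m)) - s' (n + m) = h"
    by (simp add: algebra_simps)
  have "(\<integral>\<omega>. (\<Prod>i\<le>n. g i (X (s i) \<omega>)) * ((\<Prod>j = 1..Suc m. w (x - X (s n + real j * h) \<omega>)) * k (x - X (s n + real (Suc m) * h) \<omega>)) \<partial>M)
      = (\<integral>\<omega>. (\<Prod>i\<le>n + m. g' i (X (s' i) \<omega>)) * (\<lambda>y. w y * k y) (x - X (s' (Suc (n + m))) \<omega>) \<partial>M)"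
    unfolding prod' s'_end by (simp add: mult.assoc)
  also have "\<dots> = (\<integral>\<omega>. (\<Prod>i\<le>n + m. g' i (X (s' i) \<omega>)) * step h w k (x - X (s' (n + m)) \<omega>) \<partial>M)"
    using expectation_one_step[OF _ mono', of "n + m" g' "\<lambda>y. w y * k y" x] g'_bd w Suc.prems s0
    unfolding d by (simp add: s'_def[of 0] step_def)
  also have "\<dots> = (\<integral>\<omega>. (\<Prod>i\<le>n. g i (X (s i) \<omega>)) * ((\<Prod>j = 1..m. w (x - X (s n + real j * h) \<omega>)) * step h w k (x - X (s n + real m * h) \<omega>)) \<partial>M)"
    unfolding prod' s'_end by (simp add: mult.assoc)
  also have "\<dots> = (\<integral>\<omega>. (\<Prod>i\<le>n. g i (X (s i) \<omega>)) * (step h w ^^ m) (step h w k) (x - X (s n) \<omega>) \<partial>M)"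
    using w Suc.prems by (intro Suc.IH) simp
  finally show ?case
    by (simp only: funpow_Suc_right o_def)
qed simp

section \<open>Additive functionals and Feynman--Kac operators\<close>

definition clock :: "(real \<Rightarrow> real) \<Rightarrow> real \<Rightarrow> real \<Rightarrow> 'a \<Rightarrow> real" where
  "clock V x t \<omega> = (LBINT s:{0<..t}. V (x - X s \<omega>))"

definition FK :: "(real \<Rightarrow> real) \<Rightarrow> real \<Rightarrow> (real \<Rightarrow> real) \<Rightarrow> real \<Rightarrow> real" where
  "FK V t f x = (\<integral>\<omega>. f (x - X t \<omega>) * exp (clock V x t \<omega>) \<partial>M)"

lemma measurable_clock [measurable (raw)]:
  assumes V: "V \<in> borel_measurable borel"
    and [measurable]: "f \<in> borel_measurable N" "g \<in> borel_measurable N" "h \<in> measurable N M"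
  shows "(\<lambda>z. clock V (f z) (g z) (h z)) \<in> borel_measurable N"
proof -
  note [measurable] = V
  have "(\<lambda>z. clock V (f z) (g z) (h z)) = (\<lambda>z. LBINT s. (if 0 < s \<and> s \<le> g z then V (f z - X s (h z)) else 0))"
    unfolding clock_def set_lebesgue_integral_def
    by (intro ext Bochner_Integration.integral_cong) (auto simp: indicator_def)
  also have "\<dots> \<in> borel_measurable N"
    by measurable
  finally show ?thesis .
qed

lemma measurable_FK [measurable (raw)]:
  assumes V: "V \<in> borel_measurable borel" and f: "f \<in> borel_measurable borel"
    and [measurable]: "d \<in> borel_measurable N" "g \<in> borel_measurable N"
  shows "(\<lambda>z. FK V (d z) f (g z)) \<in> borel_measurable N"
  unfolding FK_def using V f by measurable

lemma clock_0 [simp]: "clock V x 0 \<omega> = 0"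
  by (simp add: clock_def set_lebesgue_integral_def)

lemma FK_0 [simp]: "FK V 0 f x = f x"
  by (simp add: FK_def X_0 prob_space)

lemma clock_abs_le:
  assumes "\<And>x. \<bar>V x\<bar> \<le> C" "t \<ge> 0"
  shows "\<bar>clock V x t \<omega>\<bar> \<le> C * t"
  unfolding clock_def using set_integral_Ioc_bound[of 0 t "\<lambda>s. V (x - X s \<omega>)" C] assms by simp

end

section \<open>Feynman--Kac semigroup\<close>

context symmetric_levy_path
begin

text \<open>Right Riemann sum with n cells for the integral of V (x - X (s + r)) over r in (0, t].
  It samples the path at finitely many times, which is what the discrete Markov property can
  treat.\<close>

definition rclock :: "(real \<Rightarrow> real) \<Rightarrow> real \<Rightarrow> real \<Rightarrow> real \<Rightarrow> nat \<Rightarrow> 'a \<Rightarrow> real" where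
  "rclock V x s t n \<omega> = (\<Sum>j = 1..n. t / real n * V (x - X (s + real j * (t / real n)) \<omega>))"

lemma measurable_rclock [measurable (raw)]:
  assumes [measurable]: "V \<in> borel_measurable borel"
  shows "rclock V x s t n \<in> borel_measurable M"
  unfolding rclock_def by measurable

lemma rclock_abs_le:
  assumes "\<And>x. \<bar>V x\<bar> \<le> C" "t \<ge> 0"
  shows "\<bar>rclock V x s t n \<omega>\<bar> \<le> C * t"
proof -
  have C: "C \<ge> 0" using assms(1) abs_ge_zero order_trans by blast
  have "\<bar>rclock V x s t n \<omega>\<bar> \<le> (\<Sum>j = 1..n. t / real n * C)"
    unfolding rclock_def using assms
    by (intro order_trans[OF sum_abs] sum_mono) (auto simp: abs_mult intro!: mult_left_mono divide_right_mono)
  also have "\<dots> \<le> C * t"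
    using assms C by (cases "n = 0") auto
  finally show ?thesis .
qed

lemma measurable_path:
  "\<omega> \<in> space M \<Longrightarrow> V \<in> borel_measurable borel \<Longrightarrow> (\<lambda>r. V (x - X (s + r) \<omega>)) \<in> borel_measurable borel"
  by (rule measurable_compose[where N = borel]) measurable

lemma rclock_tendsto:
  assumes V: "bounded_continuous V" and "t \<ge> 0" "s \<ge> 0" and \<omega>: "\<omega> \<in> space M"
  shows "(\<lambda>n. rclock V x s t n \<omega>) \<longlonglongrightarrow> (LBINT r:{0<..t}. V (x - X (s + r) \<omega>))"
proof -
  obtain C where C: "\<And>x. \<bar>V x\<bar> \<le> C" using V by (auto simp: bounded_continuous_def)
  have V_cont: "isCont V y" for y
    using V by (auto simp: bounded_continuous_def continuous_on_eq_continuous_at)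
  show ?thesis
    unfolding rclock_def
  proof (rule right_riemann_sums_tendsto[where c = "\<lambda>r. V (x - X (s + r) \<omega>)"])
    show "(\<lambda>r. V (x - X (s + r) \<omega>)) \<in> borel_measurable borel"
      using V \<omega> by (intro measurable_path) (auto dest: bounded_continuous_borel)
    fix u :: real assume "u \<ge> 0"
    then have "((\<lambda>r. X r \<omega>) \<longlongrightarrow> X (s + u) \<omega>) (at_right (s + u))"
      using \<open>s \<ge> 0\<close> by (intro X_right_cont) auto
    moreover have "filterlim (\<lambda>r. s + r) (at_right (s + u)) (at_right u)"
      unfolding filterlim_at by (auto intro!: tendsto_intros simp: eventually_at_filter)
    ultimately have "((\<lambda>r. X (s + r) \<omega>) \<longlongrightarrow> X (s + u) \<omega>) (at_right u)"
      by (rule filterlim_compose)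
    then show "((\<lambda>r. V (x - X (s + r) \<omega>)) \<longlongrightarrow> V (x - X (s + u) \<omega>)) (at_right u)"
      by (intro isCont_tendsto_compose[OF V_cont] tendsto_intros)
  qed (use C assms in auto)
qed

lemma step_funpow_eq:
  assumes V: "bounded_borel V" and k: "bounded_borel k" and t: "t \<ge> 0" and n: "n > 0"
  shows "(step (t / real n) (\<lambda>y. exp (t / real n * V y)) ^^ n) k y =
         (\<integral>\<omega>. exp (rclock V y 0 t n \<omega>) * k (y - X t \<omega>) \<partial>M)"
proof -
  have "(\<integral>\<omega>. (\<Prod>i\<le>0. (1 :: real)) *
         ((\<Prod>j = 1..n. exp (t / real n * V (y - X (0 + real j * (t / real n)) \<omega>))) *
           k (y - X (0 + real n * (t / real n)) \<omega>)) \<partial>M) =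
         (\<integral>\<omega>. (\<Prod>i\<le>0. (1 :: real)) *
         (step (t / real n) (\<lambda>y. exp (t / real n * V y)) ^^ n) k (y - X 0 \<omega>) \<partial>M)"
    using expectation_multi_step[where s = "\<lambda>_. 0" and n = 0 and g = "\<lambda>_ _. 1" and h = "t / real n" and k = k
      and w = "\<lambda>y. exp (t / real n * V y)" and x = y and m = n]
    t n V k by (auto simp: mono_def)
  then show ?thesis
    using n by (simp add: X_0 prob_space rclock_def exp_sum)
qed

lemma step_funpow_abs_le:
  assumes V: "bounded_borel V" "\<And>x. \<bar>V x\<bar> \<le> B" and t: "t \<ge> 0"
    and k: "bounded_borel k" "\<And>x. \<bar>k x\<bar> \<le> C"
  shows "\<bar>(step (t / real (Suc n)) (\<lambda>y. exp (t / real (Suc n) * V y)) ^^ Suc n) k y\<bar> \<le> exp (B * t) * C"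
proof -
  note [measurable] = bounded_borel_measurable[OF V(1)] bounded_borel_measurable[OF k(1)]
  have "exp (rclock V y 0 t (Suc n) \<omega>) * \<bar>k x\<bar> \<le> exp (B * t) * C" for \<omega> x
    using rclock_abs_le[of V B t y 0 "Suc n" \<omega>, OF V(2) t] k(2) by (intro mult_mono) auto
  then show ?thesis
    unfolding step_funpow_eq[OF V(1) k(1) t zero_less_Suc] by (intro expectation_abs_le) (auto simp: abs_mult)
qed

text \<open>The function k may vary with n: the symmetry argument needs this, because the adjoint of
  a Trotter product carries one extra weight that is absorbed into the function.\<close>

lemma step_funpow_tendsto:
  assumes V: "bounded_continuous V" and t: "t \<ge> 0"
    and k: "\<And>n. bounded_borel (k n)" "\<And>n x. \<bar>k n x\<bar> \<le> C" "\<And>x. (\<lambda>n. k n x) \<longlonglongrightarrow> k' x"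
  shows "(\<lambda>n. (step (t / real (Suc n)) (\<lambda>y. exp (t / real (Suc n) * V y)) ^^ Suc n) (k n) y) \<longlonglongrightarrow> FK V t k' y"
proof -
  have Vb: "bounded_borel V" using V by simp
  have k': "k' \<in> borel_measurable borel"
    by (rule borel_measurable_LIMSEQ_real[of _ k]) (use k in auto)
  note [measurable] = bounded_borel_measurable[OF Vb] k(1)[THEN bounded_borel_measurable] k'
  obtain B where B: "\<And>x. \<bar>V x\<bar> \<le> B" using Vb by (metis bounded_borelE)
  have bd: "\<bar>k n x\<bar> * exp (rclock V y 0 t (Suc n) \<omega>) \<le> C * exp (B * t)" for n \<omega> x
    using rclock_abs_le[of V B t y 0 "Suc n" \<omega>, OF B t] k(2)[of n] order_trans[OF abs_ge_zero k(2)]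
    by (intro mult_mono) auto
  show ?thesis
    unfolding step_funpow_eq[OF Vb k(1) t zero_less_Suc] FK_def mult.commute[of "exp _"]
  proof (rule integral_dominated_convergence[where w = "\<lambda>_. C * exp (B * t)"])
    show "AE \<omega> in M. (\<lambda>n. k n (y - X t \<omega>) * exp (rclock V y 0 t (Suc n) \<omega>)) \<longlonglongrightarrow> k' (y - X t \<omega>) * exp (clock V y t \<omega>)"
    proof (rule AE_I2)
      fix \<omega> assume "\<omega> \<in> space M"
      then have "(\<lambda>n. rclock V y 0 t n \<omega>) \<longlonglongrightarrow> clock V y t \<omega>"
        using rclock_tendsto[OF V t, of 0 \<omega> y] by (simp add: clock_def)
      from LIMSEQ_Suc[OF this]
      show "(\<lambda>n. k n (y - X t \<omega>) * exp (rclock V y 0 t (Suc n) \<omega>)) \<longlonglongrightarrow> k' (y - X t \<omega>) * exp (clock V y t \<omega>)"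
        by (intro tendsto_intros k)
    qed
    show "AE \<omega> in M. norm (k n (y - X t \<omega>) * exp (rclock V y 0 t (Suc n) \<omega>)) \<le> C * exp (B * t)" for n
      using bd by (intro AE_I2) (auto simp: abs_mult)
  qed auto
qed

lemma FK_abs_le:
  assumes V: "\<And>x. \<bar>V x\<bar> \<le> B" "V \<in> borel_measurable borel" and f: "f \<in> borel_measurable borel" "\<And>x. \<bar>f x\<bar> \<le> C" and t: "t \<ge> 0"
  shows "\<bar>FK V t f x\<bar> \<le> exp (B * t) * C"
proof -
  note [measurable] = V(2) f(1)
  have "\<bar>f (x - X t \<omega>) * exp (clock V x t \<omega>)\<bar> \<le> exp (B * t) * C" for \<omega>
    using clock_abs_le[of V B t x \<omega>, OF V(1) t] f(2)
    by (subst mult.commute) (auto simp: abs_mult intro!: mult_mono)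
  then show ?thesis
    unfolding FK_def by (intro expectation_abs_le) auto
qed

lemma bounded_borel_FK [simp]:
  assumes V: "bounded_borel V" and f: "bounded_borel f" and t: "t \<ge> 0"
  shows "bounded_borel (FK V t f)"
proof -
  obtain B C where "\<And>x. \<bar>V x\<bar> \<le> B" "\<And>x. \<bar>f x\<bar> \<le> C" using V f by (metis bounded_borelE)
  then show ?thesis
    using assms by (intro bounded_borelI[of _ "exp (B * t) * C"] FK_abs_le) (auto dest: bounded_borel_measurable)
qed

text \<open>For Riemann sums in place of both clocks this is the discrete Markov property; dominated
  convergence passes to the limit. Two potentials are allowed because W = V yields the semigroup
  law, while W = 0 yields the Markov property of the free motion after a weighted past.\<close>

lemma FK_markov:
  assumes V: "bounded_continuous V" and W: "bounded_continuous W"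
    and F: "bounded_borel F" and k: "bounded_borel k" and s: "s \<ge> 0" and t: "t \<ge> 0"
  shows "(\<integral>\<omega>. exp (clock V x s \<omega>) * F (x - X s \<omega>) *
            (exp (LBINT r:{0<..t}. W (x - X (s + r) \<omega>)) * k (x - X (s + t) \<omega>)) \<partial>M) =
         (\<integral>\<omega>. exp (clock V x s \<omega>) * F (x - X s \<omega>) * FK W t k (x - X s \<omega>) \<partial>M)"
proof -
  have Vb: "bounded_borel V" and Wb: "bounded_borel W" using V W by auto
  note [measurable] = bounded_borel_measurable[OF Vb] bounded_borel_measurable[OF Wb]
    bounded_borel_measurable[OF F] bounded_borel_measurable[OF k]
  obtain BV where BV: "BV \<ge> 0" "\<And>x. \<bar>V x\<bar> \<le> BV" using Vb by (metis bounded_borelE)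
  obtain BW where BW: "BW \<ge> 0" "\<And>x. \<bar>W x\<bar> \<le> BW" using Wb by (metis bounded_borelE)
  obtain BF where BF: "BF \<ge> 0" "\<And>x. \<bar>F x\<bar> \<le> BF" using F by (metis bounded_borelE)
  obtain Bk where Bk: "Bk \<ge> 0" "\<And>x. \<bar>k x\<bar> \<le> Bk" using k by (metis bounded_borelE)
  define K where "K n = (step (t / real (Suc n)) (\<lambda>y. exp (t / real (Suc n) * W y)) ^^ Suc n) k" for n
  have Km [measurable]: "K n \<in> borel_measurable borel" for n
    unfolding K_def using Wb k by (intro bounded_borel_measurable bounded_borel_step_funpow) auto
  have K_lim: "(\<lambda>n. K n y) \<longlonglongrightarrow> FK W t k y" for y
    unfolding K_def by (rule step_funpow_tendsto[OF W t, of "\<lambda>_. k" Bk]) (use k Bk in auto)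
  have K_bd: "\<bar>K n y\<bar> \<le> exp (BW * t) * Bk" for n y
    unfolding K_def by (rule step_funpow_abs_le[OF Wb BW(2) t k Bk(2)])
  have past_bd: "\<bar>exp (rclock V x 0 s n \<omega>) * F (x - X s \<omega>)\<bar> \<le> exp (BV * s) * BF" for n \<omega>
    using rclock_abs_le[of V BV s x 0 n \<omega>, OF BV(2) s] BF by (auto simp: abs_mult intro!: mult_mono)
  have fut_bd: "\<bar>exp (rclock W x s t n \<omega>) * k (x - X (s + t) \<omega>)\<bar> \<le> exp (BW * t) * Bk" for n \<omega>
    using rclock_abs_le[of W BW t x s n \<omega>, OF BW(2) t] Bk by (auto simp: abs_mult intro!: mult_mono)
  define L where "L n = (\<integral>\<omega>. exp (rclock V x 0 s (Suc n) \<omega>) * F (x - X s \<omega>) *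
            (exp (rclock W x s t (Suc n) \<omega>) * k (x - X (s + t) \<omega>)) \<partial>M)" for n
  have L_eq: "L n = (\<integral>\<omega>. exp (rclock V x 0 s (Suc n) \<omega>) * F (x - X s \<omega>) * K n (x - X s \<omega>) \<partial>M)" for n
  proof -
    let ?n = "Suc n"
    define \<tau> where "\<tau> i = real i * (s / real ?n)" for i
    \<comment> \<open>No weight at index 0, since the Riemann sums use right end points; the factor
      F of the present sits at the last index.\<close>
    define g where "g i y = (if i = 0 then 1 else exp (s / real ?n * V (x - y))) * (if i = ?n then F (x - y) else 1)" for i y
    have gb: "bounded_borel (g i)" for i
    proof -
      have "bounded_borel (\<lambda>y. exp (s / real ?n * V (x - y)))"
        using BV by (intro bounded_borel_exp bounded_borel_mult bounded_borelI[of "\<lambda>y. V (x - y)" BV]) auto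
      moreover have "bounded_borel (\<lambda>y. F (x - y))"
        using BF by (intro bounded_borelI[of _ BF]) auto
      ultimately show ?thesis
        unfolding g_def by (cases "i = 0"; cases "i = ?n") simp_all
    qed
    have prod: "(\<Prod>i\<le>?n. g i (X (\<tau> i) \<omega>)) = exp (rclock V x 0 s ?n \<omega>) * F (x - X s \<omega>)" for \<omega>
    proof -
      have "(\<Prod>i\<le>?n. g i (X (\<tau> i) \<omega>)) =
          (\<Prod>i\<le>?n. if i = 0 then 1 else exp (s / real ?n * V (x - X (\<tau> i) \<omega>))) *
          (\<Prod>i\<le>?n. if i = ?n then F (x - X (\<tau> i) \<omega>) else 1)"
        unfolding g_def by (rule prod.distrib)
      also have "(\<Prod>i\<le>?n. if i = ?n then F (x - X (\<tau> i) \<omega>) else 1) = F (x - X (\<tau> ?n) \<omega>)"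
        by (subst prod.delta) auto
      also have "(\<Prod>i\<le>?n. if i = 0 then 1 else exp (s / real ?n * V (x - X (\<tau> i) \<omega>))) =
          (\<Prod>i = 1..?n. exp (s / real ?n * V (x - X (\<tau> i) \<omega>)))"
        by (rule prod.mono_neutral_cong_right) auto
      also have "\<dots> = exp (rclock V x 0 s ?n \<omega>)"
        unfolding rclock_def \<tau>_def by (simp only: exp_sum finite_atLeastAtMost add_0_left)
      finally show ?thesis by (simp add: \<tau>_def)
    qed
    have fut: "(\<Prod>j = 1..?n. exp (t / real ?n * W (x - X (s + real j * (t / real ?n)) \<omega>))) = exp (rclock W x s t ?n \<omega>)" for \<omega>
      unfolding rclock_def by (simp only: exp_sum finite_atLeastAtMost)
    have ends: "\<tau> ?n = s" "s + real ?n * (t / real ?n) = s + t"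
      by (auto simp: \<tau>_def)
    have "(\<integral>\<omega>. (\<Prod>i\<le>?n. g i (X (\<tau> i) \<omega>)) *
         ((\<Prod>j = 1..?n. exp (t / real ?n * W (x - X (\<tau> ?n + real j * (t / real ?n)) \<omega>))) *
           k (x - X (\<tau> ?n + real ?n * (t / real ?n)) \<omega>)) \<partial>M) =
         (\<integral>\<omega>. (\<Prod>i\<le>?n. g i (X (\<tau> i) \<omega>)) * K n (x - X (\<tau> ?n) \<omega>) \<partial>M)"
      unfolding K_def
      by (rule expectation_multi_step) (use gb k Wb s t in \<open>auto simp: \<tau>_def mono_def intro!: divide_right_mono mult_right_mono\<close>)
    then show ?thesis
      unfolding L_def prod fut ends .
  qed
  have past_lim: "(\<lambda>n. exp (rclock V x 0 s (Suc n) \<omega>) * F (x - X s \<omega>)) \<longlonglongrightarrow> exp (clock V x s \<omega>) * F (x - X s \<omega>)"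
    if "\<omega> \<in> space M" for \<omega>
    using LIMSEQ_Suc[OF rclock_tendsto[OF V s order_refl that, of x]]
    by (intro tendsto_intros) (simp add: clock_def)
  have "L \<longlonglongrightarrow> (\<integral>\<omega>. exp (clock V x s \<omega>) * F (x - X s \<omega>) *
            (exp (LBINT r:{0<..t}. W (x - X (s + r) \<omega>)) * k (x - X (s + t) \<omega>)) \<partial>M)"
    unfolding L_def
  proof (rule integral_dominated_convergence[where w = "\<lambda>_. exp (BV * s) * BF * (exp (BW * t) * Bk)"])
    have "(\<lambda>\<omega>. LBINT r:{0<..t}. W (x - X (s + r) \<omega>)) \<in> borel_measurable M"
      unfolding set_lebesgue_integral_def by measurable
    then show "(\<lambda>\<omega>. exp (clock V x s \<omega>) * F (x - X s \<omega>) *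
            (exp (LBINT r:{0<..t}. W (x - X (s + r) \<omega>)) * k (x - X (s + t) \<omega>))) \<in> borel_measurable M"
      by measurable
    show "AE \<omega> in M. (\<lambda>n. exp (rclock V x 0 s (Suc n) \<omega>) * F (x - X s \<omega>) * (exp (rclock W x s t (Suc n) \<omega>) * k (x - X (s + t) \<omega>)))
       \<longlonglongrightarrow> exp (clock V x s \<omega>) * F (x - X s \<omega>) * (exp (LBINT r:{0<..t}. W (x - X (s + r) \<omega>)) * k (x - X (s + t) \<omega>))"
      by (intro AE_I2 tendsto_mult[OF past_lim] tendsto_mult tendsto_exp tendsto_const LIMSEQ_Suc[OF rclock_tendsto[OF W t s]])
    show "AE \<omega> in M. norm (exp (rclock V x 0 s (Suc n) \<omega>) * F (x - X s \<omega>) * (exp (rclock W x s t (Suc n) \<omega>) * k (x - X (s + t) \<omega>)))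
       \<le> exp (BV * s) * BF * (exp (BW * t) * Bk)" for n
      unfolding real_norm_def abs_mult[of "_ * F _"] using past_bd fut_bd BF
      by (intro AE_I2 mult_mono) auto
  qed auto
  moreover have "L \<longlonglongrightarrow> (\<integral>\<omega>. exp (clock V x s \<omega>) * F (x - X s \<omega>) * FK W t k (x - X s \<omega>) \<partial>M)"
    unfolding L_eq
  proof (rule integral_dominated_convergence[where w = "\<lambda>_. exp (BV * s) * BF * (exp (BW * t) * Bk)"])
    show "AE \<omega> in M. (\<lambda>n. exp (rclock V x 0 s (Suc n) \<omega>) * F (x - X s \<omega>) * K n (x - X s \<omega>))
       \<longlonglongrightarrow> exp (clock V x s \<omega>) * F (x - X s \<omega>) * FK W t k (x - X s \<omega>)"
      by (intro AE_I2 tendsto_mult[OF past_lim] K_lim)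
    show "AE \<omega> in M. norm (exp (rclock V x 0 s (Suc n) \<omega>) * F (x - X s \<omega>) * K n (x - X s \<omega>))
       \<le> exp (BV * s) * BF * (exp (BW * t) * Bk)" for n
      unfolding real_norm_def abs_mult[of "_ * F _"] using past_bd K_bd BF
      by (intro AE_I2 mult_mono) auto
  qed auto
  ultimately show ?thesis
    by (rule LIMSEQ_unique)
qed

lemma clock_add:
  assumes V: "bounded_borel V" and s: "s \<ge> 0" and t: "t \<ge> 0" and \<omega>: "\<omega> \<in> space M"
  shows "clock V x (s + t) \<omega> = clock V x s \<omega> + (LBINT r:{0<..t}. V (x - X (s + r) \<omega>))"
proof -
  obtain B where B: "\<And>x. \<bar>V x\<bar> \<le> B" using V by (metis bounded_borelE)
  have "(\<lambda>r. V (x - X r \<omega>)) \<in> borel_measurable borel"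
    using measurable_path[OF \<omega>, of V x 0] V by (auto dest: bounded_borel_measurable)
  then have "clock V x (s + t) \<omega> = clock V x s \<omega> + (LBINT r:{s<..s + t}. V (x - X r \<omega>))"
    unfolding clock_def using B s t by (intro set_integral_Ioc_add) auto
  also have "(LBINT r:{s<..s + t}. V (x - X r \<omega>)) = (LBINT r:{0<..t}. V (x - X (s + r) \<omega>))"
    unfolding set_lebesgue_integral_def
    by (subst lborel_integral_real_affine[where c = 1 and t = s]) (auto simp: indicator_def intro!: Bochner_Integration.integral_cong)
  finally show ?thesis .
qed

lemma FK_semigroup:
  assumes V: "bounded_continuous V" and f: "bounded_borel f" and s: "s \<ge> 0" and t: "t \<ge> 0"
  shows "FK V (s + t) f x = FK V s (FK V t f) x"
proof -
  have "FK V (s + t) f x = (\<integral>\<omega>. exp (clock V x s \<omega>) * 1 *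
            (exp (LBINT r:{0<..t}. V (x - X (s + r) \<omega>)) * f (x - X (s + t) \<omega>)) \<partial>M)"
    unfolding FK_def using clock_add[OF bounded_continuous_borel[OF V] s t]
    by (intro Bochner_Integration.integral_cong) (auto simp: exp_add)
  also have "\<dots> = FK V s (FK V t f) x"
    using FK_markov[OF V V bounded_borel_const[of 1] f s t, of x]
    by (simp add: FK_def[of V s] mult.commute)
  finally show ?thesis .
qed

lemma FK_zero: "FK (\<lambda>_. 0) t f x = trans t f x"
  by (simp add: FK_def clock_def trans_def)

lemma markov:
  assumes V: "bounded_continuous V" and F: "bounded_borel F" and k: "bounded_borel k" and s: "s \<ge> 0" and t: "t \<ge> 0"
  shows "(\<integral>\<omega>. exp (clock V x s \<omega>) * F (x - X s \<omega>) * k (x - X (s + t) \<omega>) \<partial>M) =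
         (\<integral>\<omega>. exp (clock V x s \<omega>) * F (x - X s \<omega>) * trans t k (x - X s \<omega>) \<partial>M)"
  using FK_markov[OF V _ F k s t, of "\<lambda>_. 0" x] unfolding FK_zero
  by (simp add: set_lebesgue_integral_def)

end

section \<open>Resolvent and Duhamel's formula\<close>

text \<open>The exponential weight is cut off at 0, so that resolvents are integrals over the whole
  line and the Fubini lemma for an integrable weight applies directly.\<close>

definition decay :: "real \<Rightarrow> real \<Rightarrow> real" where
  "decay l u = indicator {0<..} u * exp (- (l * u))"

lemma measurable_decay [measurable]: "decay l \<in> borel_measurable borel"
  unfolding decay_def by measurable

lemma decay_nonneg [simp]: "0 \<le> decay l u"
  by (simp add: decay_def)

lemma has_integral_decay:
  assumes l: "l > 0"
  shows "has_bochner_integral lborel (decay l) (1 / l)"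
proof -
  have *: "exponential_density l u = l * (indicator {0..} u * exp (- (l * u)))" for u
    by (simp add: exponential_density_def indicator_def mult.commute)
  interpret prob_space "density lborel (exponential_density l)"
    using l by (rule prob_space_exponential_density)
  have "(\<integral>\<^sup>+u. ennreal (exponential_density l u) \<partial>lborel) = ennreal 1"
    using emeasure_space_1 by (simp add: emeasure_density)
  then have "has_bochner_integral lborel (exponential_density l) 1"
    using l by (intro has_bochner_integral_nn_integral) (auto simp: * )
  then have "has_bochner_integral lborel (\<lambda>u. 1 / l * exponential_density l u) (1 / l * 1)"
    by (rule has_bochner_integral_mult_right)
  moreover have "has_bochner_integral lborel (\<lambda>u. 1 / l * exponential_density l u) (1 / l * 1) \<longleftrightarrow>
      has_bochner_integral lborel (decay l) (1 / l * 1)"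
  proof (rule has_bochner_integral_cong_AE)
    have "AE u in lborel. u \<noteq> (0 :: real)" by (rule AE_lborel_singleton)
    then show "AE u in lborel. 1 / l * exponential_density l u = decay l u"
      by eventually_elim (use l in \<open>auto simp: * decay_def indicator_def\<close>)
  qed (auto simp: * )
  ultimately show ?thesis by simp
qed

lemma integrable_decay [simp]: "l > 0 \<Longrightarrow> integrable lborel (decay l)"
  and integral_decay [simp]: "l > 0 \<Longrightarrow> (LBINT u. decay l u) = 1 / l"
  using has_integral_decay[of l] by (auto simp: has_bochner_integral_iff)

lemma integrable_decay_mult:
  assumes "l > 0" "f \<in> borel_measurable borel" "\<And>u. \<bar>f u\<bar> \<le> C"
  shows "integrable lborel (\<lambda>u. decay l u * f u)"
proof (rule Bochner_Integration.integrable_bound)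
  show "integrable lborel (\<lambda>u. C * decay l u)" using assms by simp
  have "C \<ge> 0" using assms abs_ge_zero order_trans by blast
  then show "AE u in lborel. norm (decay l u * f u) \<le> norm (C * decay l u)"
    using assms by (intro AE_I2) (auto simp: abs_mult mult.commute[of C] intro!: mult_left_mono)
qed (use assms in auto)

lemma integral_decay_mult_abs_le:
  assumes "l > 0" "f \<in> borel_measurable borel" "\<And>u. \<bar>f u\<bar> \<le> C"
  shows "\<bar>\<integral>u. decay l u * f u \<partial>lborel\<bar> \<le> C / l"
proof -
  have "\<bar>\<integral>u. decay l u * f u \<partial>lborel\<bar> \<le> (LBINT u. C * decay l u)"
    using assms by (intro integral_abs_le integrable_decay_mult[where C = C])
      (auto simp: abs_mult mult.commute[of C] intro!: mult_left_mono)
  then show ?thesis using assms by simp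
qed

context symmetric_levy_path
begin

definition resolvent :: "real \<Rightarrow> (real \<Rightarrow> real) \<Rightarrow> real \<Rightarrow> real" where
  "resolvent l k x = (LBINT u. decay l u * trans u k x)"

lemma measurable_resolvent [measurable (raw)]:
  assumes [measurable]: "k \<in> borel_measurable borel" "g \<in> borel_measurable N"
  shows "(\<lambda>z. resolvent l k (g z)) \<in> borel_measurable N"
  unfolding resolvent_def by measurable

lemma resolvent_abs_le:
  assumes "l > 0" "bounded_borel k" "\<And>x. \<bar>k x\<bar> \<le> C"
  shows "\<bar>resolvent l k x\<bar> \<le> C / l"
  unfolding resolvent_def using assms
  by (intro integral_decay_mult_abs_le trans_abs_le) (auto dest: bounded_borel_measurable)

lemma bounded_borel_resolvent [simp]:
  assumes "l > 0" "bounded_borel k"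
  shows "bounded_borel (resolvent l k)"
proof -
  obtain C where "\<And>x. \<bar>k x\<bar> \<le> C" using assms by (metis bounded_borelE)
  then show ?thesis
    using assms by (intro bounded_borelI[OF _ resolvent_abs_le]) (auto dest: bounded_borel_measurable)
qed

text \<open>Fubini, the Markov property at time s for each u, and Fubini back: given the past, the
  expected discounted occupation after s is the resolvent at the present position.\<close>

lemma expectation_future_occupation:
  assumes V: "bounded_continuous V" and F: "bounded_borel F" and k: "bounded_borel k"
    and s: "s \<ge> 0" and l: "l > 0"
  shows "(\<integral>\<omega>. exp (clock V x s \<omega>) * F (x - X s \<omega>) * (LBINT u. decay l u * k (x - X (s + u) \<omega>)) \<partial>M) =
         (\<integral>\<omega>. exp (clock V x s \<omega>) * F (x - X s \<omega>) * resolvent l k (x - X s \<omega>) \<partial>M)"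
proof -
  have Vb: "bounded_borel V" using V by simp
  note [measurable] = bounded_borel_measurable[OF Vb] bounded_borel_measurable[OF F] bounded_borel_measurable[OF k]
  obtain BV where BV: "BV \<ge> 0" "\<And>x. \<bar>V x\<bar> \<le> BV" using Vb by (metis bounded_borelE)
  obtain BF where BF: "BF \<ge> 0" "\<And>x. \<bar>F x\<bar> \<le> BF" using F by (metis bounded_borelE)
  obtain Bk where Bk: "Bk \<ge> 0" "\<And>x. \<bar>k x\<bar> \<le> Bk" using k by (metis bounded_borelE)
  define W where "W \<omega> = exp (clock V x s \<omega>) * F (x - X s \<omega>)" for \<omega>
  have W [measurable]: "W \<in> borel_measurable M" unfolding W_def by measurable
  have W_bd: "\<bar>W \<omega>\<bar> \<le> exp (BV * s) * BF" for \<omega>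
    unfolding W_def using clock_abs_le[of V BV s x \<omega>, OF BV(2) s] BF by (auto simp: abs_mult intro!: mult_mono)
  have "(\<integral>\<omega>. W \<omega> * (LBINT u. decay l u * k (x - X (s + u) \<omega>)) \<partial>M)
     = (\<integral>\<omega>. 1 * (LBINT u. decay l u * (W \<omega> * k (x - X (s + u) \<omega>))) \<partial>M)"
    by (simp add: mult.left_commute)
  also have "\<dots> = (LBINT u. decay l u * (\<integral>\<omega>. 1 * (W \<omega> * k (x - X (s + u) \<omega>)) \<partial>M))"
    using l W_bd Bk by (intro PL.fubini_bounded[symmetric, where C = "exp (BV * s) * BF * Bk"])
      (auto simp: abs_mult intro!: mult_mono order_trans[OF abs_ge_zero W_bd])
  also have "\<dots> = (LBINT u. decay l u * (\<integral>\<omega>. 1 * (W \<omega> * trans u k (x - X s \<omega>)) \<partial>M))"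
    using markov[OF V F k s, of _ x]
    by (intro Bochner_Integration.integral_cong) (auto simp: decay_def indicator_def W_def)
  also have "\<dots> = (\<integral>\<omega>. 1 * (LBINT u. decay l u * (W \<omega> * trans u k (x - X s \<omega>))) \<partial>M)"
    using l W_bd Bk k by (intro PL.fubini_bounded[where C = "exp (BV * s) * BF * Bk"])
      (auto simp: abs_mult intro!: mult_mono trans_abs_le order_trans[OF abs_ge_zero W_bd])
  also have "\<dots> = (\<integral>\<omega>. W \<omega> * resolvent l k (x - X s \<omega>) \<partial>M)"
    by (simp add: mult.left_commute resolvent_def)
  finally show ?thesis unfolding W_def .
qed

text \<open>This is the integral of e^(-l r) k (x - X r) over r > s, written with time restarted at
  s. Its conditional expectation given the past up to s is e^(-l s) times the resolvent of k at x -
  X s, which is how the resolvent enters a pathwise identity.\<close>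

definition tail_occupation :: "real \<Rightarrow> (real \<Rightarrow> real) \<Rightarrow> real \<Rightarrow> real \<Rightarrow> 'a \<Rightarrow> real" where
  "tail_occupation l k x s \<omega> = exp (- (l * s)) * (LBINT u. decay l u * k (x - X (s + u) \<omega>))"

lemma measurable_tail_occupation [measurable (raw)]:
  assumes [measurable]: "k \<in> borel_measurable borel" "f \<in> borel_measurable N" "g \<in> measurable N M"
  shows "(\<lambda>z. tail_occupation l k x (f z) (g z)) \<in> borel_measurable N"
  unfolding tail_occupation_def by measurable

lemma tail_occupation_abs_le:
  assumes l: "l > 0" and k: "\<And>x. \<bar>k x\<bar> \<le> C" "k \<in> borel_measurable borel" and s: "s \<ge> 0" and \<omega>: "\<omega> \<in> space M"
  shows "\<bar>tail_occupation l k x s \<omega>\<bar> \<le> C / l"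
proof -
  have "\<bar>\<integral>u. decay l u * k (x - X (s + u) \<omega>) \<partial>lborel\<bar> \<le> C / l"
    using l k measurable_path[OF \<omega> k(2)] by (intro integral_decay_mult_abs_le)
  moreover have "exp (- (l * s)) \<le> 1" using l s by simp
  ultimately have "exp (- (l * s)) * \<bar>\<integral>u. decay l u * k (x - X (s + u) \<omega>) \<partial>lborel\<bar> \<le> 1 * (C / l)"
    by (intro mult_mono) auto
  then show ?thesis by (simp add: tail_occupation_def abs_mult)
qed

text \<open>After a shift of the variable the tail is an integral over (s, \<infinity>), and passing
  from 0 to s loses the part over (0, s]. This exhibits the bounded density in s that the product
  rule asks for.\<close>

lemma tail_occupation_diff:
  assumes l: "l > 0" and k: "bounded_borel k" and s: "s \<ge> 0" and \<omega>: "\<omega> \<in> space M"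
  shows "tail_occupation l k x s \<omega> = tail_occupation l k x 0 \<omega> + (LBINT r:{0<..s}. - exp (- (l * r)) * k (x - X r \<omega>))"
proof -
  obtain C where C: "C \<ge> 0" "\<And>x. \<bar>k x\<bar> \<le> C" using k by (metis bounded_borelE)
  have [measurable]: "(\<lambda>r. k (x - X r \<omega>)) \<in> borel_measurable borel"
    using measurable_path[OF \<omega>, of k x 0] k by (auto dest: bounded_borel_measurable)
  have tail: "tail_occupation l k x s \<omega> = (LBINT r. indicator {s<..} r * (decay l r * k (x - X r \<omega>)))"
  proof -
    have "(LBINT r. indicator {s<..} r * (decay l r * k (x - X r \<omega>)))
       = (LBINT u. indicator {s<..} (s + 1 * u) * (decay l (s + 1 * u) * k (x - X (s + 1 * u) \<omega>)))"
      by (subst lborel_integral_real_affine[where c = 1 and t = s]) auto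
    also have "\<dots> = (LBINT u. exp (- (l * s)) * (decay l u * k (x - X (s + u) \<omega>)))"
      using s by (intro Bochner_Integration.integral_cong) (auto simp: decay_def indicator_def exp_add[symmetric] algebra_simps)
    finally show ?thesis by (simp add: tail_occupation_def)
  qed
  have int: "integrable lborel (\<lambda>r. decay l r * k (x - X r \<omega>))"
    using l C by (intro integrable_decay_mult) auto
  have "tail_occupation l k x 0 \<omega> = (LBINT r. decay l r * k (x - X r \<omega>))"
    by (simp add: tail_occupation_def)
  also have "\<dots> = (LBINT r. indicator {0<..s} r * (exp (- (l * r)) * k (x - X r \<omega>))
       + indicator {s<..} r * (decay l r * k (x - X r \<omega>)))"
    using s by (intro Bochner_Integration.integral_cong) (auto simp: decay_def indicator_def)
  also have "\<dots> = (LBINT r. indicator {0<..s} r * (exp (- (l * r)) * k (x - X r \<omega>)))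
       + (LBINT r. indicator {s<..} r * (decay l r * k (x - X r \<omega>)))"
  proof (rule Bochner_Integration.integral_add)
    show "integrable lborel (\<lambda>r. indicator {0<..s} r * (exp (- (l * r)) * k (x - X r \<omega>)))"
      by (rule Bochner_Integration.integrable_bound[OF int]) (auto simp: decay_def indicator_def)
    show "integrable lborel (\<lambda>r. indicator {s<..} r * (decay l r * k (x - X r \<omega>)))"
      by (rule Bochner_Integration.integrable_bound[OF int]) (auto simp: indicator_def)
  qed
  finally show ?thesis
    unfolding tail by (simp add: set_lebesgue_integral_def)
qed

text \<open>Pathwise this is the product rule for \<open>exp (clock s) * tail_occupation s\<close>, so no question about the domain of the
  generator arises.\<close>

lemma FK_duhamel:
  assumes V: "bounded_continuous V" and k: "bounded_borel k" and t: "t \<ge> 0" and l: "l > 0"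
  shows "exp (- (l * t)) * FK V t (resolvent l k) x +
         (LBINT s:{0<..t}. exp (- (l * s)) * FK V s (\<lambda>y. k y - V y * resolvent l k y) x) = resolvent l k x"
proof -
  have Vb: "bounded_borel V" using V by simp
  note [measurable] = bounded_borel_measurable[OF Vb] bounded_borel_measurable[OF k]
  obtain BV where BV: "BV \<ge> 0" "\<And>x. \<bar>V x\<bar> \<le> BV" using Vb by (metis bounded_borelE)
  obtain Bk where Bk: "Bk \<ge> 0" "\<And>x. \<bar>k x\<bar> \<le> Bk" using k by (metis bounded_borelE)
  define J where "J = tail_occupation l k x"
  have J_meas [measurable (raw)]: "(\<lambda>z. J (f z) (g z)) \<in> borel_measurable N"
    if "f \<in> borel_measurable N" "g \<in> measurable N M" for f g and N :: "'c measure"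
    unfolding J_def using that by measurable
  have J_bd: "\<bar>J s \<omega>\<bar> \<le> Bk / l" if "s \<ge> 0" "\<omega> \<in> space M" for s \<omega>
    unfolding J_def using l Bk that by (intro tail_occupation_abs_le) auto
  have clock_le: "exp (clock V x s \<omega>) \<le> exp (BV * t)" if "0 \<le> s" "s \<le> t" for s \<omega>
    using clock_abs_le[of V BV s x \<omega>, OF BV(2)] that BV(1) mult_left_mono[of s t BV] by auto
  have EJ: "(\<integral>\<omega>. exp (clock V x s \<omega>) * F (x - X s \<omega>) * J s \<omega> \<partial>M) = exp (- (l * s)) * FK V s (\<lambda>y. F y * resolvent l k y) x"
    if "s \<ge> 0" "bounded_borel F" for s F
    using expectation_future_occupation[OF V that(2) k that(1) l, of x]
    by (simp add: J_def tail_occupation_def FK_def mult.left_commute[of "exp (- (l * s))"]) (simp add: ac_simps)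
  \<comment> \<open>The density in s of exp (clock) * J along a path: the first term comes from the
    clock, the second from the tail occupation.\<close>
  define G where "G s \<omega> = exp (clock V x s \<omega>) * V (x - X s \<omega>) * J s \<omega> - exp (clock V x s \<omega>) * exp (- (l * s)) * k (x - X s \<omega>)" for s \<omega>
  have path: "exp (clock V x t \<omega>) * J t \<omega> = J 0 \<omega> + (LBINT s:{0<..t}. G s \<omega>)" if \<omega>: "\<omega> \<in> space M" for \<omega>
  proof -
    define C where "C = max (BV * exp (BV * t)) Bk"
    define B where "B = max (exp (BV * t)) (Bk / l)"
    have [measurable]: "(\<lambda>r. V (x - X r \<omega>)) \<in> borel_measurable borel" "(\<lambda>r. k (x - X r \<omega>)) \<in> borel_measurable borel"
      using measurable_path[OF \<omega>, of V x 0] measurable_path[OF \<omega>, of k x 0] by auto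
    have [measurable]: "(\<lambda>r. clock V x r \<omega>) \<in> borel_measurable borel" "(\<lambda>r. J r \<omega>) \<in> borel_measurable borel"
      using \<omega> by measurable
    have "exp (clock V x t \<omega>) * J t \<omega> = exp (clock V x 0 \<omega>) * J 0 \<omega> +
        (LBINT s:{0<..t}. V (x - X s \<omega>) * exp (clock V x s \<omega>) * J s \<omega> + exp (clock V x s \<omega>) * (- exp (- (l * s)) * k (x - X s \<omega>)))"
    proof (rule product_rule_bounded_densities[where C = C and B = B])
      fix s :: real assume s: "0 < s" "s \<le> t"
      have "\<bar>V (x - X s \<omega>) * exp (clock V x s \<omega>)\<bar> \<le> BV * exp (BV * t)"
        using BV clock_le[of s \<omega>] s by (auto simp: abs_mult intro!: mult_mono)
      then show "\<bar>V (x - X s \<omega>) * exp (clock V x s \<omega>)\<bar> \<le> C" by (simp add: C_def)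
      have "exp (- (l * s)) * \<bar>k (x - X s \<omega>)\<bar> \<le> 1 * Bk"
        using Bk s l by (intro mult_mono) auto
      then show "\<bar>- exp (- (l * s)) * k (x - X s \<omega>)\<bar> \<le> C" by (simp add: C_def abs_mult)
    next
      fix s :: real assume s: "0 \<le> s" "s \<le> t"
      show "exp (clock V x s \<omega>) = exp (clock V x 0 \<omega>) + (LBINT s:{0<..s}. V (x - X s \<omega>) * exp (clock V x s \<omega>))"
        using exp_rule_bounded_density[of "\<lambda>s. V (x - X s \<omega>)" BV "\<lambda>s. clock V x s \<omega>" s, OF _ _ clock_def] BV s
        by simp
      show "J s \<omega> = J 0 \<omega> + (LBINT r:{0<..s}. - exp (- (l * r)) * k (x - X r \<omega>))"
        unfolding J_def using s by (intro tail_occupation_diff l k \<omega>)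
      show "\<bar>exp (clock V x s \<omega>)\<bar> \<le> B" "\<bar>J s \<omega>\<bar> \<le> B"
        using clock_le[OF s, of \<omega>] J_bd[OF s(1) \<omega>] by (auto simp: B_def max.coboundedI1 max.coboundedI2)
    qed (use t in auto)
    then show ?thesis
      by (simp add: G_def algebra_simps)
  qed
  \<comment> \<open>Set to 0 outside (0, t] and outside \<open>space M\<close>, so that the bound
    holds for all arguments, as the Fubini lemma for bounded kernels demands.\<close>
  define G' where "G' s \<omega> = (if 0 < s \<and> s \<le> t \<and> \<omega> \<in> space M then G s \<omega> else 0)" for s \<omega>
  have G_bd: "\<bar>G s \<omega>\<bar> \<le> exp (BV * t) * BV * (Bk / l) + exp (BV * t) * 1 * Bk" if "0 \<le> s" "s \<le> t" "\<omega> \<in> space M" for s \<omega>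
  proof -
    have "\<bar>G s \<omega>\<bar> \<le> exp (clock V x s \<omega>) * \<bar>V (x - X s \<omega>)\<bar> * \<bar>J s \<omega>\<bar> + exp (clock V x s \<omega>) * exp (- (l * s)) * \<bar>k (x - X s \<omega>)\<bar>"
      unfolding G_def by (rule order_trans[OF abs_triangle_ineq4]) (simp add: abs_mult)
    also have "\<dots> \<le> exp (BV * t) * BV * (Bk / l) + exp (BV * t) * 1 * Bk"
      using clock_le[OF that(1,2), of \<omega>] J_bd[OF that(1,3)] BV Bk that l by (intro add_mono mult_mono) auto
    finally show ?thesis .
  qed
  have "(\<integral>\<omega>. exp (clock V x t \<omega>) * J t \<omega> \<partial>M) = (\<integral>\<omega>. J 0 \<omega> + (LBINT s:{0<..t}. G s \<omega>) \<partial>M)"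
    by (intro Bochner_Integration.integral_cong path) auto
  also have "\<dots> = (\<integral>\<omega>. J 0 \<omega> \<partial>M) + (\<integral>\<omega>. (LBINT s:{0<..t}. G s \<omega>) \<partial>M)"
  proof (rule Bochner_Integration.integral_add)
    show "integrable M (J 0)"
      by (rule integrable_const_bound[where B = "Bk / l"]) (use J_bd in auto)
    have [measurable]: "(\<lambda>\<omega>. LBINT s:{0<..t}. G s \<omega>) \<in> borel_measurable M"
      unfolding set_lebesgue_integral_def G_def by measurable
    have "\<bar>LBINT s:{0<..t}. G s \<omega>\<bar> \<le> (exp (BV * t) * BV * (Bk / l) + exp (BV * t) * 1 * Bk) * (t - 0)"
      if "\<omega> \<in> space M" for \<omega>
      by (rule set_integral_Ioc_bound) (use G_bd t that in auto)
    then show "integrable M (\<lambda>\<omega>. LBINT s:{0<..t}. G s \<omega>)"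
      by (intro integrable_const_bound[where B = "(exp (BV * t) * BV * (Bk / l) + exp (BV * t) * 1 * Bk) * t"]) auto
  qed
  also have "(\<integral>\<omega>. J 0 \<omega> \<partial>M) = resolvent l k x"
    using EJ[of 0 "\<lambda>_. 1"] by simp
  also have "(\<integral>\<omega>. (LBINT s:{0<..t}. G s \<omega>) \<partial>M) = (\<integral>\<omega>. 1 * (LBINT s. indicator {0<..t} s * G' s \<omega>) \<partial>M)"
  proof (rule Bochner_Integration.integral_cong[OF refl])
    fix \<omega> assume "\<omega> \<in> space M"
    then show "(LBINT s:{0<..t}. G s \<omega>) = 1 * (LBINT s. indicator {0<..t} s * G' s \<omega>)"
      unfolding set_lebesgue_integral_def mult_1
      by (intro Bochner_Integration.integral_cong) (auto simp: G'_def indicator_def)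
  qed
  also have "\<dots> = (LBINT s. indicator {0<..t} s * (\<integral>\<omega>. 1 * G' s \<omega> \<partial>M))"
  proof (rule PL.fubini_bounded[symmetric])
    show "\<bar>G' s \<omega>\<bar> \<le> exp (BV * t) * BV * (Bk / l) + exp (BV * t) * 1 * Bk" for s \<omega>
      unfolding G'_def using G_bd[of s \<omega>] BV Bk l by auto
    have "(\<lambda>z. if 0 < fst z \<and> fst z \<le> t then G (fst z) (snd z) else 0) \<in> borel_measurable (lborel \<Otimes>\<^sub>M M)"
      unfolding G_def by measurable
    then show "case_prod G' \<in> borel_measurable (lborel \<Otimes>\<^sub>M M)"
      by (rule subst[OF measurable_cong, rotated]) (auto simp: G'_def space_pair_measure)
  qed auto
  also have "\<dots> = (LBINT s:{0<..t}. - (exp (- (l * s)) * FK V s (\<lambda>y. k y - V y * resolvent l k y) x))"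
    unfolding set_lebesgue_integral_def
  proof (rule Bochner_Integration.integral_cong[OF refl])
    fix s :: real
    show "indicator {0<..t} s * (\<integral>\<omega>. 1 * G' s \<omega> \<partial>M) =
      indicator {0<..t} s *\<^sub>R - (exp (- (l * s)) * FK V s (\<lambda>y. k y - V y * resolvent l k y) x)"
    proof (cases "0 < s \<and> s \<le> t")
      case True
      have bd1: "\<bar>exp (clock V x s \<omega>) * f (x - X s \<omega>)\<bar> \<le> exp (BV * t) * C" if "\<And>x. \<bar>f x\<bar> \<le> C" for f C \<omega>
        using clock_le[of s \<omega>] True that[of "x - X s \<omega>"] by (auto simp: abs_mult intro!: mult_mono)
      have i1: "integrable M (\<lambda>\<omega>. exp (clock V x s \<omega>) * f (x - X s \<omega>))" if "bounded_borel f" for f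
      proof -
        note [measurable] = bounded_borel_measurable[OF that]
        obtain C where "\<And>x. \<bar>f x\<bar> \<le> C" using \<open>bounded_borel f\<close> by (metis bounded_borelE)
        from bd1[of f C, OF this] show ?thesis by (intro integrable_bounded) auto
      qed
      have i2: "integrable M (\<lambda>\<omega>. exp (clock V x s \<omega>) * V (x - X s \<omega>) * J s \<omega>)"
      proof (rule integrable_const_bound[where B = "exp (BV * t) * BV * (Bk / l)"])
        show "AE \<omega> in M. norm (exp (clock V x s \<omega>) * V (x - X s \<omega>) * J s \<omega>) \<le> exp (BV * t) * BV * (Bk / l)"
          unfolding real_norm_def abs_mult[of "_ * V _"]
          using bd1[of V BV, OF BV(2)] J_bd[of s] True BV by (intro AE_I2 mult_mono) auto
      qed auto
      have "(\<integral>\<omega>. 1 * G' s \<omega> \<partial>M) = (\<integral>\<omega>. exp (clock V x s \<omega>) * V (x - X s \<omega>) * J s \<omega> - exp (- (l * s)) * (exp (clock V x s \<omega>) * k (x - X s \<omega>)) \<partial>M)"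
        using True by (intro Bochner_Integration.integral_cong) (auto simp: G'_def G_def)
      also have "\<dots> = exp (- (l * s)) * FK V s (\<lambda>y. V y * resolvent l k y) x - exp (- (l * s)) * FK V s k x"
        using True EJ[of s V] Vb i1[OF k] i2 by (simp add: FK_def[of V s k] mult.commute)
      finally have e1: "(\<integral>\<omega>. 1 * G' s \<omega> \<partial>M) = exp (- (l * s)) * FK V s (\<lambda>y. V y * resolvent l k y) x - exp (- (l * s)) * FK V s k x" .
      have e2: "FK V s (\<lambda>y. k y - V y * resolvent l k y) x = FK V s k x - FK V s (\<lambda>y. V y * resolvent l k y) x"
        unfolding FK_def using i1[OF k] i1[of "\<lambda>y. V y * resolvent l k y"] Vb k l
        by (subst Bochner_Integration.integral_diff[symmetric]) (auto simp: algebra_simps)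
      show ?thesis unfolding e1 e2 by (simp add: right_diff_distrib)
    qed auto
  qed
  also have "\<dots> = - (LBINT s:{0<..t}. exp (- (l * s)) * FK V s (\<lambda>y. k y - V y * resolvent l k y) x)"
    by (simp add: set_lebesgue_integral_def)
  finally have "(\<integral>\<omega>. exp (clock V x t \<omega>) * J t \<omega> \<partial>M) =
     resolvent l k x - (LBINT s:{0<..t}. exp (- (l * s)) * FK V s (\<lambda>y. k y - V y * resolvent l k y) x)"
    by simp
  moreover have "(\<integral>\<omega>. exp (clock V x t \<omega>) * J t \<omega> \<partial>M) = exp (- (l * t)) * FK V t (resolvent l k) x"
    using EJ[of t "\<lambda>_. 1"] t by simp
  ultimately show ?thesis by simp
qed

end

section \<open>Symmetry and Schur's test\<close>

lemma integrable_bounded_borel_mult: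
  fixes f g :: "real \<Rightarrow> real"
  assumes "integrable lborel f" "bounded_borel g"
  shows "integrable lborel (\<lambda>x. f x * g x)" "integrable lborel (\<lambda>x. g x * f x)"
proof -
  obtain C where C: "C \<ge> 0" "\<And>x. \<bar>g x\<bar> \<le> C" using assms(2) by (metis bounded_borelE)
  have "integrable lborel (\<lambda>x. C * f x)" using assms by simp
  then show "integrable lborel (\<lambda>x. f x * g x)"
  proof (rule Bochner_Integration.integrable_bound)
    show "AE x in lborel. norm (f x * g x) \<le> norm (C * f x)"
      using C by (intro AE_I2) (auto simp: abs_mult mult.commute[of C] intro!: mult_left_mono)
  qed (use assms bounded_borel_measurable in auto)
  then show "integrable lborel (\<lambda>x. g x * f x)" by (simp add: mult.commute)
qed

lemma integral_lborel_shift: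
  fixes f :: "real \<Rightarrow> real"
  shows "(LBINT x. f (x + c)) = (LBINT x. f x)"
  using lborel_integral_real_affine[of 1 f c] by (simp add: add.commute)

lemma nn_integral_lborel_shift:
  fixes f :: "real \<Rightarrow> ennreal"
  assumes [measurable]: "f \<in> borel_measurable borel"
  shows "(\<integral>\<^sup>+x. f (x - c) \<partial>lborel) = (\<integral>\<^sup>+x. f x \<partial>lborel)"
  using nn_integral_real_affine[of f 1 "- c"] by simp

context symmetric_levy_path
begin

text \<open>Lebesgue measure is translation invariant: for each \<omega> the integral over x does
  not see the shift by \<open>X d \<omega>\<close>.\<close>

lemma integrable_shift:
  assumes f: "integrable lborel f"
  shows "integrable (lborel \<Otimes>\<^sub>M M) (\<lambda>(x, \<omega>). f (x - X d \<omega>) :: real)"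
proof (rule integrableI_bounded)
  have [measurable]: "f \<in> borel_measurable borel" using f by auto
  show "(\<lambda>(x, \<omega>). f (x - X d \<omega>)) \<in> borel_measurable (lborel \<Otimes>\<^sub>M M)" by measurable
  have "(\<integral>\<^sup>+z. norm (case z of (x, \<omega>) \<Rightarrow> f (x - X d \<omega>)) \<partial>(lborel \<Otimes>\<^sub>M M))
      = (\<integral>\<^sup>+\<omega>. \<integral>\<^sup>+x. ennreal \<bar>f (x - X d \<omega>)\<bar> \<partial>lborel \<partial>M)"
    by (subst PL.nn_integral_snd[symmetric]) auto
  also have "\<dots> = (\<integral>\<^sup>+x. ennreal \<bar>f x\<bar> \<partial>lborel)"
    by (subst nn_integral_lborel_shift[of "\<lambda>x. ennreal \<bar>f x\<bar>"]) (auto simp: emeasure_space_1)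
  also have "\<dots> < \<infinity>" using f by (simp add: integrable_iff_bounded)
  finally show "(\<integral>\<^sup>+z. norm (case z of (x, \<omega>) \<Rightarrow> f (x - X d \<omega>)) \<partial>(lborel \<Otimes>\<^sub>M M)) < \<infinity>" .
qed

lemma integrable_trans:
  "integrable lborel f \<Longrightarrow> integrable lborel (trans d f)"
  using PL.integrable_fst'[OF integrable_shift, of f d] by (simp add: trans_def[abs_def])

lemma trans_reflect:
  assumes [measurable]: "g \<in> borel_measurable borel" and d: "d \<ge> 0"
  shows "(\<integral>\<omega>. g (x + X d \<omega>) \<partial>M) = trans d g x"
proof -
  have "(\<integral>\<omega>. g (x + X d \<omega>) \<partial>M) = (\<integral>y. g (x - y) \<partial>distr M borel (\<lambda>\<omega>. - X d \<omega>))"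
    by (subst integral_distr) auto
  also have "\<dots> = trans d g x"
    unfolding X_symm[OF d] trans_def by (subst integral_distr) auto
  finally show ?thesis .
qed

text \<open>Translating x by X d moves the displacement from f to g with the opposite sign, and the
  symmetry of the law of X d removes the sign.\<close>

lemma trans_symmetric:
  assumes f: "integrable lborel f" and g: "bounded_borel g" and d: "d \<ge> 0"
  shows "(LBINT x. g x * trans d f x) = (LBINT x. f x * trans d g x)"
proof -
  have [measurable]: "f \<in> borel_measurable borel" "g \<in> borel_measurable borel"
    using f g by (auto dest: bounded_borel_measurable)
  obtain C where C: "C \<ge> 0" "\<And>x. \<bar>g x\<bar> \<le> C" using g by (metis bounded_borelE)
  have int: "integrable (lborel \<Otimes>\<^sub>M M) (\<lambda>(x, \<omega>). g x * f (x - X d \<omega>))"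
  proof (rule Bochner_Integration.integrable_bound)
    show "integrable (lborel \<Otimes>\<^sub>M M) (\<lambda>z. C * (case z of (x, \<omega>) \<Rightarrow> f (x - X d \<omega>)))"
      by (intro integrable_mult_right integrable_shift f)
    show "AE z in lborel \<Otimes>\<^sub>M M. norm (case z of (x, \<omega>) \<Rightarrow> g x * f (x - X d \<omega>)) \<le> norm (C * (case z of (x, \<omega>) \<Rightarrow> f (x - X d \<omega>)))"
      using C by (intro AE_I2) (auto simp: abs_mult intro!: mult_right_mono)
  qed measurable
  have "(LBINT x. g x * trans d f x) = (LBINT x. \<integral>\<omega>. g x * f (x - X d \<omega>) \<partial>M)"
    by (simp add: trans_def)
  also have "\<dots> = (\<integral>\<omega>. \<integral>x. g x * f (x - X d \<omega>) \<partial>lborel \<partial>M)"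
    by (rule PL.Fubini_integral[OF int, symmetric])
  also have "\<dots> = (\<integral>\<omega>. 1 * (LBINT x. f x * g (x + X d \<omega>)) \<partial>M)"
  proof (rule Bochner_Integration.integral_cong[OF refl])
    fix \<omega>
    show "(LBINT x. g x * f (x - X d \<omega>)) = 1 * (LBINT x. f x * g (x + X d \<omega>))"
      using integral_lborel_shift[of "\<lambda>x. g x * f (x - X d \<omega>)" "X d \<omega>"] by (simp add: mult.commute)
  qed
  also have "\<dots> = (LBINT x. f x * (\<integral>\<omega>. 1 * g (x + X d \<omega>) \<partial>M))"
    using f C by (intro PL.fubini_bounded[symmetric, where C = C]) auto
  also have "\<dots> = (LBINT x. f x * trans d g x)"
    using d by (simp add: trans_reflect)
  finally show ?thesis .
qed

lemma integrable_step: "integrable lborel f \<Longrightarrow> bounded_borel w \<Longrightarrow> integrable lborel (step h w f)"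
  unfolding step_def by (intro integrable_trans integrable_bounded_borel_mult)

lemma integrable_step_funpow:
  "integrable lborel f \<Longrightarrow> bounded_borel w \<Longrightarrow> integrable lborel ((step h w ^^ n) f)"
  by (induction n) (auto intro: integrable_step)

text \<open>With P the free motion and M multiplication by w, \<open>step\<close> is P M and its
  adjoint is M P. Since (M P)^n M = M (P M)^n, the operator M (P M)^n is symmetric, which explains
  the factor w on both sides.\<close>

lemma step_funpow_adjoint:
  assumes f: "integrable lborel f" and g: "bounded_borel g" and w: "bounded_borel w" and h: "h \<ge> 0"
  shows "(LBINT x. (w x * g x) * (step h w ^^ n) f x) = (LBINT x. f x * (w x * (step h w ^^ n) g x))"
  using g
proof (induction n arbitrary: g)
  case (Suc n)
  have "(LBINT x. (w x * g x) * (step h w ^^ Suc n) f x) = (LBINT x. (w x * g x) * trans h (\<lambda>y. w y * (step h w ^^ n) f y) x)"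
    by (simp add: step_def)
  also have "\<dots> = (LBINT x. (w x * (step h w ^^ n) f x) * trans h (\<lambda>x. w x * g x) x)"
    using f w h Suc.prems by (intro trans_symmetric integrable_bounded_borel_mult integrable_step_funpow) auto
  also have "\<dots> = (LBINT x. (w x * step h w g x) * (step h w ^^ n) f x)"
    by (simp add: step_def mult.commute mult.left_commute)
  also have "\<dots> = (LBINT x. f x * (w x * (step h w ^^ n) (step h w g) x))"
    using Suc.prems w by (intro Suc.IH) auto
  finally show ?case by (simp only: funpow_Suc_right o_def)
qed (simp add: mult.commute)

section \<open>Order, linearity, integrability and symmetry of the Feynman--Kac operators\<close>

lemma integrable_FK_integrand:
  assumes V: "bounded_borel V" and f: "bounded_borel f" and t: "t \<ge> 0"
  shows "integrable M (\<lambda>\<omega>. f (x - X t \<omega>) * exp (clock V x t \<omega>))"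
proof -
  note [measurable] = bounded_borel_measurable[OF V] bounded_borel_measurable[OF f]
  obtain B where B: "\<And>x. \<bar>V x\<bar> \<le> B" using V by (metis bounded_borelE)
  obtain C where C: "C \<ge> 0" "\<And>x. \<bar>f x\<bar> \<le> C" using f by (metis bounded_borelE)
  show ?thesis
    using order_trans[OF abs_ge_self clock_abs_le[of V B t x, OF B t]] C
    by (intro integrable_bounded[where C = "C * exp (B * t)"]) (auto simp: abs_mult intro!: mult_mono)
qed

lemma FK_mono:
  assumes "bounded_borel V" "bounded_borel f" "bounded_borel g" "t \<ge> 0" "\<And>x. f x \<le> g x"
  shows "FK V t f x \<le> FK V t g x"
  unfolding FK_def using assms by (intro integral_mono integrable_FK_integrand) auto

lemma FK_add:
  assumes "bounded_borel V" "bounded_borel f" "bounded_borel g" "t \<ge> 0"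
  shows "FK V t (\<lambda>x. f x + g x) x = FK V t f x + FK V t g x"
  unfolding FK_def using assms
  by (subst Bochner_Integration.integral_add[symmetric]) (auto simp: algebra_simps intro!: integrable_FK_integrand)

lemma FK_cmult: "FK V t (\<lambda>x. c * f x) x = c * FK V t f x"
  unfolding FK_def by (simp add: mult.assoc)

lemma FK_diff:
  assumes "bounded_borel V" "bounded_borel f" "bounded_borel g" "t \<ge> 0"
  shows "FK V t (\<lambda>x. f x - g x) x = FK V t f x - FK V t g x"
  using FK_add[OF assms(1,2) bounded_borel_mult[OF bounded_borel_const[of "-1"] assms(3)] assms(4)]
    FK_cmult[of V t "-1" g x] by simp

lemma FK_nonneg:
  assumes "\<And>x. 0 \<le> f x"
  shows "0 \<le> FK V t f x"
  unfolding FK_def using assms by (intro Bochner_Integration.integral_nonneg) auto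

text \<open>Domination by the free semigroup. The latter preserves integrability in x by translation
  invariance, so the Feynman--Kac operators do as well.\<close>

lemma FK_abs_le_trans:
  assumes V: "bounded_borel V" "\<And>x. \<bar>V x\<bar> \<le> B" and f: "bounded_borel f" and t: "t \<ge> 0"
  shows "\<bar>FK V t f x\<bar> \<le> exp (B * t) * trans t (\<lambda>y. \<bar>f y\<bar>) x"
proof -
  note [measurable] = bounded_borel_measurable[OF f]
  obtain C where C: "C \<ge> 0" "\<And>x. \<bar>f x\<bar> \<le> C" using f by (metis bounded_borelE)
  have "\<bar>FK V t f x\<bar> \<le> (\<integral>\<omega>. exp (B * t) * \<bar>f (x - X t \<omega>)\<bar> \<partial>M)"
    unfolding FK_def
  proof (rule integral_abs_le)
    show "integrable M (\<lambda>\<omega>. exp (B * t) * \<bar>f (x - X t \<omega>)\<bar>)"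
      using C by (intro integrable_mult_right integrable_bounded[where C = C]) auto
    show "\<bar>f (x - X t \<omega>) * exp (clock V x t \<omega>)\<bar> \<le> exp (B * t) * \<bar>f (x - X t \<omega>)\<bar>" for \<omega>
      using clock_abs_le[of V B t x \<omega>, OF V(2) t]
      by (subst mult.commute) (auto simp: abs_mult intro!: mult_right_mono)
  qed (intro integrable_FK_integrand V f t)
  then show ?thesis by (simp add: trans_def)
qed

lemma integrable_FK:
  assumes V: "bounded_borel V" and f: "bounded_borel f" "integrable lborel f" and t: "t \<ge> 0"
  shows "integrable lborel (FK V t f)"
proof -
  note [measurable] = bounded_borel_measurable[OF V] bounded_borel_measurable[OF f(1)]
  obtain B where B: "\<And>x. \<bar>V x\<bar> \<le> B" using V by (metis bounded_borelE)
  have "integrable lborel (\<lambda>x. exp (B * t) * trans t (\<lambda>y. \<bar>f y\<bar>) x)"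
    using f by (intro integrable_mult_right integrable_trans) auto
  then show ?thesis
  proof (rule Bochner_Integration.integrable_bound)
    show "AE x in lborel. norm (FK V t f x) \<le> norm (exp (B * t) * trans t (\<lambda>y. \<bar>f y\<bar>) x)"
      using FK_abs_le_trans[OF V B f(1) t] by (intro AE_I2) (auto intro: order_trans[OF _ abs_ge_self])
  qed simp
qed

text \<open>Trotter products are symmetric only up to one weight w. Starting one side from u = g / w
  cancels it, and as n grows u tends to g and w to 1, so the asymmetry disappears in the
  limit.\<close>

lemma FK_symmetric:
  assumes V: "bounded_continuous V" and f: "bounded_borel f" "integrable lborel f" and g: "bounded_borel g" and t: "t \<ge> 0"
  shows "(LBINT x. g x * FK V t f x) = (LBINT x. f x * FK V t g x)"
proof -
  have Vb: "bounded_borel V" using V by simp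
  note [measurable] = bounded_borel_measurable[OF Vb] bounded_borel_measurable[OF f(1)] bounded_borel_measurable[OF g]
  obtain B where B: "B \<ge> 0" "\<And>x. \<bar>V x\<bar> \<le> B" using Vb by (metis bounded_borelE)
  obtain Cf where Cf: "Cf \<ge> 0" "\<And>x. \<bar>f x\<bar> \<le> Cf" using f by (metis bounded_borelE)
  obtain Cg where Cg: "Cg \<ge> 0" "\<And>x. \<bar>g x\<bar> \<le> Cg" using g by (metis bounded_borelE)
  define w where "w n y = exp (t / real (Suc n) * V y)" for n y
  define K where "K n = step (t / real (Suc n)) (w n) ^^ Suc n" for n
  define u where "u n y = exp (- (t / real (Suc n) * V y)) * g y" for n y
  have wb: "bounded_borel (w n)" for n unfolding w_def using Vb by simp
  have ub: "bounded_borel (u n)" for n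
    unfolding u_def using g bounded_borel_exp[OF bounded_borel_mult[OF bounded_borel_const[of "- (t / real (Suc n))"] Vb]] by simp
  have wu: "w n y * u n y = g y" for n y
    by (simp add: w_def u_def exp_minus)
  have wt: "\<bar>t / real (Suc n) * V y\<bar> \<le> t * B" for n y
  proof -
    have "t / real (Suc n) * \<bar>V y\<bar> \<le> t * B"
      using B t divide_left_mono[of 1 "real (Suc n)" t] by (intro mult_mono) auto
    then show ?thesis using t by (simp add: abs_mult)
  qed
  have u_bd: "\<bar>u n y\<bar> \<le> exp (t * B) * Cg" for n y
    unfolding u_def abs_mult using order_trans[OF abs_ge_minus_self wt[of n y]] Cg by (intro mult_mono) auto
  have w_bd: "\<bar>w n y\<bar> \<le> exp (t * B)" for n y
    unfolding w_def using order_trans[OF abs_ge_self wt[of n y]] by simp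
  have to0: "(\<lambda>n. t / real (Suc n) * V y) \<longlonglongrightarrow> 0" for y
    by (rule LIMSEQ_Suc[of "\<lambda>n. t / real n * V y"]) real_asymp
  have w_lim: "(\<lambda>n. w n y) \<longlonglongrightarrow> 1" for y
    unfolding w_def using tendsto_exp[OF to0[of y]] by simp
  have u_lim: "(\<lambda>n. u n y) \<longlonglongrightarrow> g y" for y
    unfolding u_def using tendsto_mult[OF tendsto_exp[OF tendsto_minus[OF to0[of y]]] tendsto_const[of "g y"]] by simp
  have Kf_lim: "(\<lambda>n. K n f y) \<longlonglongrightarrow> FK V t f y" for y
    unfolding K_def w_def by (rule step_funpow_tendsto[OF V t, of "\<lambda>_. f" Cf f]) (use f Cf in auto)
  have Ku_lim: "(\<lambda>n. K n (u n) y) \<longlonglongrightarrow> FK V t g y" for y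
    unfolding K_def w_def by (rule step_funpow_tendsto[OF V t ub u_bd u_lim])
  have Kf_meas: "bounded_borel (K n f)" "bounded_borel (K n (u n))" for n
    unfolding K_def using wb f(1) ub by (auto intro!: bounded_borel_step_funpow simp del: funpow.simps)
  have Ku_bd: "\<bar>K n (u n) y\<bar> \<le> exp (B * t) * (exp (t * B) * Cg)" for n y
    unfolding K_def w_def by (rule step_funpow_abs_le[OF Vb B(2) t ub u_bd])
  have Kf_bd: "\<bar>K n f y\<bar> \<le> exp (B * t) * trans t (\<lambda>y. \<bar>f y\<bar>) y" for n y
  proof -
    have "\<bar>K n f y\<bar> \<le> (\<integral>\<omega>. exp (B * t) * \<bar>f (y - X t \<omega>)\<bar> \<partial>M)"
      unfolding K_def w_def step_funpow_eq[OF Vb f(1) t zero_less_Suc]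
    proof (rule integral_abs_le)
      show bd: "\<bar>exp (rclock V y 0 t (Suc n) \<omega>) * f (y - X t \<omega>)\<bar> \<le> exp (B * t) * \<bar>f (y - X t \<omega>)\<bar>" for \<omega>
        using rclock_abs_le[of V B t y 0 "Suc n" \<omega>, OF B(2) t] by (auto simp: abs_mult intro!: mult_right_mono)
      show "integrable M (\<lambda>\<omega>. exp (B * t) * \<bar>f (y - X t \<omega>)\<bar>)"
        using Cf by (intro integrable_mult_right integrable_bounded[where C = Cf]) auto
      then show "integrable M (\<lambda>\<omega>. exp (rclock V y 0 t (Suc n) \<omega>) * f (y - X t \<omega>))"
        by (rule Bochner_Integration.integrable_bound) (use bd in auto)
    qed
    then show ?thesis by (simp add: trans_def)
  qed
  have eq: "(LBINT x. g x * K n f x) = (LBINT x. f x * (w n x * K n (u n) x))" for n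
    using step_funpow_adjoint[OF f(2) ub[of n] wb[of n], of "t / real (Suc n)" "Suc n"] t
    unfolding wu K_def by simp
  have dom1: "integrable lborel (\<lambda>x. Cg * (exp (B * t) * trans t (\<lambda>y. \<bar>f y\<bar>) x))"
    using f by (intro integrable_mult_right integrable_trans) auto
  note [measurable] = Kf_meas[THEN bounded_borel_measurable] wb[THEN bounded_borel_measurable]
  have "(\<lambda>n. \<integral>x. g x * K n f x \<partial>lborel) \<longlonglongrightarrow> (LBINT x. g x * FK V t f x)"
  proof (rule integral_dominated_convergence[OF _ _ dom1])
    show "AE x in lborel. (\<lambda>n. g x * K n f x) \<longlonglongrightarrow> g x * FK V t f x"
      by (intro AE_I2 tendsto_mult tendsto_const Kf_lim)
    show "AE x in lborel. norm (g x * K n f x) \<le> Cg * (exp (B * t) * trans t (\<lambda>y. \<bar>f y\<bar>) x)" for n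
      unfolding real_norm_def abs_mult using Kf_bd Cg by (intro AE_I2 mult_mono) auto
  qed auto
  moreover have "(\<lambda>n. \<integral>x. f x * (w n x * K n (u n) x) \<partial>lborel) \<longlonglongrightarrow> (LBINT x. f x * (1 * FK V t g x))"
  proof (rule integral_dominated_convergence[where w = "\<lambda>x. \<bar>f x\<bar> * (exp (t * B) * (exp (B * t) * (exp (t * B) * Cg)))"])
    show "AE x in lborel. (\<lambda>n. f x * (w n x * K n (u n) x)) \<longlonglongrightarrow> f x * (1 * FK V t g x)"
      by (intro AE_I2 tendsto_mult tendsto_const Ku_lim w_lim)
    show "AE x in lborel. norm (f x * (w n x * K n (u n) x)) \<le> \<bar>f x\<bar> * (exp (t * B) * (exp (B * t) * (exp (t * B) * Cg)))" for n
      unfolding real_norm_def abs_mult using Ku_bd w_bd by (intro AE_I2 mult_mono order_refl) auto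
    show "integrable lborel (\<lambda>x. \<bar>f x\<bar> * (exp (t * B) * (exp (B * t) * (exp (t * B) * Cg))))"
      using f by (intro integrable_mult_left) auto
  qed auto
  ultimately show ?thesis
    unfolding eq by (simp add: LIMSEQ_unique)
qed

text \<open>Schur's test with test function \<phi>: pointwise (FK f)^2 \<le> FK \<phi> * FK (f^2 /
  \<phi>) \<le> E \<phi> FK (f^2 / \<phi>), and after integration symmetry moves the operator back
  onto \<phi>, which costs a second factor E. The lower bound c > 0 keeps f / \<phi>
  bounded.\<close>

lemma FK_schur:
  assumes V: "bounded_continuous V" and f: "bounded_borel f" "integrable lborel f" and t: "t \<ge> 0"
    and \<phi>: "bounded_borel \<phi>" "c > 0" "\<And>x. c \<le> \<phi> x" and E: "E > 0" "\<And>x. FK V t \<phi> x \<le> E * \<phi> x"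
  shows "(LBINT x. (FK V t f x)\<^sup>2) \<le> E\<^sup>2 * (LBINT x. (f x)\<^sup>2)"
proof -
  have Vb: "bounded_borel V" using V by simp
  note [measurable] = bounded_borel_measurable[OF \<phi>(1)] bounded_borel_measurable[OF f(1)]
  have \<phi>pos: "\<phi> x > 0" for x using \<phi>(2) \<phi>(3)[of x] by linarith
  define h where "h x = f x * (f x / \<phi> x)" for x
  have hb: "bounded_borel (\<lambda>x. f x / \<phi> x)"
  proof -
    obtain C where C: "C \<ge> 0" "\<And>x. \<bar>f x\<bar> \<le> C" using f by (metis bounded_borelE)
    show ?thesis
      using C \<phi>pos \<phi>(2,3) by (intro bounded_borelI[of _ "C / c"]) (auto simp: abs_divide intro!: frac_le order_trans[OF _ abs_ge_self])
  qed
  then have h: "bounded_borel h" "integrable lborel h"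
    unfolding h_def using f bounded_borel_mult[of f "\<lambda>x. f x / \<phi> x"]
      integrable_bounded_borel_mult(1)[of f "\<lambda>x. f x / \<phi> x"] by blast+
  have f2: "integrable lborel (\<lambda>x. (f x)\<^sup>2)"
    using f by (intro bounded_borel_integrable_power2)
  have pt: "(FK V t f x)\<^sup>2 \<le> E * (\<phi> x * FK V t h x)" for x
  proof -
    \<comment> \<open>the optimal choice in \<open>2 a f \<le> a\<^sup>2 \<phi> + f\<^sup>2 / \<phi>\<close>, which replaces the Cauchy--Schwarz inequality\<close>
    define a where "a = FK V t f x / (E * \<phi> x)"
    have pos: "E * \<phi> x > 0" using E \<phi>pos by simp
    have "2 * a * FK V t f x = FK V t (\<lambda>y. 2 * a * f y) x"
      by (simp add: FK_cmult)
    also have "\<dots> \<le> FK V t (\<lambda>y. a\<^sup>2 * \<phi> y + h y) x"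
    proof (rule FK_mono)
      fix y
      have "0 \<le> (a * \<phi> y - f y)\<^sup>2" by simp
      then have "2 * a * f y * \<phi> y \<le> a\<^sup>2 * \<phi> y * \<phi> y + f y * f y"
        by (simp add: power2_eq_square algebra_simps)
      then show "2 * a * f y \<le> a\<^sup>2 * \<phi> y + h y"
        using \<phi>pos[of y] by (simp add: h_def field_simps)
    qed (use f \<phi> h Vb t in auto)
    also have "\<dots> = a\<^sup>2 * FK V t \<phi> x + FK V t h x"
      using Vb \<phi>(1) h t by (simp add: FK_add FK_cmult)
    also have "\<dots> \<le> a\<^sup>2 * (E * \<phi> x) + FK V t h x"
      using E by (intro add_right_mono mult_left_mono) auto
    finally have *: "2 * a * FK V t f x \<le> a\<^sup>2 * (E * \<phi> x) + FK V t h x" .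
    have "FK V t f x = a * (E * \<phi> x)" using less_imp_neq[OF pos] unfolding a_def by (metis nonzero_eq_divide_eq)
    with * have "a\<^sup>2 * (E * \<phi> x) \<le> FK V t h x" by (simp add: power2_eq_square algebra_simps)
    from mult_left_mono[OF this, of "E * \<phi> x"] pos show ?thesis
      using \<open>FK V t f x = a * (E * \<phi> x)\<close> by (simp add: power2_eq_square algebra_simps)
  qed
  have "(LBINT x. (FK V t f x)\<^sup>2) \<le> (LBINT x. E * (\<phi> x * FK V t h x))"
    using pt Vb f h \<phi> t
    by (intro integral_mono bounded_borel_integrable_power2 integrable_mult_right integrable_bounded_borel_mult(2) integrable_FK) auto
  also have "\<dots> = E * (LBINT x. h x * FK V t \<phi> x)"
    using FK_symmetric[OF V h \<phi>(1) t] by simp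
  also have "\<dots> \<le> E * (LBINT x. E * (f x)\<^sup>2)"
  proof (intro mult_left_mono integral_mono)
    show "integrable lborel (\<lambda>x. h x * FK V t \<phi> x)"
      using Vb h \<phi> t by (intro integrable_bounded_borel_mult(1)) auto
    fix x
    have hx: "h x \<ge> 0" using \<phi>pos[of x] by (simp add: h_def)
    have "h x * FK V t \<phi> x \<le> h x * (E * \<phi> x)" using hx E by (intro mult_left_mono) auto
    also have "\<dots> = E * (f x)\<^sup>2" using \<phi>pos[of x] by (simp add: h_def power2_eq_square)
    finally show "h x * FK V t \<phi> x \<le> E * (f x)\<^sup>2" .
  qed (use f2 E in auto)
  also have "\<dots> = E\<^sup>2 * (LBINT x. (f x)\<^sup>2)"
    by (simp add: power2_eq_square)
  finally show ?thesis .
qed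

text \<open>Along each path V (x - X s) * exp (clock) is the density of exp (clock). The time
  integral of \<open>FK V s V\<close> is thereby expressed by an exponential moment, without any
  reference to the height of V.\<close>

lemma FK_occupation:
  assumes V: "bounded_continuous V" and t: "t \<ge> 0"
  shows "(LBINT s:{0<..t}. FK V s V x) = FK V t (\<lambda>_. 1) x - 1"
proof -
  have Vb: "bounded_borel V" using V by simp
  note [measurable] = bounded_borel_measurable[OF Vb]
  obtain B where B: "B \<ge> 0" "\<And>x. \<bar>V x\<bar> \<le> B" using Vb by (metis bounded_borelE)
  define G where "G s \<omega> = (if 0 < s \<and> s \<le> t then V (x - X s \<omega>) * exp (clock V x s \<omega>) else 0)" for s \<omega>
  have G_bd: "\<bar>G s \<omega>\<bar> \<le> B * exp (B * t)" for s \<omega>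
    unfolding G_def using clock_abs_le[of V B s x \<omega>, OF B(2)] B mult_left_mono[of s t B]
    by (auto simp: abs_mult intro!: mult_mono)
  have "(LBINT s:{0<..t}. FK V s V x) = (LBINT s. indicator {0<..t} s * (\<integral>\<omega>. 1 * G s \<omega> \<partial>M))"
    unfolding set_lebesgue_integral_def FK_def
    by (intro Bochner_Integration.integral_cong) (auto simp: G_def indicator_def)
  also have "\<dots> = (\<integral>\<omega>. 1 * (LBINT s. indicator {0<..t} s * G s \<omega>) \<partial>M)"
    by (rule PL.fubini_bounded[OF _ _ _ G_bd]) (auto simp: G_def)
  also have "\<dots> = (\<integral>\<omega>. exp (clock V x t \<omega>) - 1 \<partial>M)"
  proof (rule Bochner_Integration.integral_cong[OF refl])
    fix \<omega> assume \<omega>: "\<omega> \<in> space M"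
    have "(LBINT s. indicator {0<..t} s * G s \<omega>) = (LBINT s:{0<..t}. V (x - X s \<omega>) * exp (clock V x s \<omega>))"
      unfolding set_lebesgue_integral_def by (intro Bochner_Integration.integral_cong) (auto simp: G_def indicator_def)
    moreover have "(\<lambda>r. V (x - X r \<omega>)) \<in> borel_measurable borel" "(\<lambda>r. clock V x r \<omega>) \<in> borel_measurable borel"
      using measurable_path[OF \<omega>, of V x 0] \<omega> by auto
    ultimately show "1 * (LBINT s. indicator {0<..t} s * G s \<omega>) = exp (clock V x t \<omega>) - 1"
      using exp_rule_bounded_density[of "\<lambda>s. V (x - X s \<omega>)" B "\<lambda>s. clock V x s \<omega>" t, OF _ _ clock_def] B t by simp
  qed
  also have "\<dots> = FK V t (\<lambda>_. 1) x - 1"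
    using integrable_FK_integrand[OF Vb bounded_borel_const[of 1] t, of x] by (simp add: FK_def prob_space)
  finally show ?thesis .
qed

text \<open>A supremum bound on the source would be useless, since V blows up as the bump narrows.
  Comparing the source with \<eta> V instead reduces the integral to the occupation identity, hence
  to an exponential moment that is bounded uniformly in the width.\<close>

lemma FK_small_source:
  assumes V: "bounded_continuous V" "\<And>x. 0 \<le> V x" and t: "t \<ge> 0" and l: "l \<ge> 0"
    and r: "r \<in> borel_measurable borel" "\<And>x. \<bar>r x\<bar> \<le> \<eta> * V x" and \<eta>: "\<eta> \<ge> 0"
  shows "\<bar>LBINT s:{0<..t}. exp (- (l * s)) * FK V s r x\<bar> \<le> \<eta> * FK V t (\<lambda>_. 1) x"
proof -
  have Vb: "bounded_borel V" using V by simp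
  obtain B where B: "B \<ge> 0" "\<And>x. \<bar>V x\<bar> \<le> B" using Vb by (metis bounded_borelE)
  have "\<bar>r x\<bar> \<le> \<eta> * B" for x
    using r(2)[of x] B(2)[of x] V(2)[of x] \<eta> mult_left_mono[of "V x" B \<eta>] by linarith
  then have rb: "bounded_borel r"
    using r by (intro bounded_borelI)
  note [measurable] = bounded_borel_measurable[OF Vb] r(1)
  have FKV: "\<bar>FK V s V x\<bar> \<le> exp (B * t) * B" if "0 < s" "s \<le> t" for s
  proof -
    have "\<bar>FK V s V x\<bar> \<le> exp (B * s) * B"
      using B that by (intro FK_abs_le) auto
    also have "\<dots> \<le> exp (B * t) * B" using B that by (intro mult_right_mono) (auto intro!: mult_left_mono)
    finally show ?thesis .
  qed
  have pt: "\<bar>exp (- (l * s)) * FK V s r x\<bar> \<le> \<eta> * FK V s V x" if "0 < s" "s \<le> t" for s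
  proof -
    have "FK V s r x \<le> FK V s (\<lambda>x. \<eta> * V x) x"
      using Vb rb that r(2) by (intro FK_mono) (auto simp: abs_le_iff)
    moreover have "FK V s (\<lambda>x. - 1 * r x) x \<le> FK V s (\<lambda>x. \<eta> * V x) x"
      using Vb rb that r(2) by (intro FK_mono bounded_borel_mult) (auto simp: abs_le_iff)
    ultimately have "\<bar>FK V s r x\<bar> \<le> \<eta> * FK V s V x"
      unfolding FK_cmult by linarith
    moreover have "exp (- (l * s)) \<le> 1" using l that by simp
    ultimately have "exp (- (l * s)) * \<bar>FK V s r x\<bar> \<le> 1 * (\<eta> * FK V s V x)"
      by (intro mult_mono) auto
    then show ?thesis by (simp add: abs_mult)
  qed
  have si: "set_integrable lborel {0<..t} (\<lambda>s. \<eta> * FK V s V x)"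
    by (rule set_integrable_bounded_Ioc[where C = "\<eta> * (exp (B * t) * B)"])
      (use FKV \<eta> in \<open>auto simp: abs_mult intro!: mult_left_mono\<close>)
  have "\<bar>LBINT s:{0<..t}. exp (- (l * s)) * FK V s r x\<bar> \<le> (LBINT s:{0<..t}. \<eta> * FK V s V x)"
    unfolding set_lebesgue_integral_def
  proof (rule integral_abs_le)
    show "integrable lborel (\<lambda>s. indicator {0<..t} s *\<^sub>R (\<eta> * FK V s V x))"
      using si by (simp add: set_integrable_def)
    show bd: "\<bar>indicator {0<..t} s *\<^sub>R (exp (- (l * s)) * FK V s r x)\<bar> \<le> indicator {0<..t} s *\<^sub>R (\<eta> * FK V s V x)" for s
      using pt[of s] by (auto simp: indicator_def)
    show "integrable lborel (\<lambda>s. indicator {0<..t} s *\<^sub>R (exp (- (l * s)) * FK V s r x))"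
      by (rule Bochner_Integration.integrable_bound[OF \<open>integrable lborel (\<lambda>s. indicator {0<..t} s *\<^sub>R (\<eta> * FK V s V x))\<close>])
        (unfold real_norm_def, measurable, intro AE_I2 order_trans[OF bd abs_ge_self])
  qed
  also have "\<dots> = \<eta> * (FK V t (\<lambda>_. 1) x - 1)"
    using FK_occupation[OF V(1) t] by simp
  also have "\<dots> \<le> \<eta> * FK V t (\<lambda>_. 1) x"
    using \<eta> by (simp add: algebra_simps)
  finally show ?thesis .
qed

end

section \<open>Green function\<close>

lemma continuous_cosine_transform:
  fixes \<phi> :: "real \<Rightarrow> real"
  assumes \<phi>: "integrable lborel \<phi>"
  shows "isCont (\<lambda>x. \<integral>t. \<phi> t * cos (t * x) \<partial>lborel) x"
  unfolding continuous_at_sequentially o_def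
proof (intro allI impI)
  fix u :: "nat \<Rightarrow> real" assume u: "u \<longlonglongrightarrow> x"
  show "(\<lambda>n. \<integral>t. \<phi> t * cos (t * u n) \<partial>lborel) \<longlonglongrightarrow> (LBINT t. \<phi> t * cos (t * x))"
  proof (rule integral_dominated_convergence[where w = "\<lambda>t. \<bar>\<phi> t\<bar>"])
    show "AE t in lborel. (\<lambda>n. \<phi> t * cos (t * u n)) \<longlonglongrightarrow> \<phi> t * cos (t * x)"
      using u by (intro AE_I2 tendsto_intros)
    show "AE t in lborel. norm (\<phi> t * cos (t * u n)) \<le> \<bar>\<phi> t\<bar>" for n
      by (intro AE_I2) (simp add: abs_mult mult_left_le)
  qed (use \<phi> in auto)
qed

lemma abs_cosine_transform_le:
  fixes \<phi> :: "real \<Rightarrow> real"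
  assumes \<phi>: "integrable lborel \<phi>"
  shows "\<bar>\<integral>t. \<phi> t * cos (t * x) \<partial>lborel\<bar> \<le> (LBINT t. \<bar>\<phi> t\<bar>)"
proof (rule integral_abs_le)
  show bd: "\<bar>\<phi> t * cos (t * x)\<bar> \<le> \<bar>\<phi> t\<bar>" for t
    by (simp add: abs_mult mult_left_le)
  show "integrable lborel (\<lambda>t. \<phi> t * cos (t * x))"
    by (rule Bochner_Integration.integrable_bound[OF \<phi>]) (use \<phi> bd in auto)
qed (use \<phi> in auto)

lemma integral_cos_Icc:
  fixes a b t :: real
  assumes "a \<le> b" "t \<noteq> 0"
  shows "(LBINT x. indicator {a..b} x * cos (t * x)) = (sin (t * b) - sin (t * a)) / t"
proof -
  have "(LBINT x. indicator {a..b} x *\<^sub>R cos (t * x)) = sin (t * b) / t - sin (t * a) / t"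
  proof (rule integral_FTC_atLeastAtMost[OF assms(1)])
    show "((\<lambda>x. sin (t * x) / t) has_vector_derivative cos (t * x)) (at x within {a..b})" for x
      using assms(2) unfolding has_real_derivative_iff_has_vector_derivative[symmetric]
      by (auto intro!: derivative_eq_intros)
  qed (intro continuous_intros)
  then show ?thesis by (simp add: diff_divide_distrib)
qed

text \<open>Levy's inversion formula is a limit of integrals over (-T, T). Integrability of \<phi>
  makes it a Lebesgue integral; its real part has the kernel (sin (t b) - sin (t a)) / t, the
  integral of cos (t x) over [a, b], and Fubini finishes.\<close>

lemma (in real_distribution) measure_Ioc_of_integrable_char:
  fixes \<phi> :: "real \<Rightarrow> real"
  assumes \<phi>: "\<And>t. char M t = of_real (\<phi> t)" "integrable lborel \<phi>"
    and ab: "a \<le> b" "measure M {a} = 0" "measure M {b} = 0"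
  shows "measure M {a<..b} = (LBINT x. indicator {a..b} x * (1 / (2 * pi) * (LBINT t. \<phi> t * cos (t * x))))"
proof -
  have [measurable]: "\<phi> \<in> borel_measurable borel" using \<phi>(2) by auto
  define F where "F t = (iexp (-(t * a)) - iexp (-(t * b))) / (\<i> * t)" for t :: real
  have [measurable]: "F \<in> borel_measurable borel" unfolding F_def by measurable
  have F_bd: "norm (F t) \<le> b - a" for t
  proof (cases "t = 0")
    case False
    have "F t = - ((iexp ((-t) * b) - iexp ((-t) * a)) / (\<i> * t))"
      unfolding F_def by (simp add: minus_divide_left)
    also have "norm \<dots> = norm ((iexp ((-t) * b) - iexp ((-t) * a)) / (\<i> * (-t)))"
      by (simp add: norm_divide norm_mult)
    also have "\<dots> \<le> b - a"
      using Levy_Inversion_aux2[OF ab(1), of "-t"] False by simp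
    finally show ?thesis .
  qed (use ab in \<open>simp add: F_def\<close>)
  have Re_F: "Re (F t * of_real (\<phi> t)) = \<phi> t * ((sin (t * b) - sin (t * a)) / t)" for t
  proof (cases "t = 0")
    case False
    have "F t = ((cos (t * a) - \<i> * sin (t * a)) - (cos (t * b) - \<i> * sin (t * b))) / (\<i> * t)"
    proof -
      have ie: "iexp (- u) = of_real (cos u) - \<i> * of_real (sin u)" for u :: real
        by (simp add: complex_eq_iff Re_exp Im_exp)
      show ?thesis unfolding F_def ie ..
    qed
    also have "\<dots> = Complex ((sin (t * b) - sin (t * a)) / t) ((cos (t * b) - cos (t * a)) / t)"
      using False by (simp add: complex_eq_iff Re_divide Im_divide power2_eq_square field_simps)
    finally show ?thesis by simp
  qed (simp add: F_def)
  have int: "integrable lborel (\<lambda>t. F t * of_real (\<phi> t))"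
  proof (rule Bochner_Integration.integrable_bound)
    show "integrable lborel (\<lambda>t. (b - a) * \<phi> t)" using \<phi>(2) by simp
    show "AE t in lborel. norm (F t * of_real (\<phi> t)) \<le> norm ((b - a) * \<phi> t)"
      using F_bd ab by (intro AE_I2) (auto simp: norm_mult abs_mult intro!: mult_right_mono)
  qed measurable
  have "(\<lambda>T. CLBINT t=- real T..real T. F t * of_real (\<phi> t)) \<longlonglongrightarrow> (CLBINT t. F t * of_real (\<phi> t))"
  proof -
    have "(\<lambda>T. CLBINT t. indicator {- real T<..<real T} t *\<^sub>R (F t * of_real (\<phi> t))) \<longlonglongrightarrow> (CLBINT t. F t * of_real (\<phi> t))"
    proof (rule integral_dominated_convergence[where w = "\<lambda>t. norm (F t * of_real (\<phi> t))"])
      show "AE t in lborel. (\<lambda>T. indicator {- real T<..<real T} t *\<^sub>R (F t * of_real (\<phi> t))) \<longlonglongrightarrow> F t * of_real (\<phi> t)"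
      proof (intro AE_I2 tendsto_eventually)
        fix t :: real
        obtain N :: nat where N: "\<bar>t\<bar> < real N" using reals_Archimedean2 by blast
        show "\<forall>\<^sub>F T in sequentially. indicator {- real T<..<real T} t *\<^sub>R (F t * of_real (\<phi> t)) = F t * of_real (\<phi> t)"
          unfolding eventually_sequentially using N by (intro exI[of _ N]) (auto simp: indicator_def)
      qed
      show "integrable lborel (\<lambda>t. norm (F t * of_real (\<phi> t)))"
        using int by (rule integrable_norm)
      show "AE t in lborel. norm (indicator {- real T<..<real T} t *\<^sub>R (F t * of_real (\<phi> t))) \<le> norm (F t * of_real (\<phi> t))" for T
        by (auto simp: indicator_def)
    qed measurable
    then show ?thesis
      by (simp add: interval_lebesgue_integral_def set_lebesgue_integral_def)
  qed
  from tendsto_mult[OF tendsto_const[of "complex_of_real (1 / (2 * pi))"] this]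
  have "(\<lambda>T. complex_of_real (1 / (2 * pi)) * (CLBINT t=- real T..real T. F t * of_real (\<phi> t)))
      \<longlonglongrightarrow> of_real (1 / (2 * pi)) * (CLBINT t. F t * of_real (\<phi> t))"
    by simp
  moreover have "(\<lambda>T. complex_of_real (1 / (2 * pi)) * (CLBINT t=- real T..real T. F t * of_real (\<phi> t))) \<longlonglongrightarrow> of_real (measure M {a<..b})"
    using Levy_Inversion[OF ab] unfolding F_def \<phi>(1) by simp
  ultimately have "of_real (measure M {a<..b}) = of_real (1 / (2 * pi)) * (CLBINT t. F t * of_real (\<phi> t))"
    by (rule LIMSEQ_unique[rotated])
  then have "measure M {a<..b} = Re (of_real (1 / (2 * pi)) * (CLBINT t. F t * of_real (\<phi> t)))"
    by (metis (mono_tags) Re_complex_of_real)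
  also have "\<dots> = 1 / (2 * pi) * (LBINT t. \<phi> t * ((sin (t * b) - sin (t * a)) / t))"
    using integral_Re[OF int] unfolding Re_F by simp
  also have "(LBINT t. \<phi> t * ((sin (t * b) - sin (t * a)) / t)) = (LBINT t. \<phi> t * (LBINT x. indicator {a..b} x * cos (t * x)))"
  proof (rule integral_cong_AE)
    \<comment> \<open>At t = 0 the quotient is 0 by convention while the integral of the cosine is b
      - a; a single point is negligible.\<close>
    have "AE t in lborel. t \<noteq> (0 :: real)" by (rule AE_lborel_singleton)
    then show "AE t in lborel. \<phi> t * ((sin (t * b) - sin (t * a)) / t) = \<phi> t * (LBINT x. indicator {a..b} x * cos (t * x))"
      by eventually_elim (use ab in \<open>auto simp: integral_cos_Icc\<close>)
  qed measurable
  also have "\<dots> = (LBINT x. indicator {a..b} x * (LBINT t. \<phi> t * cos (t * x)))"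
    using \<phi>(2) by (intro lborel_pair.fubini_bounded[where C = 1] integrable_real_indicator) (auto simp: emeasure_lborel_Icc_eq)
  finally show ?thesis
    by (simp add: mult.left_commute)
qed

text \<open>Inversion is available only for intervals whose end points are not atoms. Such points
  are dense, and the bound B (b - a) for the mass of such intervals then excludes atoms altogether.
  A negative value of h would persist on an interval by continuity and give it negative
  mass.\<close>

lemma (in real_distribution) density_of_integrable_char:
  fixes \<phi> :: "real \<Rightarrow> real"
  assumes \<phi>: "\<And>t. char M t = of_real (\<phi> t)" "integrable lborel \<phi>"
  defines "h \<equiv> \<lambda>x. 1 / (2 * pi) * (LBINT t. \<phi> t * cos (t * x))"
  shows "0 \<le> h x" "M = density lborel (\<lambda>x. ennreal (h x))"
proof -
  have h_cont: "isCont h x" for x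
    unfolding h_def by (intro continuous_intros continuous_cosine_transform \<phi>)
  have h_meas [measurable]: "h \<in> borel_measurable borel"
    using h_cont by (intro borel_measurable_continuous_onI continuous_at_imp_continuous_on) auto
  define B where "B = 1 / (2 * pi) * (LBINT t. \<bar>\<phi> t\<bar>)"
  have h_bd: "\<bar>h x\<bar> \<le> B" for x
    unfolding h_def B_def abs_mult using abs_cosine_transform_le[OF \<phi>(2), of x] by (intro mult_mono) auto
  have B0: "B \<ge> 0" using h_bd abs_ge_zero order_trans by blast
  have atoms: "countable {x. measure M {x} \<noteq> 0}" by (rule countable_support)
  have choose_between: "\<exists>c. measure M {c} = 0 \<and> a < c \<and> c < b" if "a < b" for a b
    using open_minus_countable[OF atoms, of "{a<..<b}"] that by auto
  have Icc: "measure M {a<..b} = (LBINT x. indicator {a..b} x * h x)" if "a \<le> b" "measure M {a} = 0" "measure M {b} = 0" for a b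
    unfolding h_def using measure_Ioc_of_integrable_char[OF \<phi> that] .
  have Icc_bound: "(LBINT x. indicator {a..b} x * h x) \<le> B * (b - a)" if "a \<le> b" for a b
  proof -
    have "\<bar>\<integral>x. indicator {a..b} x * h x \<partial>lborel\<bar> \<le> (LBINT x. B * indicator {a..b} x)"
    proof (rule integral_abs_le)
      show "integrable lborel (\<lambda>x. indicator {a..b} x * h x)"
        using integrableI_bounded_set_indicator[of "{a..b}" lborel h B] h_bd by (simp add: emeasure_lborel_Icc_eq)
      show "integrable lborel (\<lambda>x. B * indicator {a..b} x)"
        by (intro integrable_mult_right integrable_real_indicator) (auto simp: emeasure_lborel_Icc_eq)
    qed (use h_bd in \<open>auto simp: indicator_def\<close>)
    then show ?thesis using that by simp
  qed
  have no_atoms: "measure M {x} = 0" for x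
  proof (rule ccontr)
    assume "measure M {x} \<noteq> 0"
    then have p: "measure M {x} > 0" using measure_nonneg[of M "{x}"] by linarith
    \<comment> \<open>The added 1 avoids division by 0. With e chosen as a quarter of the mass over
      D, an interval of length at most 2 e around x carries at most half of the supposed
      atom.\<close>
    define D where "D = B + 1"
    have D: "D > 0" using B0 by (simp add: D_def)
    define e where "e = measure M {x} / (4 * D)"
    have e: "e > 0" using p D by (simp add: e_def)
    obtain a where a: "measure M {a} = 0" "x - e < a" "a < x" using choose_between[of "x - e" x] e by auto
    obtain b where b: "measure M {b} = 0" "x < b" "b < x + e" using choose_between[of x "x + e"] e by auto
    have "measure M {x} \<le> measure M {a<..b}" using a b by (intro finite_measure_mono) auto
    also have "\<dots> \<le> B * (b - a)" using Icc[of a b] Icc_bound[of a b] a b by simp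
    also have "\<dots> \<le> D * (2 * e)" using a b B0 by (intro mult_mono) (auto simp: D_def)
    also have "\<dots> = measure M {x} / 2" using D by (simp add: e_def)
    finally show False using p by simp
  qed
  show h_nonneg: "0 \<le> h x" for x
  proof (rule ccontr)
    assume neg: "\<not> 0 \<le> h x"
    have "h \<midarrow>x\<rightarrow> h x" using h_cont[of x] by (simp add: isCont_def)
    then have "\<forall>\<^sub>F y in nhds x. h y < h x / 2"
      using neg h_cont[of x] order_tendstoD(2)[of h "h x" "nhds x" "h x / 2"] by (simp add: isCont_def tendsto_at_iff_tendsto_nhds)
    then obtain d where d: "d > 0" "\<And>y. \<bar>y - x\<bar> < d \<Longrightarrow> h y < h x / 2"
      unfolding eventually_nhds_metric dist_real_def by auto
    define b where "b = x + d / 2"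
    have "0 \<le> measure M {x<..b}" by simp
    also have "\<dots> = (LBINT y. indicator {x..b} y * h y)" using d by (intro Icc no_atoms) (auto simp: b_def)
    also have "\<dots> \<le> (LBINT y. h x / 2 * indicator {x..b} y)"
    proof (rule integral_mono)
      show "integrable lborel (\<lambda>y. indicator {x..b} y * h y)"
        using integrableI_bounded_set_indicator[of "{x..b}" lborel h B] h_bd by (simp add: emeasure_lborel_Icc_eq)
      show "indicator {x..b} y * h y \<le> h x / 2 * indicator {x..b} y" for y
        using d(2)[of y] d(1) by (auto simp: indicator_def b_def)
      show "integrable lborel (\<lambda>y. h x / 2 * indicator {x..b} y)"
        by (intro integrable_mult_right integrable_real_indicator) (auto simp: emeasure_lborel_Icc_eq)
    qed
    also have "\<dots> = h x / 2 * (d / 2)" using d by (simp add: b_def)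
    also have "\<dots> < 0" using neg d by (intro mult_neg_pos) auto
    finally show False by simp
  qed
  show "M = density lborel (\<lambda>x. ennreal (h x))"
  proof (rule measure_eqI_generator_eq[where E = "range (\<lambda>(a, b). {a<..b::real})" and \<Omega> = UNIV and A = "\<lambda>n. {- real n<..real n}"])
    show "Int_stable (range (\<lambda>(a, b). {a<..b::real}))"
      by (auto simp: Int_stable_def)
    fix S :: "real set" assume "S \<in> range (\<lambda>(a, b). {a<..b})"
    then obtain a b where S: "S = {a<..b}" by auto
    show "emeasure M S = emeasure (density lborel (\<lambda>x. ennreal (h x))) S"
    proof (cases "a \<le> b")
      case True
      have int: "integrable lborel (\<lambda>y. indicator {a..b} y * h y)"
        using integrableI_bounded_set_indicator[of "{a..b}" lborel h B] h_bd by (simp add: emeasure_lborel_Icc_eq)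
      have "emeasure (density lborel (\<lambda>x. ennreal (h x))) S = (\<integral>\<^sup>+x. ennreal (h x) * indicator {a<..b} x \<partial>lborel)"
        unfolding S by (subst emeasure_density) auto
      also have "\<dots> = (\<integral>\<^sup>+x. ennreal (indicator {a..b} x * h x) \<partial>lborel)"
      proof (rule nn_integral_cong_AE)
        have "AE x in lborel. x \<noteq> a" by (rule AE_lborel_singleton)
        then show "AE x in lborel. ennreal (h x) * indicator {a<..b} x = ennreal (indicator {a..b} x * h x)"
          by eventually_elim (auto simp: indicator_def)
      qed
      also have "\<dots> = ennreal (LBINT x. indicator {a..b} x * h x)"
        using int h_nonneg by (intro nn_integral_eq_integral) auto
      also have "\<dots> = emeasure M S"
        unfolding S emeasure_eq_measure Icc[OF True no_atoms no_atoms] ..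
      finally show ?thesis by simp
    qed (simp add: S)
  next
    show "range (\<lambda>n. {- real n<..real n}) \<subseteq> range (\<lambda>(a, b). {a<..b})" by auto
    show "(\<Union>i. {- real i<..real i}) = UNIV"
    proof (intro set_eqI iffI UNIV_I)
      fix x :: real
      obtain N :: nat where "\<bar>x\<bar> < real N" using reals_Archimedean2 by blast
      then show "x \<in> (\<Union>i. {- real i<..real i})" by (intro UN_I[of N]) auto
    qed
  next
    have "sets borel = sigma_sets UNIV (range (\<lambda>(a, b). {a<..b::real}))"
      by (subst borel_sigma_sets_Ioc) (simp add: sets_measure_of)
    then show "sets M = sigma_sets UNIV (range (\<lambda>(a, b). {a<..b}))"
      "sets (density lborel (\<lambda>x. ennreal (h x))) = sigma_sets UNIV (range (\<lambda>(a, b). {a<..b}))"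
      by simp_all
  qed (auto simp: emeasure_eq_measure)
qed

text \<open>Nonnegativity, evenness and measurability of \<Psi> are consequences of the two
  assumptions: the characteristic function has modulus at most 1, it is real, and \<Psi> is
  recovered from 1 / (1 + \<Psi>).\<close>

locale symmetric_levy_exponent = symmetric_levy_path M X
  for M :: "'a measure" and X :: "real \<Rightarrow> 'a \<Rightarrow> real" +
  fixes \<Psi> :: "real \<Rightarrow> real"
  assumes char_X: "t \<ge> 0 \<Longrightarrow> (CLINT \<omega>|M. exp (\<i> * of_real (p * X t \<omega>))) = exp (- of_real (t * \<Psi> p))"
    and Psi_integrable: "integrable lborel (\<lambda>p. 1 / (1 + \<Psi> p))"
begin

lemma Psi_nonneg: "\<Psi> p \<ge> 0"
proof -
  have "exp (- \<Psi> p) = norm (CLINT \<omega>|M. exp (\<i> * of_real (p * X 1 \<omega>)))"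
    using char_X[of 1 p] by simp
  also have "\<dots> \<le> (\<integral>\<omega>. norm (exp (\<i> * of_real (p * X 1 \<omega>))) \<partial>M)"
    by (rule integral_norm_bound)
  also have "\<dots> = 1" by (simp add: prob_space)
  finally show ?thesis by simp
qed

lemma measurable_Psi [measurable]: "\<Psi> \<in> borel_measurable borel"
proof -
  have [measurable]: "(\<lambda>p. 1 / (1 + \<Psi> p)) \<in> borel_measurable borel"
    using Psi_integrable by auto
  have "\<Psi> = (\<lambda>p. 1 / (1 / (1 + \<Psi> p)) - 1)" by auto
  also have "\<dots> \<in> borel_measurable borel" by measurable
  finally show ?thesis .
qed

lemma Psi_minus: "\<Psi> (- p) = \<Psi> p"
proof -
  have "exp (- complex_of_real (1 * \<Psi> (- p))) = (CLINT \<omega>|M. cnj (exp (\<i> * of_real (p * X 1 \<omega>))))"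
    using char_X[of 1 "- p"] by (simp add: exp_cnj)
  also have "\<dots> = cnj (exp (- complex_of_real (1 * \<Psi> p)))"
    using char_X[of 1 p] Bochner_Integration.integral_cnj[of M "\<lambda>\<omega>. exp (\<i> * of_real (p * X 1 \<omega>))"] by simp
  also have "\<dots> = exp (- complex_of_real (1 * \<Psi> p))"
    by (simp add: exp_cnj)
  finally have "complex_of_real (exp (- \<Psi> (- p))) = complex_of_real (exp (- \<Psi> p))"
    by (simp add: exp_of_real[symmetric])
  then show ?thesis by (simp only: of_real_eq_iff exp_inj_iff neg_equal_iff_equal)
qed

lemma integrable_inverse_Psi:
  assumes l: "l > 0"
  shows "integrable lborel (\<lambda>p. 1 / (l + \<Psi> p))"
proof (rule Bochner_Integration.integrable_bound)
  show "integrable lborel (\<lambda>p. max 1 (1 / l) * (1 / (1 + \<Psi> p)))" by (rule integrable_mult_right[OF Psi_integrable])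
  show "AE p in lborel. norm (1 / (l + \<Psi> p)) \<le> norm (max 1 (1 / l) * (1 / (1 + \<Psi> p)))"
  proof (rule AE_I2)
    fix p
    have "1 + \<Psi> p \<le> max 1 (1 / l) * (l + \<Psi> p)"
    proof -
      have "1 \<le> max 1 (1 / l) * l" using l mult_right_mono[of "1 / l" "max 1 (1 / l)" l] by simp
      moreover have "1 * \<Psi> p \<le> max 1 (1 / l) * \<Psi> p" using Psi_nonneg[of p] by (intro mult_right_mono) auto
      ultimately show ?thesis by (simp add: distrib_left)
    qed
    then have "1 / (l + \<Psi> p) \<le> max 1 (1 / l) * (1 / (1 + \<Psi> p))"
      using l Psi_nonneg[of p] by (simp add: divide_simps)
    then show "norm (1 / (l + \<Psi> p)) \<le> norm (max 1 (1 / l) * (1 / (1 + \<Psi> p)))"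
      using l Psi_nonneg[of p] by auto
  qed
qed measurable

text \<open>The function \<open>psi\<close> at a positive parameter in real form: \<Psi> is even, so
  the sine part of the Fourier integral vanishes (\<open>psi_eq_green\<close>).\<close>

definition green :: "real \<Rightarrow> real \<Rightarrow> real" where
  "green l x = 1 / (2 * pi) * (LBINT p. 1 / (l + \<Psi> p) * cos (p * x))"

lemma isCont_green: "l > 0 \<Longrightarrow> isCont (green l) x"
  unfolding green_def by (intro continuous_intros continuous_cosine_transform integrable_inverse_Psi)

lemma measurable_green [measurable]: "l > 0 \<Longrightarrow> green l \<in> borel_measurable borel"
  by (intro borel_measurable_continuous_onI continuous_at_imp_continuous_on) (auto intro: isCont_green)

lemma green_minus [simp]: "green l (- x) = green l x"
  by (simp add: green_def)

lemma green_le: 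
  assumes "l > 0"
  shows "green l x \<le> green l 0"
proof -
  have "(LBINT p. 1 / (l + \<Psi> p) * cos (p * x)) \<le> (LBINT p. \<bar>1 / (l + \<Psi> p)\<bar>)"
    using abs_cosine_transform_le[OF integrable_inverse_Psi[OF assms], of x] by simp
  also have "\<dots> = (LBINT p. 1 / (l + \<Psi> p) * cos (p * 0))"
    using assms Psi_nonneg by (intro Bochner_Integration.integral_cong) (auto simp: add_pos_nonneg)
  finally show ?thesis unfolding green_def by (intro mult_left_mono) auto
qed

text \<open>The integrands are strictly ordered at every p. Strictness makes every l' above a
  critical l subcritical, that is q * green l' 0 < 1, so that a supersolution is available
  there.\<close>

lemma green_0_strict_antimono:
  assumes "0 < l" "l < l'"
  shows "green l' 0 < green l 0"
proof -
  define d where "d p = 1 / (l + \<Psi> p) - 1 / (l' + \<Psi> p)" for p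
  have d_pos: "d p > 0" for p
    unfolding d_def using assms Psi_nonneg[of p] by (simp add: frac_less2)
  have int: "integrable lborel d"
    unfolding d_def using assms by (intro Bochner_Integration.integrable_diff integrable_inverse_Psi) auto
  have "(LBINT p. d p) \<noteq> 0"
  proof
    assume "(LBINT p. d p) = 0"
    then have "AE p in lborel. d p = 0"
      using integral_nonneg_eq_0_iff_AE[OF int] d_pos by (auto simp: less_imp_le)
    moreover have "(AE p in lborel. d p = 0) \<longleftrightarrow> (AE p in (lborel :: real measure). False)"
      using d_pos by (intro AE_cong) (metis less_irrefl)
    ultimately show False by (simp add: eventually_False ae_filter_eq_bot_iff)
  qed
  moreover have "(LBINT p. d p) \<ge> 0" using d_pos by (intro Bochner_Integration.integral_nonneg) (auto simp: less_imp_le)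
  moreover have "green l 0 - green l' 0 = 1 / (2 * pi) * (LBINT p. d p)"
    unfolding green_def d_def using assms by (simp add: integrable_inverse_Psi right_diff_distrib)
  ultimately have "green l 0 - green l' 0 > 0" by (simp add: less_le)
  then show ?thesis by simp
qed

text \<open>Every coupling is subcritical for some l: the integrand tends to 0 as l grows, dominated
  by 1 / (1 + \<Psi>).\<close>

lemma green_0_small:
  assumes "e > 0"
  shows "\<exists>l>0. green l 0 < e"
proof -
  have "(\<lambda>n. \<integral>p. 1 / (real (Suc n) + \<Psi> p) \<partial>lborel) \<longlonglongrightarrow> (\<integral>p. 0 \<partial>(lborel :: real measure))"
  proof (rule integral_dominated_convergence[OF _ _ Psi_integrable])
    show "AE p in lborel. (\<lambda>n. 1 / (real (Suc n) + \<Psi> p)) \<longlonglongrightarrow> 0"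
    proof (rule AE_I2)
      fix p show "(\<lambda>n. 1 / (real (Suc n) + \<Psi> p)) \<longlonglongrightarrow> 0"
        by (rule LIMSEQ_Suc[of "\<lambda>n. 1 / (real n + \<Psi> p)"]) real_asymp
    qed
    show "AE p in lborel. norm (1 / (real (Suc n) + \<Psi> p)) \<le> 1 / (1 + \<Psi> p)" for n
      using Psi_nonneg by (intro AE_I2) (auto simp: add_nonneg_nonneg intro!: frac_le add_pos_nonneg)
  qed auto
  from tendsto_mult[OF tendsto_const[of "1 / (2 * pi)"] this]
  have "(\<lambda>n. green (real (Suc n)) 0) \<longlonglongrightarrow> 0"
    unfolding green_def by simp
  then have "\<forall>\<^sub>F n in sequentially. green (real (Suc n)) 0 < e"
    using assms by (rule order_tendstoD)
  then obtain n where "green (real (Suc n)) 0 < e" by (auto simp: eventually_sequentially)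
  then show ?thesis by (intro exI[of _ "real (Suc n)"]) auto
qed

lemma psi_eq_green:
  assumes l: "l > 0"
  shows "psi \<Psi> (of_real l) x = of_real (green l x)"
proof -
  have int: "integrable lborel (\<lambda>p. 1 / (l + \<Psi> p) * c (p * x))" if [measurable]: "c \<in> borel_measurable borel" and "\<And>u. \<bar>c u\<bar> \<le> (1 :: real)" for c
    using integrable_inverse_Psi[OF l] that(2)
    by (intro Bochner_Integration.integrable_bound[OF integrable_inverse_Psi[OF l]] AE_I2) (auto simp: abs_mult intro!: mult_left_le divide_right_mono)
  have eq: "exp (- \<i> * of_real (p * x)) / (of_real (\<Psi> p) + of_real l) =
      complex_of_real (1 / (l + \<Psi> p) * cos (p * x)) + (- \<i>) * complex_of_real (1 / (l + \<Psi> p) * sin (p * x))" for p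
  proof -
    have e: "exp (- \<i> * of_real (p * x)) = complex_of_real (cos (p * x)) - \<i> * complex_of_real (sin (p * x))"
      using exp_Euler[of "- of_real (p * x)"] by (simp add: cos_of_real sin_of_real del: of_real_mult)
    show ?thesis unfolding e by (simp add: diff_divide_distrib add.commute)
  qed
  have odd: "(LBINT p. 1 / (l + \<Psi> p) * sin (p * x)) = 0"
  proof -
    have "(LBINT p. 1 / (l + \<Psi> p) * sin (p * x)) = (LBINT p. 1 / (l + \<Psi> (0 + - 1 * p)) * sin ((0 + - 1 * p) * x))"
      by (subst lborel_integral_real_affine[where c = "-1" and t = 0]) auto
    also have "\<dots> = - (LBINT p. 1 / (l + \<Psi> p) * sin (p * x))"
      by (simp add: Psi_minus)
    finally show ?thesis by simp
  qed
  have "(CLBINT p. exp (- \<i> * of_real (p * x)) / (of_real (\<Psi> p) + of_real l)) =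
     (CLBINT p. complex_of_real (1 / (l + \<Psi> p) * cos (p * x))) + (CLBINT p. (- \<i>) * complex_of_real (1 / (l + \<Psi> p) * sin (p * x)))"
    unfolding eq using int[of cos] int[of sin]
    by (intro Bochner_Integration.integral_add integrable_mult_right integrable_of_real) auto
  also have "\<dots> = complex_of_real (LBINT p. 1 / (l + \<Psi> p) * cos (p * x))"
    by (simp only: integral_complex_of_real integral_mult_right_zero odd) simp
  finally show ?thesis
    unfolding psi_def green_def by simp
qed

text \<open>The law of X at an independent exponential time of rate l. Its characteristic function l
  / (l + \<Psi>) is integrable, so inversion provides the density l * green l; positivity and
  integrability of \<open>green\<close> follow.\<close>

definition exp_law :: "real \<Rightarrow> real measure" where
  "exp_law l = distr (density lborel (\<lambda>u. ennreal (l * decay l u)) \<Otimes>\<^sub>M M) borel (\<lambda>(u, \<omega>). X u \<omega>)"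

lemma prob_space_decay:
  assumes l: "l > 0"
  shows "prob_space (density lborel (\<lambda>u. ennreal (l * decay l u)))"
proof
  have "(\<integral>\<^sup>+u. ennreal (l * decay l u) \<partial>lborel) = ennreal (LBINT u. l * decay l u)"
    using l by (intro nn_integral_eq_integral) auto
  then show "emeasure (density lborel (\<lambda>u. ennreal (l * decay l u))) (space (density lborel (\<lambda>u. ennreal (l * decay l u)))) = 1"
    using l by (simp add: emeasure_density)
qed

lemma integral_exp_law:
  fixes h :: "real \<Rightarrow> 'c :: {banach, second_countable_topology}"
  assumes l: "l > 0" and [measurable]: "h \<in> borel_measurable borel" and bd: "\<And>x. norm (h x) \<le> C"
  shows "(\<integral>x. h x \<partial>exp_law l) = (LBINT u. (l * decay l u) *\<^sub>R (\<integral>\<omega>. h (X u \<omega>) \<partial>M))"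
proof -
  let ?D = "density lborel (\<lambda>u. ennreal (l * decay l u))"
  interpret D: prob_space ?D using l by (rule prob_space_decay)
  interpret P: pair_prob_space ?D M by unfold_locales
  have int: "integrable (?D \<Otimes>\<^sub>M M) (\<lambda>(u, \<omega>). h (X u \<omega>))"
    by (rule P.P.integrable_const_bound[where B = C]) (use bd in auto)
  have "(\<integral>x. h x \<partial>exp_law l) = (\<integral>z. (case z of (u, \<omega>) \<Rightarrow> h (X u \<omega>)) \<partial>(?D \<Otimes>\<^sub>M M))"
    unfolding exp_law_def by (subst integral_distr) (auto simp: case_prod_unfold)
  also have "\<dots> = (\<integral>u. \<integral>\<omega>. h (X u \<omega>) \<partial>M \<partial>?D)"
    using P.integral_fst'[OF int] by simp
  also have "\<dots> = (LBINT u. (l * decay l u) *\<^sub>R (\<integral>\<omega>. h (X u \<omega>) \<partial>M))"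
    using l by (subst integral_density) auto
  finally show ?thesis .
qed

lemma exp_law_density:
  assumes l: "l > 0"
  shows "exp_law l = density lborel (\<lambda>x. ennreal (l * green l x))" "0 \<le> l * green l x"
proof -
  let ?D = "density lborel (\<lambda>u. ennreal (l * decay l u))"
  interpret D: prob_space ?D using l by (rule prob_space_decay)
  interpret P: pair_prob_space ?D M by unfold_locales
  interpret E: real_distribution "exp_law l"
    unfolding exp_law_def by (rule P.P.real_distribution_distr) (simp add: case_prod_unfold)
  have char: "char (exp_law l) p = of_real (l / (l + \<Psi> p))" for p
  proof -
    have "char (exp_law l) p = (CLBINT u. (l * decay l u) *\<^sub>R (CLINT \<omega>|M. iexp (p * X u \<omega>)))"
      unfolding char_def by (rule integral_exp_law[OF l, where C = 1]) auto
    also have "\<dots> = (CLBINT u. complex_of_real (l * decay (l + \<Psi> p) u))"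
    proof (rule Bochner_Integration.integral_cong[OF refl])
      fix u :: real
      show "(l * decay l u) *\<^sub>R (CLINT \<omega>|M. iexp (p * X u \<omega>)) = complex_of_real (l * decay (l + \<Psi> p) u)"
      proof (cases "u > 0")
        case True
        have "(l * decay l u) *\<^sub>R (CLINT \<omega>|M. iexp (p * X u \<omega>)) = complex_of_real (l * exp (- (l * u))) * complex_of_real (exp (- (u * \<Psi> p)))"
          using True char_X[of u p] by (simp add: decay_def scaleR_conv_of_real exp_of_real[symmetric])
        also have "\<dots> = complex_of_real (l * decay (l + \<Psi> p) u)"
          using True by (simp add: decay_def exp_add[symmetric] algebra_simps flip: of_real_mult)
        finally show ?thesis .
      qed (simp add: decay_def)
    qed
    also have "\<dots> = of_real (l / (l + \<Psi> p))"
      using l Psi_nonneg[of p] by (subst integral_complex_of_real) (simp add: add_pos_nonneg)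
    finally show ?thesis .
  qed
  have int: "integrable lborel (\<lambda>p. l / (l + \<Psi> p))"
    using integrable_mult_right[OF integrable_inverse_Psi[OF l], of l] by simp
  have eq: "1 / (2 * pi) * (LBINT t. l / (l + \<Psi> t) * cos (t * x)) = l * green l x" for x
  proof -
    have "(LBINT t. l / (l + \<Psi> t) * cos (t * x)) = (LBINT t. l * (1 / (l + \<Psi> t) * cos (t * x)))"
      by simp
    also have "\<dots> = l * (LBINT t. 1 / (l + \<Psi> t) * cos (t * x))"
      by (rule integral_mult_right_zero)
    finally show ?thesis by (simp add: green_def)
  qed
  show "exp_law l = density lborel (\<lambda>x. ennreal (l * green l x))" "0 \<le> l * green l x"
    using E.density_of_integrable_char[OF char int] unfolding eq by auto
qed

lemma green_nonneg: "l > 0 \<Longrightarrow> 0 \<le> green l x"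
  using exp_law_density(2)[of l x] by (simp add: zero_le_mult_iff)

lemma integrable_green: 
  assumes l: "l > 0"
  shows "integrable lborel (green l)"
proof (rule integrableI_nonneg)
  let ?D = "density lborel (\<lambda>u. ennreal (l * decay l u))"
  interpret D: prob_space ?D using l by (rule prob_space_decay)
  interpret P: pair_prob_space ?D M by unfold_locales
  interpret E: real_distribution "exp_law l"
    unfolding exp_law_def by (rule P.P.real_distribution_distr) (simp add: case_prod_unfold)
  have "ennreal l * (\<integral>\<^sup>+x. ennreal (green l x) \<partial>lborel) = emeasure (exp_law l) UNIV"
    using l green_nonneg[OF l] unfolding exp_law_density(1)[OF l]
    by (subst emeasure_density) (auto simp: nn_integral_cmult[symmetric] ennreal_mult)
  also have "\<dots> < \<infinity>" by (simp add: E.emeasure_eq_measure)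
  finally show "(\<integral>\<^sup>+x. ennreal (green l x) \<partial>lborel) < \<infinity>"
    using l by (auto simp: ennreal_mult_less_top)
qed (use l green_nonneg in auto)

lemma resolvent_eq_green:
  assumes l: "l > 0" and k: "bounded_borel k"
  shows "resolvent l k x = (LBINT y. k (x - y) * green l y)"
proof -
  obtain C where C: "C \<ge> 0" "\<And>x. \<bar>k x\<bar> \<le> C" using k by (metis bounded_borelE)
  have [measurable]: "k \<in> borel_measurable borel" using k by (rule bounded_borel_measurable)
  have "l * resolvent l k x = (LBINT u. (l * decay l u) *\<^sub>R (\<integral>\<omega>. k (x - X u \<omega>) \<partial>M))"
    unfolding resolvent_def trans_def by (simp add: mult.assoc)
  also have "\<dots> = (\<integral>y. k (x - y) \<partial>exp_law l)"
    using l C by (subst integral_exp_law[where C = C]) auto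
  also have "\<dots> = (LBINT y. l * (k (x - y) * green l y))"
    unfolding exp_law_density(1)[OF l] using l exp_law_density(2)[OF l]
    by (subst integral_density) (auto simp: ac_simps)
  finally show ?thesis using l by simp
qed

end

section \<open>Approximation of the point potential\<close>

definition tent :: "real \<Rightarrow> real" where
  "tent x = max 0 (1 - \<bar>x\<bar>)"

lemma tent_bounds: "0 \<le> tent x" "tent x \<le> 1" "\<bar>x\<bar> \<ge> 1 \<Longrightarrow> tent x = 0" "\<bar>x\<bar> \<le> 1 / 2 \<Longrightarrow> 1 / 2 \<le> tent x"
  by (auto simp: tent_def)

lemma measurable_tent [measurable]: "tent \<in> borel_measurable borel"
  unfolding tent_def by measurable

lemma integrable_tent: "integrable lborel tent"
proof (rule integrableI_bounded_set[where A = "{-1..1}" and B = 1])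
  show "AE x in lborel. x \<in> {-1..1} \<longrightarrow> norm (tent x) \<le> 1"
    using tent_bounds by (auto simp: abs_le_iff)
  show "AE x in lborel. x \<notin> {-1..1} \<longrightarrow> tent x = 0"
    by (intro AE_I2 impI tent_bounds(3)) auto
qed (auto simp: emeasure_lborel_Icc_eq)

lemma integral_tent_pos: "(LBINT x. tent x) > 0"
proof -
  have "(LBINT x. 1 / 2 * indicator {-1/2..1/2::real} x) \<le> (LBINT x. tent x)"
  proof (rule integral_mono[OF _ integrable_tent])
    show "integrable lborel (\<lambda>x. 1 / 2 * indicator {-1/2..1/2::real} x :: real)"
      by (intro integrable_mult_right integrable_real_indicator) (auto simp: emeasure_lborel_Icc_eq)
    show "1 / 2 * indicator {-1/2..1/2} x \<le> tent x" for x
      using tent_bounds(1)[of x] tent_bounds(4)[of x] by (auto simp: indicator_def abs_le_iff)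
  qed
  then show ?thesis by simp
qed

text \<open>A probability density supported within 1 / (n + 1) of 0. The tent shape is chosen for
  continuity, which the Riemann sums of the clock require of the potential.\<close>

definition bump :: "nat \<Rightarrow> real \<Rightarrow> real" where
  "bump n x = real (Suc n) * tent (real (Suc n) * x) / (LBINT y. tent y)"

lemma measurable_bump [measurable]: "bump n \<in> borel_measurable borel"
  unfolding bump_def by measurable

lemma bump_nonneg: "0 \<le> bump n x"
  unfolding bump_def using tent_bounds integral_tent_pos by (auto intro!: divide_nonneg_pos)

lemma bump_outside: "\<bar>x\<bar> > 1 / real (Suc n) \<Longrightarrow> bump n x = 0"
  unfolding bump_def using tent_bounds(3)[of "real (Suc n) * x"]
  by (simp add: abs_mult divide_less_eq mult.commute)

lemma bounded_continuous_bump: "bounded_continuous (\<lambda>x. q * bump n (x - a))"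
proof -
  have "continuous_on UNIV (\<lambda>x. q * bump n (x - a))"
  proof -
    have "continuous_on UNIV tent" unfolding tent_def by (intro continuous_intros)
    then have "continuous_on UNIV (\<lambda>x. tent (real (Suc n) * (x - a)))"
      by (rule continuous_on_compose2) (auto intro!: continuous_intros)
    then show ?thesis
      unfolding bump_def using integral_tent_pos by (intro continuous_intros) auto
  qed
  moreover have "\<bar>q * bump n (x - a)\<bar> \<le> \<bar>q\<bar> * (real (Suc n) * 1 / (LBINT y. tent y))" for x
    unfolding abs_mult abs_of_nonneg[OF bump_nonneg] unfolding bump_def
    using tent_bounds integral_tent_pos
    by (intro mult_left_mono divide_right_mono) (auto simp: less_imp_le)
  ultimately show ?thesis unfolding bounded_continuous_def by blast
qed

lemma integrable_bump: "integrable lborel (\<lambda>y. bump n (z - y))"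
  and integral_bump: "(LBINT y. bump n (z - y)) = 1"
proof -
  define m where "m = real (Suc n)"
  have m: "m > 0" by (simp add: m_def)
  have *: "bump n (z - (z + (- 1 / m) * u)) = m / (LBINT y. tent y) * tent u" for u
    unfolding bump_def m_def[symmetric] using m by simp
  have "integrable lborel (\<lambda>u. bump n (z - (z + (- 1 / m) * u)))"
    unfolding * using integrable_tent by (rule integrable_mult_right)
  then show "integrable lborel (\<lambda>y. bump n (z - y))"
    using m by (subst (asm) lborel_integrable_real_affine_iff) auto
  have "(LBINT y. bump n (z - y)) = \<bar>- 1 / m\<bar> *\<^sub>R (LBINT u. bump n (z - (z + (- 1 / m) * u)))"
    using m by (intro lborel_integral_real_affine) auto
  also have "\<dots> = 1"
    unfolding * using m integral_tent_pos by simp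
  finally show "(LBINT y. bump n (z - y)) = 1" .
qed

text \<open>The bump is a probability density in y that lives within 1 / (n + 1) of z, so the
  average deviates from c by at most e. The centre c is free: it may be a limit value, or the
  midpoint of a range that averaging has to preserve.\<close>

lemma bump_average:
  fixes h :: "real \<Rightarrow> real"
  assumes [measurable]: "h \<in> borel_measurable borel"
    and h: "\<And>y. \<bar>y - z\<bar> \<le> 1 / real (Suc n) \<Longrightarrow> \<bar>h y - c\<bar> \<le> e"
  shows "integrable lborel (\<lambda>y. bump n (z - y) * h y)"
    and "\<bar>(LBINT y. bump n (z - y) * h y) - c\<bar> \<le> e"
proof -
  have bd: "\<bar>bump n (z - y) * (h y - c)\<bar> \<le> e * bump n (z - y)" for y
  proof (cases "\<bar>z - y\<bar> \<le> 1 / real (Suc n)")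
    case True
    then have "\<bar>h y - c\<bar> \<le> e" by (intro h) (simp add: abs_minus_commute)
    then show ?thesis using bump_nonneg[of n "z - y"] by (simp add: abs_mult mult.commute mult_right_mono)
  qed (simp add: bump_outside)
  have i: "integrable lborel (\<lambda>y. bump n (z - y) * (h y - c))"
    by (rule Bochner_Integration.integrable_bound[OF integrable_mult_right[OF integrable_bump[of n z], of e]])
      (use bd in \<open>auto intro!: AE_I2 order_trans[OF bd abs_ge_self]\<close>)
  from Bochner_Integration.integrable_add[OF i integrable_mult_left[OF integrable_bump[of n z], of c]]
  show int: "integrable lborel (\<lambda>y. bump n (z - y) * h y)"
    by (simp add: algebra_simps)
  have "(LBINT y. bump n (z - y) * h y) - c = (LBINT y. bump n (z - y) * h y) - (LBINT y. bump n (z - y) * c)"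
    by (simp add: integral_bump)
  also have "\<dots> = (LBINT y. bump n (z - y) * (h y - c))"
    using int integrable_mult_left[OF integrable_bump[of n z], of c]
    by (subst Bochner_Integration.integral_diff[symmetric]) (auto simp: right_diff_distrib)
  also have "\<bar>\<dots>\<bar> \<le> (LBINT y. e * bump n (z - y))"
    by (rule integral_abs_le[OF i integrable_mult_right[OF integrable_bump] bd])
  also have "\<dots> = e" by (simp add: integral_bump)
  finally show "\<bar>(LBINT y. bump n (z - y) * h y) - c\<bar> \<le> e" .
qed

lemma bump_average_tendsto:
  fixes h :: "real \<Rightarrow> real"
  assumes [measurable]: "h \<in> borel_measurable borel" and h: "isCont h z"
  shows "(\<lambda>n. \<integral>y. bump n (z - y) * h y \<partial>lborel) \<longlonglongrightarrow> h z"
proof (rule LIMSEQ_I)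
  fix e :: real assume "e > 0"
  then obtain d where d: "d > 0" "\<And>y. \<bar>y - z\<bar> < d \<Longrightarrow> \<bar>h y - h z\<bar> < e / 2"
    using h unfolding continuous_at_eps_delta dist_real_def by (meson half_gt_zero)
  obtain N where N: "1 / real (Suc N) < d" using d(1) nat_approx_posE by blast
  have "\<bar>(LBINT y. bump n (z - y) * h y) - h z\<bar> < e" if "n \<ge> N" for n
  proof -
    have "1 / real (Suc n) \<le> 1 / real (Suc N)" using that by (intro divide_left_mono) auto
    then have "\<bar>(LBINT y. bump n (z - y) * h y) - h z\<bar> \<le> e / 2"
      using N d(2) by (intro bump_average(2)) (auto intro!: less_imp_le)
    then show ?thesis using \<open>e > 0\<close> by linarith
  qed
  then show "\<exists>N. \<forall>n\<ge>N. norm ((LBINT y. bump n (z - y) * h y) - h z) < e"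
    by auto
qed

section \<open>Supersolutions and bounds uniform in the width of the bump\<close>

context symmetric_levy_path
begin

lemma trans_const [simp]: "trans d (\<lambda>_. c) x = c"
  by (simp add: trans_def prob_space)

lemma trans_add:
  assumes "bounded_borel f" "bounded_borel g"
  shows "trans d (\<lambda>x. f x + g x) x = trans d f x + trans d g x"
proof -
  note [measurable] = assms[THEN bounded_borel_measurable]
  obtain C D where "\<And>x. \<bar>f x\<bar> \<le> C" "\<And>x. \<bar>g x\<bar> \<le> D" using assms by (metis bounded_borelE)
  then show ?thesis
    unfolding trans_def by (intro Bochner_Integration.integral_add integrable_bounded[where C = C] integrable_bounded[where C = D]) auto
qed

lemma resolvent_add_const:
  assumes "bounded_borel f" "l > 0"
  shows "resolvent l (\<lambda>x. f x + c) x = resolvent l f x + c / l"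
proof -
  obtain C where "\<And>x. \<bar>f x\<bar> \<le> C" using assms by (metis bounded_borelE)
  then have "integrable lborel (\<lambda>u. decay l u * trans u f x)"
    using assms by (intro integrable_decay_mult[where C = C] trans_abs_le) (auto dest: bounded_borel_measurable)
  then show ?thesis
    unfolding resolvent_def using assms by (simp add: trans_add distrib_left)
qed

lemma FK_le_of_supersolution:
  assumes V: "bounded_continuous V" and k: "bounded_borel k" and t: "t \<ge> 0" and l: "l > 0"
    and super: "\<And>x. V x * resolvent l k x \<le> k x"
  shows "FK V t (resolvent l k) x \<le> exp (l * t) * resolvent l k x"
proof -
  have "0 \<le> (LBINT s:{0<..t}. exp (- (l * s)) * FK V s (\<lambda>y. k y - V y * resolvent l k y) x)"
    unfolding set_lebesgue_integral_def
    using super by (intro Bochner_Integration.integral_nonneg) (auto simp: indicator_def intro!: mult_nonneg_nonneg FK_nonneg)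
  then have "exp (- (l * t)) * FK V t (resolvent l k) x \<le> resolvent l k x"
    using FK_duhamel[OF V k t l, of x] by linarith
  from mult_left_mono[OF this, of "exp (l * t)"] show ?thesis
    by (simp add: mult.assoc[symmetric] exp_add[symmetric])
qed

end

context symmetric_levy_exponent
begin

lemma resolvent_bump:
  assumes "l > 0"
  shows "resolvent l (\<lambda>y. bump n (y - a)) x = (LBINT y. bump n (x - a - y) * green l y)"
proof -
  have "bounded_borel (\<lambda>y. bump n (y - a))"
    using bounded_continuous_borel[OF bounded_continuous_bump[of 1]] by simp
  then show ?thesis
    using resolvent_eq_green[OF assms, of "\<lambda>y. bump n (y - a)" x] by (simp add: algebra_simps)
qed

lemma resolvent_bump_bounds:
  assumes l: "l > 0"
  shows "0 \<le> resolvent l (\<lambda>y. bump n (y - a)) x" "resolvent l (\<lambda>y. bump n (y - a)) x \<le> green l 0"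
proof -
  \<comment> \<open>The range [0, green l 0] is the ball of radius green l 0 / 2 about its midpoint,
    so one application of the averaging lemma yields both bounds.\<close>
  have "\<bar>resolvent l (\<lambda>y. bump n (y - a)) x - green l 0 / 2\<bar> \<le> green l 0 / 2"
    unfolding resolvent_bump[OF l]
  proof (rule bump_average(2))
    show "\<bar>green l y - green l 0 / 2\<bar> \<le> green l 0 / 2" for y
      using green_nonneg[OF l, of y] green_le[OF l, of y] by linarith
  qed (use l in auto)
  then show "0 \<le> resolvent l (\<lambda>y. bump n (y - a)) x" "resolvent l (\<lambda>y. bump n (y - a)) x \<le> green l 0"
    by linarith+
qed

lemma resolvent_bump_tendsto:
  "l > 0 \<Longrightarrow> (\<lambda>n. resolvent l (\<lambda>y. bump n (y - a)) x) \<longlonglongrightarrow> green l (x - a)"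
  unfolding resolvent_bump by (intro bump_average_tendsto isCont_green) auto

text \<open>On the support of the bump both the distance of x from a and the averaging radius are at
  most 1 / (n + 1), so \<open>green\<close> is evaluated within 2 / (n + 1) of 0; hence the
  threshold d / 2 below.\<close>

lemma resolvent_bump_near:
  assumes l: "l > 0" and \<eta>: "\<eta> > 0"
  shows "\<exists>N. \<forall>n\<ge>N. \<forall>x. \<bar>x - a\<bar> \<le> 1 / real (Suc n) \<longrightarrow> \<bar>resolvent l (\<lambda>y. bump n (y - a)) x - green l 0\<bar> \<le> \<eta>"
proof -
  obtain d where d: "d > 0" "\<And>y. \<bar>y\<bar> < d \<Longrightarrow> \<bar>green l y - green l 0\<bar> < \<eta>"
    using isCont_green[OF l, of 0] \<eta> unfolding continuous_at_eps_delta dist_real_def by auto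
  obtain N where N: "1 / real (Suc N) < d / 2" using d(1) nat_approx_posE[of "d / 2"] by auto
  have "\<bar>resolvent l (\<lambda>y. bump n (y - a)) x - green l 0\<bar> \<le> \<eta>" if n: "n \<ge> N" "\<bar>x - a\<bar> \<le> 1 / real (Suc n)" for n x
    unfolding resolvent_bump[OF l]
  proof (rule bump_average(2))
    fix y assume y: "\<bar>y - (x - a)\<bar> \<le> 1 / real (Suc n)"
    have "1 / real (Suc n) \<le> 1 / real (Suc N)" using n by (intro divide_left_mono) auto
    then have "\<bar>y\<bar> < d" using y n N by linarith
    then show "\<bar>green l y - green l 0\<bar> \<le> \<eta>" using d(2) by (simp add: less_imp_le)
  qed (use l in auto)
  then show ?thesis by blast
qed

text \<open>The bounds on \<open>\<phi>\<close> do not depend on the width of the bump; this yields exponential moments of the local time.\<close>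

lemma bump_supersolution:
  assumes q: "q > 0" and l: "l > 0" and small: "q * green l 0 < 1"
  defines "c \<equiv> 1 / q - green l 0"
  obtains \<phi> where "bounded_borel \<phi>" "c > 0" "\<And>x. c \<le> \<phi> x" "\<And>x. \<phi> x \<le> 1 / q"
    "\<And>t x. t \<ge> 0 \<Longrightarrow> FK (\<lambda>x. q * bump n (x - a)) t \<phi> x \<le> exp (l * t) * \<phi> x"
proof -
  \<comment> \<open>The resolvent of the constant l * c is c. This lifts \<phi> to at least c, and
    by the choice of c the upper bound green l 0 + c is exactly 1 / q, so that q * bump * \<phi>
    \<le> bump \<le> k.\<close>
  define k where "k x = bump n (x - a) + l * c" for x
  have bb: "bounded_borel (\<lambda>y. bump n (y - a))"
    using bounded_continuous_borel[OF bounded_continuous_bump[of 1]] by simp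
  then have kb: "bounded_borel k" unfolding k_def by simp
  have c: "c > 0" using small q by (simp add: c_def field_simps)
  have \<phi>: "resolvent l k x = resolvent l (\<lambda>y. bump n (y - a)) x + c" for x
    unfolding k_def using resolvent_add_const[OF bb l, of "l * c" x] l by simp
  have up: "resolvent l k x \<le> 1 / q" for x
    unfolding \<phi> using resolvent_bump_bounds(2)[OF l, of n a x] by (simp add: c_def)
  have super: "q * bump n (x - a) * resolvent l k x \<le> k x" for x
  proof -
    have "q * resolvent l k x \<le> 1" using up[of x] q by (simp add: field_simps)
    then have "bump n (x - a) * (q * resolvent l k x) \<le> bump n (x - a) * 1"
      by (intro mult_left_mono bump_nonneg)
    moreover have "0 \<le> l * c" using l c by simp
    ultimately show ?thesis by (simp add: k_def algebra_simps)
  qed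
  show ?thesis
  proof (rule that)
    show "bounded_borel (resolvent l k)" using kb l by simp
    show "c \<le> resolvent l k x" for x unfolding \<phi> using resolvent_bump_bounds(1)[OF l, of n a x] by simp
    show "FK (\<lambda>x. q * bump n (x - a)) t (resolvent l k) x \<le> exp (l * t) * resolvent l k x" if "t \<ge> 0" for t x
      using that by (intro FK_le_of_supersolution bounded_continuous_bump kb l super)
  qed (use up c in auto)
qed

text \<open>Take l subcritical for q. The supersolution lies between c and 1 / q, so the constant 1
  can be compared with it from both sides, and neither bound depends on n, a or x.\<close>

lemma FK_bump_one_bounded:
  assumes q: "q > 0" and t: "t \<ge> 0"
  obtains C where "\<And>n a x. FK (\<lambda>x. q * bump n (x - a)) t (\<lambda>_. 1) x \<le> C"
proof -
  obtain l where l: "l > 0" "green l 0 < 1 / q" using green_0_small[of "1 / q"] q by auto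
  then have small: "q * green l 0 < 1" using q by (simp add: field_simps)
  define c where "c = 1 / q - green l 0"
  have "FK (\<lambda>x. q * bump n (x - a)) t (\<lambda>_. 1) x \<le> 1 / c * (exp (l * t) * (1 / q))" for n a x
  proof -
    have Vb: "bounded_borel (\<lambda>x. q * bump n (x - a))" using bounded_continuous_bump by simp
    obtain \<phi> where \<phi>: "bounded_borel \<phi>" "c > 0" "\<And>x. c \<le> \<phi> x" "\<And>x. \<phi> x \<le> 1 / q"
      "\<And>t x. t \<ge> 0 \<Longrightarrow> FK (\<lambda>x. q * bump n (x - a)) t \<phi> x \<le> exp (l * t) * \<phi> x"
      using bump_supersolution[OF q l(1) small, of n a] unfolding c_def by blast
    have "FK (\<lambda>x. q * bump n (x - a)) t (\<lambda>_. 1) x \<le> FK (\<lambda>x. q * bump n (x - a)) t (\<lambda>x. 1 / c * \<phi> x) x"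
      using \<phi> Vb t by (intro FK_mono) auto
    also have "\<dots> = 1 / c * FK (\<lambda>x. q * bump n (x - a)) t \<phi> x" by (rule FK_cmult)
    also have "\<dots> \<le> 1 / c * (exp (l * t) * \<phi> x)" using \<phi> t by (intro mult_left_mono) auto
    also have "\<dots> \<le> 1 / c * (exp (l * t) * (1 / q))" using \<phi> by (intro mult_left_mono) auto
    finally show ?thesis .
  qed
  then show ?thesis using that by blast
qed

lemma FK_bump_contraction:
  assumes q: "q > 0" and l: "l > 0" and crit: "q * green l 0 = 1"
    and f: "bounded_borel f" "integrable lborel f" and t: "t \<ge> 0"
  shows "(LBINT x. (exp (- (l * t)) * FK (\<lambda>x. q * bump n (x - a)) t f x)\<^sup>2) \<le> (LBINT x. (f x)\<^sup>2)"
proof -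
  define A where "A = (LBINT x. (FK (\<lambda>x. q * bump n (x - a)) t f x)\<^sup>2)"
  define B where "B = (LBINT x. (f x)\<^sup>2)"
  have ineq: "A \<le> (exp (l' * t))\<^sup>2 * B" if l': "l' > l" for l'
  proof -
    have "green l' 0 < green l 0" using l l' by (intro green_0_strict_antimono) auto
    then have small: "q * green l' 0 < 1" using q crit mult_strict_left_mono[of "green l' 0" "green l 0" q] by simp
    obtain \<phi> where \<phi>: "bounded_borel \<phi>" "1 / q - green l' 0 > 0" "\<And>x. 1 / q - green l' 0 \<le> \<phi> x"
      "\<And>t x. t \<ge> 0 \<Longrightarrow> FK (\<lambda>x. q * bump n (x - a)) t \<phi> x \<le> exp (l' * t) * \<phi> x"
      using bump_supersolution[OF q _ small, of n a] l l' by (metis less_trans)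
    show ?thesis
      unfolding A_def B_def
      by (rule FK_schur[OF bounded_continuous_bump f t \<phi>(1-3)]) (use \<phi>(4) t in auto)
  qed
  have "((\<lambda>l'. (exp (l' * t))\<^sup>2 * B) \<longlongrightarrow> (exp (l * t))\<^sup>2 * B) (at_right l)"
    by (intro tendsto_intros)
  moreover have "\<forall>\<^sub>F l' in at_right l. A \<le> (exp (l' * t))\<^sup>2 * B"
    unfolding eventually_at_right_field by (intro exI[of _ "l + 1"]) (auto intro: ineq)
  ultimately have "A \<le> (exp (l * t))\<^sup>2 * B"
    by (intro tendsto_lowerbound) auto
  from mult_left_mono[OF this, of "(exp (- (l * t)))\<^sup>2"]
  have "(exp (- (l * t)))\<^sup>2 * A \<le> (exp (- (l * t)) * exp (l * t))\<^sup>2 * B"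
    by (simp add: power_mult_distrib mult.assoc)
  also have "\<dots> = B" by (simp add: exp_add[symmetric])
  finally show ?thesis
    unfolding A_def B_def by (simp add: power_mult_distrib)
qed

text \<open>A convolution of the integrable functions f and green l, by Tonelli and translation
  invariance.\<close>

lemma integrable_resolvent:
  assumes l: "l > 0" and f: "bounded_borel f" "integrable lborel f"
  shows "integrable lborel (resolvent l f)"
proof (rule integrableI_bounded)
  have [measurable]: "f \<in> borel_measurable borel" using f by auto
  have [measurable]: "green l \<in> borel_measurable borel" using l by simp
  show "resolvent l f \<in> borel_measurable lborel" by measurable
  have "(\<integral>\<^sup>+x. norm (resolvent l f x) \<partial>lborel) \<le> (\<integral>\<^sup>+x. \<integral>\<^sup>+y. ennreal \<bar>f (x - y)\<bar> * ennreal (green l y) \<partial>lborel \<partial>lborel)"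
  proof (rule nn_integral_mono)
    fix x
    have "ennreal (norm (resolvent l f x)) \<le> (\<integral>\<^sup>+y. norm (f (x - y) * green l y) \<partial>lborel)"
      unfolding resolvent_eq_green[OF l f(1)] by (rule integral_norm_bound_ennreal)
        (use integrable_bounded_borel_mult(2)[OF integrable_green[OF l], of "\<lambda>y. f (x - y)"] f(1) in \<open>auto simp: bounded_borel_def\<close>)
    also have "\<dots> = (\<integral>\<^sup>+y. ennreal \<bar>f (x - y)\<bar> * ennreal (green l y) \<partial>lborel)"
      using green_nonneg[OF l] by (intro nn_integral_cong) (auto simp: abs_mult ennreal_mult)
    finally show "ennreal (norm (resolvent l f x)) \<le> (\<integral>\<^sup>+y. ennreal \<bar>f (x - y)\<bar> * ennreal (green l y) \<partial>lborel)" .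
  qed
  also have "\<dots> = (\<integral>\<^sup>+y. \<integral>\<^sup>+x. ennreal \<bar>f (x - y)\<bar> * ennreal (green l y) \<partial>lborel \<partial>lborel)"
    by (rule lborel_pair.Fubini'[symmetric]) measurable
  also have "\<dots> = (\<integral>\<^sup>+y. (\<integral>\<^sup>+x. ennreal \<bar>f x\<bar> \<partial>lborel) * ennreal (green l y) \<partial>lborel)"
  proof (rule nn_integral_cong)
    fix y
    show "(\<integral>\<^sup>+x. ennreal \<bar>f (x - y)\<bar> * ennreal (green l y) \<partial>lborel) = (\<integral>\<^sup>+x. ennreal \<bar>f x\<bar> \<partial>lborel) * ennreal (green l y)"
      by (subst nn_integral_multc) (auto simp: nn_integral_lborel_shift[of "\<lambda>x. ennreal \<bar>f x\<bar>"])
  qed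
  also have "\<dots> = (\<integral>\<^sup>+x. ennreal \<bar>f x\<bar> \<partial>lborel) * (\<integral>\<^sup>+y. ennreal (green l y) \<partial>lborel)"
    by (rule nn_integral_cmult) simp
  also have "\<dots> < \<infinity>"
    using f(2) integrable_green[OF l] green_nonneg[OF l] by (auto simp: integrable_iff_bounded ennreal_mult_less_top)
  finally show "(\<integral>\<^sup>+x. norm (resolvent l f x) \<partial>lborel) < \<infinity>" .
qed

text \<open>Reflecting the convolution puts the argument into \<open>green\<close>, so continuity is
  inherited from \<open>green\<close> whatever the regularity of f. A resolvent that vanishes at a
  is therefore small on a narrow bump.\<close>

lemma isCont_resolvent:
  assumes l: "l > 0" and f: "bounded_borel f" "integrable lborel f"
  shows "isCont (resolvent l f) x"
proof -
  have [measurable]: "f \<in> borel_measurable borel" using f by auto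
  have [measurable]: "green l \<in> borel_measurable borel" using l by simp
  have eq: "resolvent l f x = (LBINT y. f y * green l (x - y))" for x
    using lborel_integral_real_affine[of "-1" "\<lambda>y. f (x - y) * green l y" x]
    unfolding resolvent_eq_green[OF l f(1)] by simp
  show ?thesis
    unfolding continuous_at_sequentially o_def eq
  proof (intro allI impI)
    fix u :: "nat \<Rightarrow> real" assume u: "u \<longlonglongrightarrow> x"
    show "(\<lambda>n. \<integral>y. f y * green l (u n - y) \<partial>lborel) \<longlonglongrightarrow> (LBINT y. f y * green l (x - y))"
    proof (rule integral_dominated_convergence[where w = "\<lambda>y. \<bar>f y\<bar> * green l 0"])
      show "AE y in lborel. (\<lambda>n. f y * green l (u n - y)) \<longlonglongrightarrow> f y * green l (x - y)"
        using u by (intro AE_I2 tendsto_mult tendsto_const isCont_tendsto_compose[OF isCont_green[OF l]] tendsto_diff)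
      show "AE y in lborel. norm (f y * green l (u n - y)) \<le> \<bar>f y\<bar> * green l 0" for n
        using green_nonneg[OF l] green_le[OF l] by (intro AE_I2) (auto simp: abs_mult intro!: mult_left_mono)
    qed (use f in auto)
  qed
qed

text \<open>Since \<open>green\<close> is even, the value of the resolvent at a is the inner product
  of f with the ground state: orthogonality becomes vanishing at the site of the potential.\<close>

lemma resolvent_at:
  assumes l: "l > 0" and f: "bounded_borel f"
  shows "resolvent l f a = (LBINT y. f y * green l (y - a))"
proof -
  have "resolvent l f a = (LBINT y. f (a - y) * green l y)"
    by (rule resolvent_eq_green[OF l f])
  also have "\<dots> = (LBINT y. f y * green l (a - y))"
    using lborel_integral_real_affine[of "-1" "\<lambda>y. f (a - y) * green l y" a] by simp
  also have "\<dots> = (LBINT y. f y * green l (y - a))"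
    using green_minus[of l "_ - a"] by simp
  finally show ?thesis .
qed

end

section \<open>Energy decay\<close>

context symmetric_levy_path
begin

lemma clock_cmult: "clock (\<lambda>x. q * V x) x t \<omega> = q * clock V x t \<omega>"
  unfolding clock_def by (rule set_integral_mult_right)

lemma FK_cross_energy:
  assumes V: "bounded_continuous V" and f: "bounded_borel f" "integrable lborel f" and t: "t \<ge> 0"
  shows "(LBINT x. f x * FK V t f x) = (LBINT x. (FK V (t / 2) f x)\<^sup>2)"
proof -
  have Vb: "bounded_borel V" using V by simp
  have "(LBINT x. f x * FK V t f x) = (LBINT x. f x * FK V (t / 2) (FK V (t / 2) f) x)"
    using FK_semigroup[OF V f(1), of "t / 2" "t / 2"] t by simp
  also have "\<dots> = (LBINT x. FK V (t / 2) f x * FK V (t / 2) f x)"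
    using f t Vb by (intro FK_symmetric V integrable_FK) auto
  finally show ?thesis by (simp add: power2_eq_square)
qed

end

context symmetric_levy_exponent
begin

lemma FK_bump_energy_antimono:
  fixes n :: nat and a :: real
  assumes q: "q > 0" and l: "l > 0" and crit: "q * green l 0 = 1"
    and f: "bounded_borel f" "integrable lborel f" and st: "0 \<le> s" "s \<le> t"
  defines "V \<equiv> \<lambda>x. q * bump n (x - a)"
  shows "(LBINT x. (exp (- (l * t)) * FK V t f x)\<^sup>2) \<le> (LBINT x. (exp (- (l * s)) * FK V s f x)\<^sup>2)"
proof -
  have V: "bounded_continuous V" unfolding V_def by (rule bounded_continuous_bump)
  then have Vb: "bounded_borel V" by simp
  have g: "bounded_borel (FK V s f)" "integrable lborel (FK V s f)"
    using Vb f st by (auto intro: integrable_FK)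
  have "exp (- (l * t)) * FK V t f x = exp (- (l * s)) * (exp (- (l * (t - s))) * FK V (t - s) (FK V s f) x)" for x
    using FK_semigroup[OF V f(1), of "t - s" s x] st by (simp add: mult.assoc[symmetric] exp_add[symmetric] right_diff_distrib)
  then have "(LBINT x. (exp (- (l * t)) * FK V t f x)\<^sup>2)
      = (exp (- (l * s)))\<^sup>2 * (LBINT x. (exp (- (l * (t - s))) * FK V (t - s) (FK V s f) x)\<^sup>2)"
    by (simp add: power_mult_distrib)
  also have "\<dots> \<le> (exp (- (l * s)))\<^sup>2 * (LBINT x. (FK V s f x)\<^sup>2)"
    unfolding V_def
    by (intro mult_left_mono FK_bump_contraction[OF q l crit]) (use g st in \<open>auto simp: V_def\<close>)
  also have "\<dots> = (LBINT x. (exp (- (l * s)) * FK V s f x)\<^sup>2)"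
    by (simp add: power_mult_distrib)
  finally show ?thesis .
qed

text \<open>The function \<open>s \<mapsto> \<parallel>T\<^sub>s\<^sub>/\<^sub>2 f\<parallel>\<^sup>2 = (T\<^sub>s f, f)\<close> is nonincreasing, and Duhamel's formula bounds its integral over \<open>(0, t]\<close>.\<close>

lemma FK_bump_energy_decay:
  fixes n :: nat and a :: real
  assumes q: "q > 0" and l: "l > 0" and crit: "q * green l 0 = 1"
    and f: "bounded_borel f" "integrable lborel f" and t: "t \<ge> 0"
  defines "V \<equiv> \<lambda>x. q * bump n (x - a)"
  assumes \<eta>: "\<eta> \<ge> 0" "\<And>x. \<bar>x - a\<bar> \<le> 1 / real (Suc n) \<Longrightarrow> \<bar>resolvent l f x\<bar> \<le> \<eta>"
    and C: "\<And>x. FK V t (\<lambda>_. 1) x \<le> C"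
  shows "t * (LBINT x. (exp (- (l * (t / 2))) * FK V (t / 2) f x)\<^sup>2) \<le>
     (LBINT x. (f x)\<^sup>2) + (LBINT x. (resolvent l f x)\<^sup>2) + \<eta> * C * (LBINT x. \<bar>f x\<bar>)"
proof -
  have V: "bounded_continuous V" unfolding V_def by (rule bounded_continuous_bump)
  then have Vb: "bounded_borel V" by simp
  have V0: "0 \<le> V x" for x unfolding V_def using q bump_nonneg by simp
  define \<phi> where "\<phi> = resolvent l f"
  have \<phi>: "bounded_borel \<phi>" "integrable lborel \<phi>"
    unfolding \<phi>_def using l f by (auto intro: integrable_resolvent)
  note [measurable] = bounded_borel_measurable[OF Vb] bounded_borel_measurable[OF f(1)] bounded_borel_measurable[OF \<phi>(1)]
  define T where "T s h x = exp (- (l * s)) * FK V s h x" for s h x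
  have T_bb: "bounded_borel (T s h)" if "s \<ge> 0" "bounded_borel h" for s h
    unfolding T_def using that Vb by simp
  have T_int: "integrable lborel (T s h)" if "s \<ge> 0" "bounded_borel h" "integrable lborel h" for s h
    unfolding T_def using that Vb by (intro integrable_mult_right integrable_FK)
  define E where "E s = (LBINT x. f x * T s f x)" for s
  have E_eq: "E s = (LBINT x. (T (s / 2) f x)\<^sup>2)" if "s \<ge> 0" for s
  proof -
    have "E s = exp (- (l * s)) * (LBINT x. f x * FK V s f x)"
      unfolding E_def T_def by (simp add: mult.left_commute[of _ "exp (- (l * s))"])
    also have "\<dots> = (exp (- (l * (s / 2))))\<^sup>2 * (LBINT x. (FK V (s / 2) f x)\<^sup>2)"
      using FK_cross_energy[OF V f that] by (simp add: power2_eq_square exp_add[symmetric])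
    finally show ?thesis by (simp add: T_def power_mult_distrib)
  qed
  have E_mono: "E t \<le> E s" if "0 \<le> s" "s \<le> t" for s
    using FK_bump_energy_antimono[OF q l crit f, of "s / 2" "t / 2" n a] that
    by (simp add: E_eq T_def V_def)
  obtain B where B: "B \<ge> 0" "\<And>x. \<bar>V x\<bar> \<le> B" using Vb by (metis bounded_borelE)
  obtain Cf where Cf: "Cf \<ge> 0" "\<And>x. \<bar>f x\<bar> \<le> Cf" using f by (metis bounded_borelE)
  define G where "G x s = (if 0 < s \<and> s \<le> t then T s f x else 0)" for x s
  have G_bd: "\<bar>G x s\<bar> \<le> exp (B * t) * Cf" for x s
  proof (cases "0 < s \<and> s \<le> t")
    case True
    have "\<bar>T s f x\<bar> \<le> 1 * (exp (B * s) * Cf)"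
      unfolding T_def abs_mult using True l B Cf FK_abs_le[of V B f Cf s x] by (intro mult_mono) auto
    also have "\<dots> \<le> exp (B * t) * Cf" using True B Cf by (auto intro!: mult_right_mono mult_left_mono)
    finally show ?thesis using True by (simp add: G_def)
  qed (use Cf in \<open>auto simp: G_def\<close>)
  have G_meas: "case_prod G \<in> borel_measurable (lborel \<Otimes>\<^sub>M lborel)"
    unfolding G_def T_def by measurable
  have fub: "(LBINT x. f x * (LBINT s. indicator {0<..t} s * G x s)) = (LBINT s. indicator {0<..t} s * (LBINT x. f x * G x s))"
    by (rule lborel_pair.fubini_bounded[OF f(2) _ G_meas G_bd]) simp
  \<comment> \<open>The energy E does not increase, so its integral over (0, t] is at least t times
    its final value.\<close>
  have lower: "t * E t \<le> (LBINT s. indicator {0<..t} s * (LBINT x. f x * G x s))"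
  proof -
    have "t * E t = (LBINT s. E t * indicator {0<..t} s)"
      using t by simp
    also have "\<dots> \<le> (LBINT s. indicator {0<..t} s * (LBINT x. f x * G x s))"
    proof (rule integral_mono)
      show "integrable lborel (\<lambda>s. E t * indicator {0<..t} s)" by simp
      have [measurable]: "(\<lambda>s. \<integral>x. f x * G x s \<partial>lborel) \<in> borel_measurable borel"
        unfolding G_def T_def by measurable
      have "\<bar>\<integral>x. f x * G x s \<partial>lborel\<bar> \<le> (LBINT x. (exp (B * t) * Cf) * \<bar>f x\<bar>)" for s
      proof (rule integral_abs_le)
        show bd: "\<bar>f x * G x s\<bar> \<le> exp (B * t) * Cf * \<bar>f x\<bar>" for x
          using mult_left_mono[OF G_bd[of x s], of "\<bar>f x\<bar>"] by (simp add: abs_mult ac_simps)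
        show int: "integrable lborel (\<lambda>x. exp (B * t) * Cf * \<bar>f x\<bar>)" using f by simp
        show "integrable lborel (\<lambda>x. f x * G x s)"
          by (rule integrable_dominated[OF int _ bd]) (unfold G_def T_def, measurable)
      qed
      then have "set_integrable lborel {0<..t} (\<lambda>s. \<integral>x. f x * G x s \<partial>lborel)"
        by (intro set_integrable_bounded_Ioc[where C = "\<integral>x. (exp (B * t) * Cf) * \<bar>f x\<bar> \<partial>lborel"]) auto
      then show "integrable lborel (\<lambda>s. indicator {0<..t} s * (LBINT x. f x * G x s))"
        by (simp add: set_integrable_def)
      show "E t * indicator {0<..t} s \<le> indicator {0<..t} s * (LBINT x. f x * G x s)" for s
        using E_mono[of s] by (auto simp: indicator_def G_def E_def)
    qed
    finally show ?thesis .
  qed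
  \<comment> \<open>The part of Duhamel's source that a point potential would not see: the bump
    lives where \<phi> is at most \<eta> in absolute value.\<close>
  define err where "err x = (LBINT s:{0<..t}. exp (- (l * s)) * FK V s (\<lambda>y. V y * \<phi> y) x)" for x
  have err_bd: "\<bar>err x\<bar> \<le> \<eta> * C" for x
  proof -
    have "\<bar>err x\<bar> \<le> \<eta> * FK V t (\<lambda>_. 1) x"
      unfolding err_def
    proof (rule FK_small_source[OF V V0 t])
      fix y
      show "\<bar>V y * \<phi> y\<bar> \<le> \<eta> * V y"
      proof (cases "\<bar>y - a\<bar> \<le> 1 / real (Suc n)")
        case True
        then have "V y * \<bar>\<phi> y\<bar> \<le> V y * \<eta>"
          unfolding \<phi>_def by (intro mult_left_mono \<eta>(2) V0)
        then show ?thesis using V0[of y] by (simp add: abs_mult mult.commute)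
      next
        case False
        then have "V y = 0" unfolding V_def using bump_outside[of n "y - a"] by simp
        then show ?thesis by simp
      qed
    qed (use l \<eta> in auto)
    also have "\<dots> \<le> \<eta> * C" using C \<eta> by (intro mult_left_mono) auto
    finally show ?thesis .
  qed
  have duhamel: "(LBINT s. indicator {0<..t} s * G x s) = \<phi> x - T t \<phi> x + err x" for x
  proof -
    have "T t \<phi> x + (LBINT s:{0<..t}. exp (- (l * s)) * FK V s (\<lambda>y. f y - V y * \<phi> y) x) = \<phi> x"
      unfolding T_def \<phi>_def by (rule FK_duhamel[OF V f(1) t l])
    moreover have "(LBINT s:{0<..t}. exp (- (l * s)) * FK V s (\<lambda>y. f y - V y * \<phi> y) x) = (LBINT s. indicator {0<..t} s * G x s) - err x"
    proof -
      have V\<phi>: "bounded_borel (\<lambda>y. V y * \<phi> y)" using Vb \<phi> by simp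
      have si: "set_integrable lborel {0<..t} (\<lambda>s. exp (- (l * s)) * FK V s h x)" if h: "bounded_borel h" for h
      proof -
        obtain D where D: "D \<ge> 0" "\<And>x. \<bar>h x\<bar> \<le> D" using h by (metis bounded_borelE)
        note [measurable] = bounded_borel_measurable[OF h]
        show ?thesis
        proof (rule set_integrable_bounded_Ioc[where C = "exp (B * t) * D"])
          fix s assume s: "0 < s" "s \<le> t"
          have "\<bar>exp (- (l * s)) * FK V s h x\<bar> \<le> 1 * (exp (B * s) * D)"
            unfolding abs_mult using s l B D FK_abs_le[of V B h D s x] by (intro mult_mono) auto
          also have "\<dots> \<le> exp (B * t) * D" using s B D by (auto intro!: mult_right_mono mult_left_mono)
          finally show "\<bar>exp (- (l * s)) * FK V s h x\<bar> \<le> exp (B * t) * D" .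
        qed measurable
      qed
      have "(LBINT s:{0<..t}. exp (- (l * s)) * FK V s (\<lambda>y. f y - V y * \<phi> y) x)
          = (LBINT s:{0<..t}. exp (- (l * s)) * FK V s f x - exp (- (l * s)) * FK V s (\<lambda>y. V y * \<phi> y) x)"
        using FK_diff[OF Vb f(1) V\<phi>] by (intro set_lebesgue_integral_cong) (auto simp: right_diff_distrib)
      also have "\<dots> = (LBINT s:{0<..t}. exp (- (l * s)) * FK V s f x) - err x"
        unfolding err_def using si[OF f(1)] si[OF V\<phi>] by (rule set_integral_diff)
      also have "(LBINT s:{0<..t}. exp (- (l * s)) * FK V s f x) = (LBINT s. indicator {0<..t} s * G x s)"
        unfolding set_lebesgue_integral_def by (intro Bochner_Integration.integral_cong) (auto simp: G_def T_def indicator_def)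
      finally show ?thesis .
    qed
    ultimately show ?thesis by simp
  qed
  have T\<phi>: "(LBINT x. (T t \<phi> x)\<^sup>2) \<le> (LBINT x. (\<phi> x)\<^sup>2)"
    using FK_bump_contraction[OF q l crit \<phi> t, of n a] by (simp add: T_def V_def)
  have sq: "integrable lborel (\<lambda>x. (f x)\<^sup>2)" "integrable lborel (\<lambda>x. (\<phi> x)\<^sup>2)" "integrable lborel (\<lambda>x. (T t \<phi> x)\<^sup>2)"
    using f \<phi> T_bb[OF t \<phi>(1)] T_int[OF t \<phi>] by (auto intro: bounded_borel_integrable_power2)
  \<comment> \<open>The pairings with \<phi> and with T t \<phi> are split by |u v| \<le> (u^2 +
    v^2) / 2. By contraction T t \<phi> is no larger than \<phi>, so apart from the error term the
    bound does not grow with t.\<close>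
  have "(LBINT x. f x * (\<phi> x - T t \<phi> x + err x)) \<le>
      (LBINT x. ((f x)\<^sup>2 + (\<phi> x)\<^sup>2) / 2 + ((f x)\<^sup>2 + (T t \<phi> x)\<^sup>2) / 2 + \<bar>f x\<bar> * (\<eta> * C))"
  proof (rule order_trans[OF abs_ge_self integral_abs_le])
    show i: "integrable lborel (\<lambda>x. ((f x)\<^sup>2 + (\<phi> x)\<^sup>2) / 2 + ((f x)\<^sup>2 + (T t \<phi> x)\<^sup>2) / 2 + \<bar>f x\<bar> * (\<eta> * C))"
      using sq f by (intro Bochner_Integration.integrable_add integrable_divide integrable_mult_left) auto
    show bd: "\<bar>f x * (\<phi> x - T t \<phi> x + err x)\<bar> \<le> ((f x)\<^sup>2 + (\<phi> x)\<^sup>2) / 2 + ((f x)\<^sup>2 + (T t \<phi> x)\<^sup>2) / 2 + \<bar>f x\<bar> * (\<eta> * C)" for x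
    proof -
      have ab: "\<bar>u * v\<bar> \<le> (u\<^sup>2 + v\<^sup>2) / 2" for u v :: real
        using zero_le_power2[of "\<bar>u\<bar> - \<bar>v\<bar>"] unfolding power2_diff by (simp add: abs_mult)
      have "\<bar>f x * (\<phi> x - T t \<phi> x + err x)\<bar> = \<bar>f x * \<phi> x - f x * T t \<phi> x + f x * err x\<bar>"
        by (simp add: algebra_simps)
      also have "\<dots> \<le> \<bar>f x * \<phi> x\<bar> + \<bar>f x * T t \<phi> x\<bar> + \<bar>f x * err x\<bar>"
        by linarith
      also have "\<bar>f x * err x\<bar> \<le> \<bar>f x\<bar> * (\<eta> * C)"
        unfolding abs_mult by (intro mult_left_mono err_bd) auto
      finally show ?thesis using ab[of "f x" "\<phi> x"] ab[of "f x" "T t \<phi> x"] by linarith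
    qed
    have [measurable]: "err \<in> borel_measurable borel"
      unfolding err_def set_lebesgue_integral_def by measurable
    have [measurable]: "T t \<phi> \<in> borel_measurable borel" using T_bb[OF t \<phi>(1)] by (rule bounded_borel_measurable)
    show "integrable lborel (\<lambda>x. f x * (\<phi> x - T t \<phi> x + err x))"
      by (rule integrable_dominated[OF i _ bd]) measurable
  qed
  also have "\<dots> = (LBINT x. (f x)\<^sup>2) + ((LBINT x. (\<phi> x)\<^sup>2) + (LBINT x. (T t \<phi> x)\<^sup>2)) / 2 + \<eta> * C * (LBINT x. \<bar>f x\<bar>)"
    using sq f by (simp add: field_simps)
  also have "\<dots> \<le> (LBINT x. (f x)\<^sup>2) + (LBINT x. (\<phi> x)\<^sup>2) + \<eta> * C * (LBINT x. \<bar>f x\<bar>)"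
    using T\<phi> by simp
  finally have upper: "(LBINT x. f x * (\<phi> x - T t \<phi> x + err x)) \<le> \<dots>" .
  have "t * E t \<le> (LBINT x. f x * (\<phi> x - T t \<phi> x + err x))"
    using lower unfolding fub[symmetric] duhamel .
  with upper show ?thesis
    using t by (simp add: E_eq T_def \<phi>_def)
qed

text \<open>Criticality rewrites the bump as V * green l 0, so Duhamel's source is V (green l 0 -
  \<phi>). On the support of the bump \<phi> is within \<eta> of green l 0, hence the source is
  small relative to V.\<close>

lemma FK_bump_ground_state:
  fixes n :: nat and a :: real
  assumes q: "q > 0" and l: "l > 0" and crit: "q * green l 0 = 1" and t: "t \<ge> 0"
  defines "V \<equiv> \<lambda>x. q * bump n (x - a)" and "\<phi> \<equiv> resolvent l (\<lambda>y. bump n (y - a))"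
  assumes \<eta>: "\<eta> \<ge> 0" "\<And>x. \<bar>x - a\<bar> \<le> 1 / real (Suc n) \<Longrightarrow> \<bar>\<phi> x - green l 0\<bar> \<le> \<eta>"
    and C: "\<And>x. FK V t (\<lambda>_. 1) x \<le> C"
  shows "\<bar>exp (- (l * t)) * FK V t \<phi> x - \<phi> x\<bar> \<le> \<eta> * C"
proof -
  have V: "bounded_continuous V" unfolding V_def by (rule bounded_continuous_bump)
  then have Vb: "bounded_borel V" by simp
  have V0: "0 \<le> V x" for x unfolding V_def using q bump_nonneg by simp
  have kb: "bounded_borel (\<lambda>y. bump n (y - a))"
    using bounded_continuous_borel[OF bounded_continuous_bump[of 1]] by simp
  have \<phi>b: "bounded_borel \<phi>" unfolding \<phi>_def using kb l by simp
  note [measurable] = bounded_borel_measurable[OF Vb] bounded_borel_measurable[OF kb] bounded_borel_measurable[OF \<phi>b]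
  have "exp (- (l * t)) * FK V t \<phi> x + (LBINT s:{0<..t}. exp (- (l * s)) * FK V s (\<lambda>y. bump n (y - a) - V y * \<phi> y) x) = \<phi> x"
    unfolding \<phi>_def by (rule FK_duhamel[OF V kb t l])
  moreover have "\<bar>LBINT s:{0<..t}. exp (- (l * s)) * FK V s (\<lambda>y. bump n (y - a) - V y * \<phi> y) x\<bar> \<le> \<eta> * FK V t (\<lambda>_. 1) x"
  proof (rule FK_small_source[OF V V0 t])
    fix y
    have eq: "bump n (y - a) - V y * \<phi> y = V y * (green l 0 - \<phi> y)"
      using crit unfolding V_def by (simp add: right_diff_distrib mult.commute mult.left_commute)
    show "\<bar>bump n (y - a) - V y * \<phi> y\<bar> \<le> \<eta> * V y"
    proof (cases "\<bar>y - a\<bar> \<le> 1 / real (Suc n)")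
      case True
      then have "V y * \<bar>green l 0 - \<phi> y\<bar> \<le> V y * \<eta>"
        using \<eta>(2)[of y] by (intro mult_left_mono V0) (simp add: abs_minus_commute)
      then show ?thesis using V0[of y] unfolding eq by (simp add: abs_mult mult.commute)
    next
      case False
      then have "V y = 0" unfolding V_def using bump_outside[of n "y - a"] by simp
      then show ?thesis unfolding eq by simp
    qed
  qed (use l \<eta> in auto)
  moreover have "\<eta> * FK V t (\<lambda>_. 1) x \<le> \<eta> * C" using C \<eta> by (intro mult_left_mono) auto
  ultimately show ?thesis by linarith
qed

end

section \<open>The point potential limit\<close>

text \<open>Real counterpart of \<open>square_integrable\<close>: the limit theorem is proved for
  real functions and transferred through real and imaginary parts.\<close>

definition square_summable :: "(real \<Rightarrow> real) \<Rightarrow> bool" where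
  "square_summable f \<longleftrightarrow> f \<in> borel_measurable borel \<and> integrable lborel (\<lambda>x. (f x)\<^sup>2)"

lemma square_summable_mult:
  assumes "square_summable f" "square_summable g"
  shows "integrable lborel (\<lambda>x. f x * g x)"
proof (rule integrable_dominated)
  show "integrable lborel (\<lambda>x. ((f x)\<^sup>2 + (g x)\<^sup>2) / 2)"
    using assms by (simp add: square_summable_def)
  show "\<bar>f x * g x\<bar> \<le> ((f x)\<^sup>2 + (g x)\<^sup>2) / 2" for x
    using zero_le_power2[of "\<bar>f x\<bar> - \<bar>g x\<bar>"] unfolding power2_diff by (simp add: abs_mult)
qed (use assms in \<open>auto simp: square_summable_def\<close>)

lemma square_summable_cmult: "square_summable f \<Longrightarrow> square_summable (\<lambda>x. c * f x)"
  by (auto simp: square_summable_def power_mult_distrib)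

lemma square_summable_add:
  assumes "square_summable f" "square_summable g"
  shows "square_summable (\<lambda>x. f x + g x)"
  using assms square_summable_mult[OF assms] unfolding square_summable_def power2_sum
  by (auto intro!: Bochner_Integration.integrable_add integrable_mult_right simp: mult.assoc)

lemma square_summable_diff:
  assumes "square_summable f" "square_summable g"
  shows "square_summable (\<lambda>x. f x - g x)"
  using square_summable_add[OF assms(1) square_summable_cmult[OF assms(2), of "-1"]] by simp

lemma square_summable_bounded:
  "bounded_borel f \<Longrightarrow> integrable lborel f \<Longrightarrow> square_summable f"
  by (simp add: square_summable_def bounded_borel_integrable_power2 bounded_borel_measurable)

text \<open>Lower semicontinuity of the norm under almost everywhere convergence. It transfers the
  estimates from bumps to the point potential although norm convergence of the approximations is not
  established.\<close>

lemma fatou_square: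
  fixes u :: "nat \<Rightarrow> real \<Rightarrow> real"
  assumes u: "\<And>n. square_summable (u n)" and v: "v \<in> borel_measurable borel"
    and lim: "AE x in lborel. (\<lambda>n. u n x) \<longlonglongrightarrow> v x"
    and b: "\<And>n. (LBINT x. (u n x)\<^sup>2) \<le> b n" "b \<longlonglongrightarrow> B"
  shows "square_summable v" "(LBINT x. (v x)\<^sup>2) \<le> B"
proof -
  note [measurable] = v
  have [measurable]: "u n \<in> borel_measurable borel" for n using u by (simp add: square_summable_def)
  have b0: "0 \<le> b n" for n
    using b(1)[of n] by (rule order_trans[rotated]) simp
  have B0: "0 \<le> B" using b(2) b0 by (intro LIMSEQ_le_const) auto
  have "(\<integral>\<^sup>+x. ennreal ((v x)\<^sup>2) \<partial>lborel) = (\<integral>\<^sup>+x. liminf (\<lambda>n. ennreal ((u n x)\<^sup>2)) \<partial>lborel)"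
  proof (rule nn_integral_cong_AE, use lim in eventually_elim)
    fix x assume "(\<lambda>n. u n x) \<longlonglongrightarrow> v x"
    then have "(\<lambda>n. ennreal ((u n x)\<^sup>2)) \<longlonglongrightarrow> ennreal ((v x)\<^sup>2)"
      by (intro tendsto_ennrealI tendsto_power)
    from lim_imp_Liminf[OF trivial_limit_sequentially this]
    show "ennreal ((v x)\<^sup>2) = liminf (\<lambda>n. ennreal ((u n x)\<^sup>2))" by (rule sym)
  qed
  also have "\<dots> \<le> liminf (\<lambda>n. \<integral>\<^sup>+x. ennreal ((u n x)\<^sup>2) \<partial>lborel)"
    by (rule nn_integral_liminf) simp
  also have "\<dots> \<le> liminf (\<lambda>n. ennreal (b n))"
    using u b(1) by (intro Liminf_mono always_eventually allI)
      (simp add: square_summable_def nn_integral_eq_integral ennreal_leI)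
  also have "\<dots> = ennreal B"
    using b(2) by (intro lim_imp_Liminf tendsto_ennrealI) auto
  finally have nn: "(\<integral>\<^sup>+x. ennreal ((v x)\<^sup>2) \<partial>lborel) \<le> ennreal B" .
  then have int: "integrable lborel (\<lambda>x. (v x)\<^sup>2)"
    by (intro integrableI_bounded) (auto intro: le_less_trans)
  then show "square_summable v" by (simp add: square_summable_def v)
  show "(LBINT x. (v x)\<^sup>2) \<le> B"
    using nn int B0 by (simp add: nn_integral_eq_integral)
qed

text \<open>Cuts both the argument and the value, so that the result is bounded and integrable, the
  class for which the bump operators are estimated.\<close>

definition truncate :: "nat \<Rightarrow> (real \<Rightarrow> real) \<Rightarrow> real \<Rightarrow> real" where
  "truncate n f x = (if \<bar>x\<bar> \<le> real n \<and> \<bar>f x\<bar> \<le> real n then f x else 0)"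

lemma truncate:
  assumes [measurable]: "f \<in> borel_measurable borel"
  shows "bounded_borel (truncate n f)" "integrable lborel (truncate n f)"
    "\<bar>truncate n f x\<bar> \<le> \<bar>f x\<bar>" "(\<lambda>n. truncate n f x) \<longlonglongrightarrow> f x"
proof -
  have [measurable]: "truncate n f \<in> borel_measurable borel" unfolding truncate_def by measurable
  show bb: "bounded_borel (truncate n f)"
    by (rule bounded_borelI[where C = "real n"]) (simp_all add: truncate_def)
  show "integrable lborel (truncate n f)"
    by (rule integrableI_bounded_set[where A = "{- real n..real n}" and B = "real n"])
      (auto simp: truncate_def emeasure_lborel_Icc_eq)
  show "\<bar>truncate n f x\<bar> \<le> \<bar>f x\<bar>" by (simp add: truncate_def)
  obtain N :: nat where N: "max \<bar>x\<bar> \<bar>f x\<bar> < real N" using reals_Archimedean2 by blast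
  show "(\<lambda>n. truncate n f x) \<longlonglongrightarrow> f x"
    by (rule tendsto_eventually, unfold eventually_sequentially, rule exI[of _ N]) (use N in \<open>auto simp: truncate_def\<close>)
qed

lemma truncate_L2:
  assumes f: "square_summable f"
  shows "(\<lambda>n. \<integral>x. (f x - truncate n f x)\<^sup>2 \<partial>lborel) \<longlonglongrightarrow> 0"
proof -
  have m [measurable]: "f \<in> borel_measurable borel" using f by (simp add: square_summable_def)
  have [measurable]: "truncate n f \<in> borel_measurable borel" for n
    using truncate(1)[OF m] by (rule bounded_borel_measurable)
  have "(\<lambda>n. \<integral>x. (f x - truncate n f x)\<^sup>2 \<partial>lborel) \<longlonglongrightarrow> (LBINT x. (f x - f x)\<^sup>2)"
  proof (rule integral_dominated_convergence[where w = "\<lambda>x. (f x)\<^sup>2"])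
    show "AE x in lborel. (\<lambda>n. (f x - truncate n f x)\<^sup>2) \<longlonglongrightarrow> (f x - f x)\<^sup>2"
      by (intro AE_I2 tendsto_power tendsto_diff tendsto_const truncate(4) m)
    show "AE x in lborel. norm ((f x - truncate n f x)\<^sup>2) \<le> (f x)\<^sup>2" for n
      by (auto simp: truncate_def)
  qed (use f in \<open>auto simp: square_summable_def\<close>)
  then show ?thesis by simp
qed

text \<open>The local time enters only through the almost sure convergence of the bump clocks, for
  each fixed t and x, so the exceptional set may depend on both.\<close>

locale levy_local_time = symmetric_levy_exponent M X \<Psi>
  for M :: "'a measure" and X :: "real \<Rightarrow> 'a \<Rightarrow> real" and \<Psi> :: "real \<Rightarrow> real" +
  fixes a \<mu> \<nu> :: real
  assumes local_time_exists: "t \<ge> 0 \<Longrightarrow> AE \<omega> in M. convergent (\<lambda>n. clock (\<lambda>y. bump n (y - a)) x t \<omega>)"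
    and mu_pos: "\<mu> > 0" and nu_pos: "\<nu> > 0" and critical: "\<mu> * green \<nu> 0 = 1"
begin

text \<open>A version of the local time at \<open>x - a\<close> that is jointly measurable in all arguments, which is not assumed of \<open>L\<close>.\<close>

definition loc :: "real \<Rightarrow> real \<Rightarrow> 'a \<Rightarrow> real" where
  "loc t x \<omega> = lim (\<lambda>n. clock (\<lambda>y. bump n (y - a)) x t \<omega>)"

lemma measurable_loc [measurable (raw)]:
  assumes [measurable]: "f \<in> borel_measurable N" "g \<in> borel_measurable N" "h \<in> measurable N M"
  shows "(\<lambda>z. loc (f z) (g z) (h z)) \<in> borel_measurable N"
  unfolding loc_def by (intro borel_measurable_lim_metric) measurable

lemma clock_tendsto_loc:
  assumes t: "t \<ge> 0"
  shows "AE \<omega> in M. (\<lambda>n. clock (\<lambda>y. bump n (y - a)) x t \<omega>) \<longlonglongrightarrow> loc t x \<omega>"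
  unfolding loc_def using local_time_exists[OF t, of x] by eventually_elim (simp add: convergent_LIMSEQ_iff)

definition LT :: "real \<Rightarrow> (real \<Rightarrow> real) \<Rightarrow> real \<Rightarrow> real" where
  "LT t f x = (\<integral>\<omega>. f (x - X t \<omega>) * exp (\<mu> * loc t x \<omega>) \<partial>M)"

lemma measurable_LT [measurable]:
  assumes [measurable]: "f \<in> borel_measurable borel"
  shows "LT t f \<in> borel_measurable borel"
  unfolding LT_def by measurable

abbreviation W :: "nat \<Rightarrow> real \<Rightarrow> real" where
  "W n \<equiv> (\<lambda>x. \<mu> * bump n (x - a))"

text \<open>Squaring the integrand doubles the coupling, and exponential moments for 2 \<mu> are
  bounded uniformly in n. Second moments are thus bounded, and almost sure convergence of the clocks
  gives convergence of the means. The function h varies with n to cover the approximate ground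
  states.\<close>

lemma FK_tendsto_LT:
  assumes t: "t \<ge> 0" and h: "\<And>n. bounded_borel (h n)" "\<And>n x. \<bar>h n x\<bar> \<le> C" "\<And>x. (\<lambda>n. h n x) \<longlonglongrightarrow> h' x"
  shows "(\<lambda>n. FK (W n) t (h n) x) \<longlonglongrightarrow> LT t h' x"
    and "integrable M (\<lambda>\<omega>. (h' (x - X t \<omega>) * exp (\<mu> * loc t x \<omega>))\<^sup>2)"
proof -
  have [measurable]: "h' \<in> borel_measurable borel"
    by (rule borel_measurable_LIMSEQ_real[of _ h]) (use h in auto)
  note [measurable] = h(1)[THEN bounded_borel_measurable]
  obtain K where K: "\<And>n a x. FK (\<lambda>x. 2 * \<mu> * bump n (x - a)) t (\<lambda>_. 1) x \<le> K"
    using FK_bump_one_bounded[of "2 * \<mu>" t] mu_pos t by auto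
  have bb: "bounded_borel (\<lambda>x. q * bump n (x - a))" for q n
    using bounded_continuous_bump by simp
  define Z where "Z n \<omega> = h n (x - X t \<omega>) * exp (clock (W n) x t \<omega>)" for n \<omega>
  have sq: "(Z n \<omega>)\<^sup>2 = (h n (x - X t \<omega>))\<^sup>2 * exp (clock (\<lambda>x. 2 * \<mu> * bump n (x - a)) x t \<omega>)" for n \<omega>
    unfolding Z_def mult.assoc clock_cmult by (simp add: power_mult_distrib power2_eq_square exp_add[symmetric])
  have C2: "(h n y)\<^sup>2 \<le> C\<^sup>2" for n y
    using power_mono[OF h(2)[of n y], of 2] by simp
  have i1: "integrable M (\<lambda>\<omega>. exp (clock (\<lambda>x. 2 * \<mu> * bump n (x - a)) x t \<omega>))" for n
    using integrable_FK_integrand[OF bb bounded_borel_const[of 1] t, of "2 * \<mu>" n x] by simp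
  have i2: "integrable M (\<lambda>\<omega>. (Z n \<omega>)\<^sup>2)" for n
  proof (rule integrable_dominated[OF integrable_mult_right[OF i1[of n], of "C\<^sup>2"]])
    show "\<bar>(Z n \<omega>)\<^sup>2\<bar> \<le> C\<^sup>2 * exp (clock (\<lambda>x. 2 * \<mu> * bump n (x - a)) x t \<omega>)" for \<omega>
      unfolding sq using C2[of n "x - X t \<omega>"] by (simp add: mult_right_mono)
  qed (unfold Z_def, measurable)
  have bd: "(\<integral>\<omega>. (Z n \<omega>)\<^sup>2 \<partial>M) \<le> C\<^sup>2 * K" for n
  proof -
    have "(\<integral>\<omega>. (Z n \<omega>)\<^sup>2 \<partial>M) \<le> (\<integral>\<omega>. C\<^sup>2 * exp (clock (\<lambda>x. 2 * \<mu> * bump n (x - a)) x t \<omega>) \<partial>M)"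
      by (rule integral_mono[OF i2 integrable_mult_right[OF i1]]) (unfold sq, intro mult_right_mono C2, simp)
    also have "\<dots> = C\<^sup>2 * FK (\<lambda>x. 2 * \<mu> * bump n (x - a)) t (\<lambda>_. 1) x"
      by (simp add: FK_def)
    also have "\<dots> \<le> C\<^sup>2 * K" by (intro mult_left_mono K) simp
    finally show ?thesis .
  qed
  have Zm: "Z n \<in> borel_measurable M" for n unfolding Z_def by measurable
  have Z'm: "(\<lambda>\<omega>. h' (x - X t \<omega>) * exp (\<mu> * loc t x \<omega>)) \<in> borel_measurable M" by measurable
  have lim: "AE \<omega> in M. (\<lambda>n. Z n \<omega>) \<longlonglongrightarrow> h' (x - X t \<omega>) * exp (\<mu> * loc t x \<omega>)"
    using clock_tendsto_loc[OF t, of x]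
  proof eventually_elim
    fix \<omega> assume "(\<lambda>n. clock (\<lambda>y. bump n (y - a)) x t \<omega>) \<longlonglongrightarrow> loc t x \<omega>"
    then show "(\<lambda>n. Z n \<omega>) \<longlonglongrightarrow> h' (x - X t \<omega>) * exp (\<mu> * loc t x \<omega>)"
      unfolding Z_def clock_cmult by (intro tendsto_intros h)
  qed
  note * = integral_tendsto_of_bounded_second_moments[OF i2 Zm Z'm lim bd]
  show "(\<lambda>n. FK (W n) t (h n) x) \<longlonglongrightarrow> LT t h' x"
    using *(3) by (simp add: FK_def LT_def Z_def)
  show "integrable M (\<lambda>\<omega>. (h' (x - X t \<omega>) * exp (\<mu> * loc t x \<omega>))\<^sup>2)" by (rule *(1))
qed

definition ground :: "real \<Rightarrow> real" where
  "ground x = green \<nu> (x - a)"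

lemma ground: "bounded_borel ground" "integrable lborel ground" "square_summable ground"
proof -
  have [measurable]: "green \<nu> \<in> borel_measurable borel" using nu_pos by simp
  have "ground \<in> borel_measurable borel" unfolding ground_def[abs_def] by measurable
  then show bb: "bounded_borel ground"
    using green_nonneg[OF nu_pos] green_le[OF nu_pos]
    by (intro bounded_borelI[where C = "green \<nu> 0"]) (auto simp: ground_def)
  show i: "integrable lborel ground"
    using lborel_integrable_real_affine[OF integrable_green[OF nu_pos], of 1 "- a"] by (simp add: ground_def[abs_def])
  show "square_summable ground" by (rule square_summable_bounded[OF bb i])
qed

lemma ground_norm_pos: "(LBINT x. (ground x)\<^sup>2) > 0"
proof -
  have int: "integrable lborel (\<lambda>x. (ground x)\<^sup>2)" using ground(3) by (simp add: square_summable_def)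
  have "green \<nu> 0 > 0" using critical mu_pos by (metis mult_zero_right less_le green_nonneg[OF nu_pos] zero_neq_one)
  then obtain d where d: "d > 0" "\<And>y. \<bar>y\<bar> < d \<Longrightarrow> \<bar>green \<nu> y - green \<nu> 0\<bar> < green \<nu> 0 / 2"
    using isCont_green[OF nu_pos, of 0] unfolding continuous_at_eps_delta dist_real_def by (metis diff_zero half_gt_zero)
  have "(LBINT x. (green \<nu> 0 / 2)\<^sup>2 * indicator {a - d/2..a + d/2} x) \<le> (LBINT x. (ground x)\<^sup>2)"
  proof (rule integral_mono[OF _ int])
    show "integrable lborel (\<lambda>x. (green \<nu> 0 / 2)\<^sup>2 * indicator {a - d/2..a + d/2} x :: real)"
      by (intro integrable_mult_right integrable_real_indicator) (auto simp: emeasure_lborel_Icc_eq)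
    fix x
    show "(green \<nu> 0 / 2)\<^sup>2 * indicator {a - d/2..a + d/2} x \<le> (ground x)\<^sup>2"
    proof (cases "x \<in> {a - d/2..a + d/2}")
      case True
      then have "\<bar>x - a\<bar> < d" using d(1) by (auto simp: abs_less_iff)
      then have "green \<nu> 0 / 2 \<le> ground x" using d(2)[of "x - a"] unfolding ground_def by linarith
      then have "(green \<nu> 0 / 2)\<^sup>2 \<le> (ground x)\<^sup>2" using \<open>green \<nu> 0 > 0\<close> by (intro power_mono) auto
      then show ?thesis using True by simp
    qed simp
  qed
  moreover have "(LBINT x. (green \<nu> 0 / 2)\<^sup>2 * indicator {a - d/2..a + d/2} x) = (green \<nu> 0 / 2)\<^sup>2 * d"
    using d(1) by simp
  moreover have "(green \<nu> 0 / 2)\<^sup>2 * d > 0" using \<open>green \<nu> 0 > 0\<close> d(1) by simp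
  ultimately show ?thesis by linarith
qed

text \<open>The resolvents of the bumps converge to the ground state and are invariant up to \<eta>
  C. Here C does not depend on n, while \<eta> becomes arbitrarily small as the bump
  narrows.\<close>

lemma LT_ground:
  assumes t: "t \<ge> 0"
  shows "exp (- (\<nu> * t)) * LT t ground x = ground x"
proof -
  define \<phi> where "\<phi> n = resolvent \<nu> (\<lambda>y. bump n (y - a))" for n
  obtain C where C: "\<And>n a x. FK (\<lambda>x. \<mu> * bump n (x - a)) t (\<lambda>_. 1) x \<le> C"
    using FK_bump_one_bounded[OF mu_pos t] by blast
  have C0: "0 \<le> C" using C[of 0 a x] FK_nonneg[of "\<lambda>_. 1" "W 0" t x] by simp
  have \<phi>b: "bounded_borel (\<phi> n)" for n
    unfolding \<phi>_def using bounded_continuous_borel[OF bounded_continuous_bump[of 1]] nu_pos by simp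
  have \<phi>le: "\<bar>\<phi> n x\<bar> \<le> green \<nu> 0" for n x
    unfolding \<phi>_def using resolvent_bump_bounds[OF nu_pos, of n a x] by simp
  have \<phi>lim: "(\<lambda>n. \<phi> n x) \<longlonglongrightarrow> ground x" for x
    unfolding \<phi>_def ground_def by (rule resolvent_bump_tendsto[OF nu_pos])
  have lhs: "(\<lambda>n. exp (- (\<nu> * t)) * FK (W n) t (\<phi> n) x - \<phi> n x) \<longlonglongrightarrow> exp (- (\<nu> * t)) * LT t ground x - ground x"
    by (intro tendsto_intros FK_tendsto_LT(1)[OF t \<phi>b \<phi>le \<phi>lim] \<phi>lim)
  have "(\<lambda>n. exp (- (\<nu> * t)) * FK (W n) t (\<phi> n) x - \<phi> n x) \<longlonglongrightarrow> 0"
  proof (rule LIMSEQ_I)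
    fix e :: real assume e: "e > 0"
    \<comment> \<open>Chosen so that \<eta> C < e; the added 1 guards against C = 0.\<close>
    define \<eta> where "\<eta> = e / (2 * (C + 1))"
    have \<eta>: "\<eta> > 0" using e C0 by (simp add: \<eta>_def)
    have \<eta>C: "\<eta> * C < e"
    proof -
      have "\<eta> * C \<le> \<eta> * (C + 1)" using \<eta> by (intro mult_left_mono) auto
      also have "\<dots> = e / 2" using C0 by (simp add: \<eta>_def field_simps)
      also have "\<dots> < e" using e by simp
      finally show ?thesis .
    qed
    obtain N where N: "\<And>n x. n \<ge> N \<Longrightarrow> \<bar>x - a\<bar> \<le> 1 / real (Suc n) \<Longrightarrow> \<bar>\<phi> n x - green \<nu> 0\<bar> \<le> \<eta>"
      using resolvent_bump_near[OF nu_pos \<eta>, of a] unfolding \<phi>_def by blast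
    have "\<bar>exp (- (\<nu> * t)) * FK (W n) t (\<phi> n) x - \<phi> n x\<bar> \<le> \<eta> * C" if "n \<ge> N" for n
      unfolding \<phi>_def using \<eta> N[OF that] C
      by (intro FK_bump_ground_state[OF mu_pos nu_pos critical t]) (auto simp: \<phi>_def)
    then show "\<exists>N. \<forall>n\<ge>N. norm (exp (- (\<nu> * t)) * FK (W n) t (\<phi> n) x - \<phi> n x - 0) < e"
      using \<eta>C by (intro exI[of _ N]) (auto intro: le_less_trans)
  qed
  from LIMSEQ_unique[OF lhs this] show ?thesis by simp
qed

lemma LT_contraction_bounded:
  assumes t: "t \<ge> 0" and f: "bounded_borel f" "integrable lborel f"
  shows "square_summable (\<lambda>x. exp (- (\<nu> * t)) * LT t f x)"
    "(LBINT x. (exp (- (\<nu> * t)) * LT t f x)\<^sup>2) \<le> (LBINT x. (f x)\<^sup>2)"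
proof -
  have [measurable]: "f \<in> borel_measurable borel" using f(1) by (rule bounded_borel_measurable)
  obtain C where C: "\<And>x. \<bar>f x\<bar> \<le> C" using f by (metis bounded_borelE)
  have Wb: "bounded_borel (W n)" for n using bounded_continuous_bump by simp
  have sq: "square_summable (\<lambda>x. exp (- (\<nu> * t)) * FK (W n) t f x)" for n
    using Wb f t by (intro square_summable_cmult square_summable_bounded integrable_FK) auto
  have lim: "AE x in lborel. (\<lambda>n. exp (- (\<nu> * t)) * FK (W n) t f x) \<longlonglongrightarrow> exp (- (\<nu> * t)) * LT t f x"
    using C f by (intro AE_I2 tendsto_mult tendsto_const FK_tendsto_LT(1)[OF t, of _ C]) auto
  have m: "(\<lambda>x. exp (- (\<nu> * t)) * LT t f x) \<in> borel_measurable borel" by measurable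
  note * = fatou_square[OF sq m lim FK_bump_contraction[OF mu_pos nu_pos critical f t] tendsto_const]
  show "square_summable (\<lambda>x. exp (- (\<nu> * t)) * LT t f x)" by (rule *(1))
  show "(LBINT x. (exp (- (\<nu> * t)) * LT t f x)\<^sup>2) \<le> (LBINT x. (f x)\<^sup>2)" by (rule *(2))
qed

text \<open>The energy estimate is applied at time 2 t, whose half is t. For fixed t the bump
  narrows and removes the term with \<eta>, because R_\<nu> f is continuous and vanishes at a; what
  remains is O(1/t).\<close>

lemma LT_decay:
  assumes t: "t > 0" and f: "bounded_borel f" "integrable lborel f" and orth: "(LBINT x. f x * ground x) = 0"
  shows "(LBINT x. (exp (- (\<nu> * t)) * LT t f x)\<^sup>2) \<le>
    ((LBINT x. (f x)\<^sup>2) + (LBINT x. (resolvent \<nu> f x)\<^sup>2)) / (2 * t)"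
proof -
  have [measurable]: "f \<in> borel_measurable borel" using f(1) by (rule bounded_borel_measurable)
  obtain Cf where Cf: "\<And>x. \<bar>f x\<bar> \<le> Cf" using f by (metis bounded_borelE)
  have t2: "2 * t \<ge> 0" "t \<ge> 0" using t by auto
  obtain C where C: "\<And>n a x. FK (\<lambda>x. \<mu> * bump n (x - a)) (2 * t) (\<lambda>_. 1) x \<le> C"
    using FK_bump_one_bounded[OF mu_pos t2(1)] by blast
  have C0: "0 \<le> C" using C[of 0 a 0] FK_nonneg[of "\<lambda>_. 1" "W 0" "2 * t" 0] by simp
  have Wb: "bounded_borel (W n)" for n using bounded_continuous_bump by simp
  define S where "S = (LBINT x. (f x)\<^sup>2) + (LBINT x. (resolvent \<nu> f x)\<^sup>2)"
  define F where "F = (LBINT x. \<bar>f x\<bar>)"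
  have F0: "0 \<le> F" unfolding F_def by (intro Bochner_Integration.integral_nonneg) auto
  define A where "A n = (LBINT x. (exp (- (\<nu> * t)) * FK (W n) t f x)\<^sup>2)" for n
  have zero: "resolvent \<nu> f a = 0"
    unfolding resolvent_at[OF nu_pos f(1)] using orth by (simp add: ground_def)
  have small: "\<exists>N. \<forall>n\<ge>N. A n \<le> (S + \<eta> * C * F) / (2 * t)" if \<eta>: "\<eta> > 0" for \<eta>
  proof -
    obtain d where d: "d > 0" "\<And>x. \<bar>x - a\<bar> < d \<Longrightarrow> \<bar>resolvent \<nu> f x - resolvent \<nu> f a\<bar> < \<eta>"
      using isCont_resolvent[OF nu_pos f, of a] \<eta> unfolding continuous_at_eps_delta dist_real_def by auto
    obtain N where N: "1 / real (Suc N) < d" using d(1) nat_approx_posE by blast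
    have "A n \<le> (S + \<eta> * C * F) / (2 * t)" if n: "n \<ge> N" for n
    proof -
      have le: "1 / real (Suc n) \<le> 1 / real (Suc N)" using n by (intro divide_left_mono) auto
      have "\<bar>resolvent \<nu> f x\<bar> \<le> \<eta>" if "\<bar>x - a\<bar> \<le> 1 / real (Suc n)" for x
        using d(2)[of x] le N that zero by auto
      then have "2 * t * (LBINT x. (exp (- (\<nu> * (2 * t / 2))) * FK (W n) (2 * t / 2) f x)\<^sup>2) \<le> S + \<eta> * C * F"
        unfolding S_def F_def using \<eta> C
        by (intro FK_bump_energy_decay[OF mu_pos nu_pos critical f t2(1)]) auto
      then show ?thesis using t by (simp add: A_def field_simps)
    qed
    then show ?thesis by blast
  qed
  show ?thesis
  proof (rule field_le_epsilon)
    fix e :: real assume e: "e > 0"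
    define \<eta> where "\<eta> = e * (2 * t) / (C * F + 1)"
    have CF: "0 \<le> C * F" using C0 F0 by simp
    have \<eta>: "\<eta> > 0" using e t CF by (auto simp: \<eta>_def intro!: divide_pos_pos)
    obtain N where N: "\<And>n. n \<ge> N \<Longrightarrow> A n \<le> (S + \<eta> * C * F) / (2 * t)" using small[OF \<eta>] by blast
    have "\<eta> * (C * F) \<le> e * (2 * t)"
    proof -
      have "\<eta> * (C * F) \<le> \<eta> * (C * F + 1)" using \<eta> by (intro mult_left_mono) auto
      also have "\<dots> = e * (2 * t)" using CF by (simp add: \<eta>_def)
      finally show ?thesis .
    qed
    then have le: "(S + \<eta> * C * F) / (2 * t) \<le> S / (2 * t) + e"
      using t by (simp add: field_simps)
    have "(LBINT x. (exp (- (\<nu> * t)) * LT t f x)\<^sup>2) \<le> S / (2 * t) + e"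
    \<comment> \<open>The sequence is taken from index N on, so that the bound holds for each of its
      terms.\<close>
    proof (rule fatou_square(2)[OF _ _ _ _ tendsto_const])
      show "square_summable (\<lambda>x. exp (- (\<nu> * t)) * FK (W (n + N)) t f x)" for n
        using Wb f t by (intro square_summable_cmult square_summable_bounded integrable_FK) auto
      show "AE x in lborel. (\<lambda>n. exp (- (\<nu> * t)) * FK (W (n + N)) t f x) \<longlonglongrightarrow> exp (- (\<nu> * t)) * LT t f x"
        using Cf f by (intro AE_I2 tendsto_mult tendsto_const LIMSEQ_ignore_initial_segment FK_tendsto_LT(1)[OF t2(2), of _ Cf]) auto
      show "(LBINT x. (exp (- (\<nu> * t)) * FK (W (n + N)) t f x)\<^sup>2) \<le> S / (2 * t) + e" for n
        using N[of "n + N"] le by (simp add: A_def)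
    qed measurable
    then show "(LBINT x. (exp (- (\<nu> * t)) * LT t f x)\<^sup>2) \<le>
      ((LBINT x. (f x)\<^sup>2) + (LBINT x. (resolvent \<nu> f x)\<^sup>2)) / (2 * t) + e"
      by (simp add: S_def)
  qed
qed

text \<open>By |u v| \<le> (u^2 + v^2) / 2 two second moments suffice. That of the exponential is
  finite for every x; that of f (x - X t) is finite for almost every x, by integration over x and
  translation invariance.\<close>

lemma AE_integrable_LT:
  assumes t: "t \<ge> 0" and f: "square_summable f"
  shows "AE x in lborel. integrable M (\<lambda>\<omega>. f (x - X t \<omega>) * exp (\<mu> * loc t x \<omega>))"
proof -
  have [measurable]: "f \<in> borel_measurable borel" using f by (simp add: square_summable_def)
  have "AE x in lborel. integrable M (\<lambda>\<omega>. (f (x - X t \<omega>))\<^sup>2)"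
    using PL.AE_integrable_fst'[OF integrable_shift[of "\<lambda>x. (f x)\<^sup>2" t]] f by (simp add: square_summable_def)
  then show ?thesis
  proof eventually_elim
    fix x assume i: "integrable M (\<lambda>\<omega>. (f (x - X t \<omega>))\<^sup>2)"
    have e: "integrable M (\<lambda>\<omega>. (exp (\<mu> * loc t x \<omega>))\<^sup>2)"
      using FK_tendsto_LT(2)[OF t, of "\<lambda>_ _. 1" 1 "\<lambda>_. 1" x] by simp
    show "integrable M (\<lambda>\<omega>. f (x - X t \<omega>) * exp (\<mu> * loc t x \<omega>))"
    proof (rule integrable_dominated)
      show "integrable M (\<lambda>\<omega>. ((f (x - X t \<omega>))\<^sup>2 + (exp (\<mu> * loc t x \<omega>))\<^sup>2) / 2)" using i e by simp
      show "\<bar>f (x - X t \<omega>) * exp (\<mu> * loc t x \<omega>)\<bar> \<le> ((f (x - X t \<omega>))\<^sup>2 + (exp (\<mu> * loc t x \<omega>))\<^sup>2) / 2" for \<omega>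
        using zero_le_power2[of "\<bar>f (x - X t \<omega>)\<bar> - \<bar>exp (\<mu> * loc t x \<omega>)\<bar>"] unfolding power2_diff by (simp add: abs_mult)
    qed measurable
  qed
qed

text \<open>Extension from bounded integrable functions by truncation: the expectations of the
  truncations converge for almost every x, and Fatou's lemma keeps the bound.\<close>

lemma LT_contraction:
  assumes t: "t \<ge> 0" and f: "square_summable f"
  shows "square_summable (\<lambda>x. exp (- (\<nu> * t)) * LT t f x)"
    "(LBINT x. (exp (- (\<nu> * t)) * LT t f x)\<^sup>2) \<le> (LBINT x. (f x)\<^sup>2)"
proof -
  have m [measurable]: "f \<in> borel_measurable borel" using f by (simp add: square_summable_def)
  have [measurable]: "truncate n f \<in> borel_measurable borel" for n
    using truncate(1)[OF m] by (rule bounded_borel_measurable)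
  have sq: "square_summable (\<lambda>x. exp (- (\<nu> * t)) * LT t (truncate n f) x)" for n
    by (rule LT_contraction_bounded(1)[OF t truncate(1,2)[OF m]])
  have bd: "(LBINT x. (exp (- (\<nu> * t)) * LT t (truncate n f) x)\<^sup>2) \<le> (LBINT x. (f x)\<^sup>2)" for n
  proof (rule order_trans[OF LT_contraction_bounded(2)[OF t truncate(1,2)[OF m]]])
    show "(LBINT x. (truncate n f x)\<^sup>2) \<le> (LBINT x. (f x)\<^sup>2)"
      using f bounded_borel_integrable_power2[OF truncate(1,2)[OF m]]
      by (intro integral_mono) (auto simp: square_summable_def truncate_def)
  qed
  have lim: "AE x in lborel. (\<lambda>n. exp (- (\<nu> * t)) * LT t (truncate n f) x) \<longlonglongrightarrow> exp (- (\<nu> * t)) * LT t f x"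
    using AE_integrable_LT[OF t f]
  proof eventually_elim
    fix x assume i: "integrable M (\<lambda>\<omega>. f (x - X t \<omega>) * exp (\<mu> * loc t x \<omega>))"
    have "(\<lambda>n. LT t (truncate n f) x) \<longlonglongrightarrow> LT t f x"
      unfolding LT_def
    proof (rule integral_dominated_convergence[where w = "\<lambda>\<omega>. \<bar>f (x - X t \<omega>) * exp (\<mu> * loc t x \<omega>)\<bar>"])
      show "AE \<omega> in M. (\<lambda>n. truncate n f (x - X t \<omega>) * exp (\<mu> * loc t x \<omega>)) \<longlonglongrightarrow> f (x - X t \<omega>) * exp (\<mu> * loc t x \<omega>)"
        by (intro AE_I2 tendsto_mult tendsto_const truncate(4) m)
      show "AE \<omega> in M. norm (truncate n f (x - X t \<omega>) * exp (\<mu> * loc t x \<omega>)) \<le> \<bar>f (x - X t \<omega>) * exp (\<mu> * loc t x \<omega>)\<bar>" for n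
        using truncate(3)[OF m] by (intro AE_I2) (auto simp: abs_mult intro!: mult_right_mono)
    qed (use i in auto)
    then show "(\<lambda>n. exp (- (\<nu> * t)) * LT t (truncate n f) x) \<longlonglongrightarrow> exp (- (\<nu> * t)) * LT t f x"
      by (intro tendsto_mult tendsto_const)
  qed
  have m': "(\<lambda>x. exp (- (\<nu> * t)) * LT t f x) \<in> borel_measurable borel" by measurable
  note * = fatou_square[OF sq m' lim bd tendsto_const]
  show "square_summable (\<lambda>x. exp (- (\<nu> * t)) * LT t f x)" by (rule *(1))
  show "(LBINT x. (exp (- (\<nu> * t)) * LT t f x)\<^sup>2) \<le> (LBINT x. (f x)\<^sup>2)" by (rule *(2))
qed

lemma LT_linear_AE:
  assumes t: "t \<ge> 0" and f: "square_summable f" and g: "square_summable g"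
  shows "AE x in lborel. LT t (\<lambda>x. f x + c * g x) x = LT t f x + c * LT t g x"
  using AE_integrable_LT[OF t f] AE_integrable_LT[OF t g]
proof eventually_elim
  fix x
  assume i: "integrable M (\<lambda>\<omega>. f (x - X t \<omega>) * exp (\<mu> * loc t x \<omega>))" "integrable M (\<lambda>\<omega>. g (x - X t \<omega>) * exp (\<mu> * loc t x \<omega>))"
  have "LT t (\<lambda>x. f x + c * g x) x = (\<integral>\<omega>. f (x - X t \<omega>) * exp (\<mu> * loc t x \<omega>) + c * (g (x - X t \<omega>) * exp (\<mu> * loc t x \<omega>)) \<partial>M)"
    unfolding LT_def by (simp add: algebra_simps)
  also have "\<dots> = LT t f x + c * LT t g x"
    unfolding LT_def using i by simp
  finally show "LT t (\<lambda>x. f x + c * g x) x = LT t f x + c * LT t g x" .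
qed

section \<open>Splitting off the ground state and decay on its complement\<close>

definition coef :: "(real \<Rightarrow> real) \<Rightarrow> real" where
  "coef f = (LBINT x. f x * ground x) / (LBINT x. (ground x)\<^sup>2)"

lemma coef_orthogonal:
  assumes f: "square_summable f"
  shows "(LBINT x. (f x - coef f * ground x) * ground x) = 0"
proof -
  have "(LBINT x. (f x - coef f * ground x) * ground x) = (LBINT x. f x * ground x - coef f * (ground x)\<^sup>2)"
    by (intro Bochner_Integration.integral_cong) (auto simp: power2_eq_square algebra_simps)
  also have "\<dots> = (LBINT x. f x * ground x) - coef f * (LBINT x. (ground x)\<^sup>2)"
    using square_summable_mult[OF f ground(3)] ground(3) by (simp add: square_summable_def)
  also have "\<dots> = 0" using ground_norm_pos by (simp add: coef_def)
  finally show ?thesis .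
qed

lemma coef_projection_le:
  assumes f: "square_summable f"
  shows "(LBINT x. (f x - coef f * ground x)\<^sup>2) \<le> (LBINT x. (f x)\<^sup>2)"
proof -
  define h where "h x = f x - coef f * ground x" for x
  have h: "square_summable h"
    unfolding h_def using f ground(3) by (intro square_summable_diff square_summable_cmult)
  have hg: "(LBINT x. h x * ground x) = 0" unfolding h_def by (rule coef_orthogonal[OF f])
  have "(LBINT x. (f x)\<^sup>2) = (LBINT x. (h x)\<^sup>2 + (2 * coef f * (h x * ground x) + (coef f)\<^sup>2 * (ground x)\<^sup>2))"
    by (intro Bochner_Integration.integral_cong) (auto simp: h_def power2_eq_square algebra_simps)
  also have "\<dots> = (LBINT x. (h x)\<^sup>2) + (coef f)\<^sup>2 * (LBINT x. (ground x)\<^sup>2)"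
    using h ground(3) square_summable_mult[OF h ground(3)] hg by (simp add: square_summable_def)
  finally show ?thesis
    unfolding h_def[symmetric] using ground_norm_pos by simp
qed

text \<open>The rescaled operator fixes \<open>ground\<close>, so subtracting its multiple may be
  done before or after. The limit theorem is thereby reduced to functions orthogonal to the ground
  state.\<close>

lemma LT_centered_eq_AE:
  assumes t: "t \<ge> 0" and f: "square_summable f"
  shows "AE x in lborel. exp (- (\<nu> * t)) * LT t f x - coef f * ground x = exp (- (\<nu> * t)) * LT t (\<lambda>x. f x - coef f * ground x) x"
  using LT_linear_AE[OF t f ground(3), of "- coef f"]
proof eventually_elim
  fix x
  assume *: "LT t (\<lambda>x. f x + - coef f * ground x) x = LT t f x + - coef f * LT t ground x"
  have "exp (- (\<nu> * t)) * LT t (\<lambda>x. f x - coef f * ground x) x = exp (- (\<nu> * t)) * LT t f x - coef f * (exp (- (\<nu> * t)) * LT t ground x)"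
  proof -
    have "LT t (\<lambda>x. f x - coef f * ground x) x = LT t f x - coef f * LT t ground x" using * by simp
    then show ?thesis by (simp add: right_diff_distrib)
  qed
  then show "exp (- (\<nu> * t)) * LT t f x - coef f * ground x = exp (- (\<nu> * t)) * LT t (\<lambda>x. f x - coef f * ground x) x"
    unfolding LT_ground[OF t] by simp
qed

text \<open>The decay rate is known for bounded integrable functions only. Truncating h may destroy
  orthogonality, so the ground state component of the truncation is removed again; the remaining
  difference is kept small for all times by contraction.\<close>

lemma LT_orthogonal_tendsto_0:
  assumes h: "square_summable h" and orth: "(LBINT x. h x * ground x) = 0"
  shows "((\<lambda>t. \<integral>x. (exp (- (\<nu> * t)) * LT t h x)\<^sup>2 \<partial>lborel) \<longlongrightarrow> 0) at_top"
proof -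
  define N where "N t = (LBINT x. (exp (- (\<nu> * t)) * LT t h x)\<^sup>2)" for t
  have N0: "0 \<le> N t" for t unfolding N_def by simp
  have m: "h \<in> borel_measurable borel" using h by (simp add: square_summable_def)
  have "\<forall>\<^sub>F t in at_top. N t < e" if e: "e > 0" for e
  proof -
    \<comment> \<open>A quarter of e, because (u + v)^2 \<le> 2 u^2 + 2 v^2 doubles it; the other
      half of e is left for S / t.\<close>
    have "\<forall>\<^sub>F n in sequentially. (LBINT x. (h x - truncate n h x)\<^sup>2) < e / 4"
      using truncate_L2[OF h] e by (intro order_tendstoD(2)) auto
    then obtain n where n: "(LBINT x. (h x - truncate n h x)\<^sup>2) < e / 4"
      by (auto simp: eventually_sequentially)
    define b where "b = truncate n h"
    have b: "bounded_borel b" "integrable lborel b" "square_summable b"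
      unfolding b_def using truncate(1,2)[OF m] by (auto intro: square_summable_bounded)
    define g where "g x = b x - coef b * ground x" for x
    have g: "bounded_borel g" "integrable lborel g" "square_summable g" "(LBINT x. g x * ground x) = 0"
      unfolding g_def using b ground coef_orthogonal[OF b(3)]
      by (auto intro: square_summable_diff square_summable_cmult)
    define r where "r x = h x - b x" for x
    have r: "square_summable r" unfolding r_def using h b by (intro square_summable_diff)
    \<comment> \<open>As h is orthogonal, the remainder r and the truncation b have opposite
      coefficients. Hence h - g is r minus its projection onto the ground state, and its norm is at
      most that of r.\<close>
    have "(LBINT x. r x * ground x) = - (LBINT x. b x * ground x)"
      unfolding r_def left_diff_distrib
      using orth square_summable_mult[OF h ground(3)] square_summable_mult[OF b(3) ground(3)] by simp
    then have "coef r = - coef b" by (simp add: coef_def)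
    then have hg: "h x - g x = r x - coef r * ground x" for x by (simp add: r_def g_def)
    have hg_sq: "square_summable (\<lambda>x. h x - g x)" using h g by (intro square_summable_diff)
    have hg_small: "(LBINT x. (h x - g x)\<^sup>2) < e / 4"
      unfolding hg using coef_projection_le[OF r] n by (simp add: r_def b_def)
    define S where "S = (LBINT x. (g x)\<^sup>2) + (LBINT x. (resolvent \<nu> g x)\<^sup>2)"
    have bound: "N t \<le> S / t + e / 2" if t: "t > 0" for t
    proof -
      have t0: "t \<ge> 0" using t by simp
      define u where "u x = exp (- (\<nu> * t)) * LT t g x" for x
      define v where "v x = exp (- (\<nu> * t)) * LT t (\<lambda>x. h x - g x) x" for x
      have u: "square_summable u" unfolding u_def by (rule LT_contraction(1)[OF t0 g(3)])
      have v: "square_summable v" unfolding v_def by (rule LT_contraction(1)[OF t0 hg_sq])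
      have "N t = (LBINT x. (u x + v x)\<^sup>2)"
        unfolding N_def
      proof (rule integral_cong_AE)
        show "AE x in lborel. (exp (- (\<nu> * t)) * LT t h x)\<^sup>2 = (u x + v x)\<^sup>2"
          using LT_linear_AE[OF t0 g(3) hg_sq, of 1] by eventually_elim (simp add: u_def v_def distrib_left)
      qed (use u v m in \<open>auto simp: square_summable_def\<close>)
      also have "\<dots> \<le> (LBINT x. 2 * (u x)\<^sup>2 + 2 * (v x)\<^sup>2)"
      proof (rule integral_mono)
        show "integrable lborel (\<lambda>x. (u x + v x)\<^sup>2)" using square_summable_add[OF u v] by (simp add: square_summable_def)
        show "integrable lborel (\<lambda>x. 2 * (u x)\<^sup>2 + 2 * (v x)\<^sup>2)" using u v by (simp add: square_summable_def)
        show "(u x + v x)\<^sup>2 \<le> 2 * (u x)\<^sup>2 + 2 * (v x)\<^sup>2" for x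
          using zero_le_power2[of "u x - v x"] by (simp add: power2_eq_square algebra_simps)
      qed
      also have "\<dots> = 2 * (LBINT x. (u x)\<^sup>2) + 2 * (LBINT x. (v x)\<^sup>2)"
        using u v by (simp add: square_summable_def)
      also have "\<dots> \<le> 2 * (S / (2 * t)) + 2 * (e / 4)"
      proof -
        have "(LBINT x. (u x)\<^sup>2) \<le> S / (2 * t)"
          unfolding u_def S_def by (rule LT_decay[OF t g(1,2,4)])
        moreover have "(LBINT x. (v x)\<^sup>2) \<le> e / 4"
          unfolding v_def using LT_contraction(2)[OF t0 hg_sq] hg_small by linarith
        ultimately show ?thesis by linarith
      qed
      finally show ?thesis by simp
    qed
    have "((\<lambda>t. S / t + e / 2) \<longlongrightarrow> e / 2) at_top" by real_asymp
    then have "\<forall>\<^sub>F t in at_top. S / t + e / 2 < e" by (rule order_tendstoD(2)) (use e in simp)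
    then show ?thesis
      using eventually_gt_at_top[of 0] by eventually_elim (use bound in force)
  qed
  then show ?thesis
    unfolding N_def[symmetric] using N0 by (intro order_tendstoI) (auto intro!: always_eventually intro: less_le_trans)
qed

theorem LT_tendsto_ground:
  assumes f: "square_summable f"
  shows "((\<lambda>t. \<integral>x. (exp (- (\<nu> * t)) * LT t f x - coef f * ground x)\<^sup>2 \<partial>lborel) \<longlongrightarrow> 0) at_top"
proof -
  have h: "square_summable (\<lambda>x. f x - coef f * ground x)"
    using f ground(3) by (intro square_summable_diff square_summable_cmult)
  have [measurable]: "f \<in> borel_measurable borel" using f by (simp add: square_summable_def)
  have [measurable]: "ground \<in> borel_measurable borel" using ground(1) by (rule bounded_borel_measurable)
  have "\<forall>\<^sub>F t in at_top. (LBINT x. (exp (- (\<nu> * t)) * LT t (\<lambda>x. f x - coef f * ground x) x)\<^sup>2)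
      = (LBINT x. (exp (- (\<nu> * t)) * LT t f x - coef f * ground x)\<^sup>2)"
    using eventually_ge_at_top[of 0]
  proof eventually_elim
    fix t :: real assume t: "0 \<le> t"
    show "(LBINT x. (exp (- (\<nu> * t)) * LT t (\<lambda>x. f x - coef f * ground x) x)\<^sup>2)
      = (LBINT x. (exp (- (\<nu> * t)) * LT t f x - coef f * ground x)\<^sup>2)"
    proof (rule integral_cong_AE)
      show "AE x in lborel. (exp (- (\<nu> * t)) * LT t (\<lambda>x. f x - coef f * ground x) x)\<^sup>2 = (exp (- (\<nu> * t)) * LT t f x - coef f * ground x)\<^sup>2"
        using LT_centered_eq_AE[OF t f] by eventually_elim simp
    qed measurable
  qed
  with LT_orthogonal_tendsto_0[OF h coef_orthogonal[OF f]] show ?thesis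
    by (rule Lim_transform_eventually)
qed

end

section \<open>Regular modifications and the main theorem\<close>

text \<open>Independence is a property of the joint law, which does not see null sets; for finitely
  many variables the exceptional sets unite to one null set.\<close>

lemma (in prob_space) indep_vars_cong_AE:
  assumes I: "indep_vars (\<lambda>_. N) Y I" and "finite I"
    and Z: "\<And>i. i \<in> I \<Longrightarrow> random_variable N (Z i)" and eq: "\<And>i. i \<in> I \<Longrightarrow> AE \<omega> in M. Y i \<omega> = Z i \<omega>"
  shows "indep_vars (\<lambda>_. N) Z I"
proof (cases "I = {}")
  case True
  then show ?thesis by (simp add: indep_vars_def indep_sets_def)
next
  case False
  have Y: "\<And>i. i \<in> I \<Longrightarrow> random_variable N (Y i)" using I by (auto simp: indep_vars_def)
  have "distr M (PiM I (\<lambda>_. N)) (\<lambda>\<omega>. \<lambda>i\<in>I. Z i \<omega>) = distr M (PiM I (\<lambda>_. N)) (\<lambda>\<omega>. \<lambda>i\<in>I. Y i \<omega>)"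
  proof (rule distr_cong_AE)
    have "AE \<omega> in M. \<forall>i\<in>I. Y i \<omega> = Z i \<omega>" using \<open>finite I\<close> eq by (intro AE_finite_allI) auto
    then show "AE \<omega> in M. (\<lambda>i\<in>I. Z i \<omega>) = (\<lambda>i\<in>I. Y i \<omega>)" by eventually_elim auto
  qed (use Y Z in \<open>auto intro!: measurable_restrict\<close>)
  also have "\<dots> = PiM I (\<lambda>i. distr M N (Y i))"
    using I indep_vars_iff_distr_eq_PiM'[OF False, where M' = "\<lambda>_. N" and X = Y] Y by simp
  also have "\<dots> = PiM I (\<lambda>i. distr M N (Z i))"
    using Y Z eq by (intro PiM_cong refl distr_cong_AE) auto
  finally show ?thesis
    using indep_vars_iff_distr_eq_PiM'[OF False, where M' = "\<lambda>_. N" and X = Z] Z by simp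
qed

text \<open>Evaluate the path at the next grid point to the right of t. This point takes countably
  many values, so each approximation is jointly measurable, and right-continuity gives the
  limit.\<close>

lemma borel_measurable_pair_of_right_continuous:
  fixes X :: "real \<Rightarrow> 'a \<Rightarrow> real"
  assumes X: "\<And>t. X t \<in> borel_measurable M" and rc: "\<And>t \<omega>. ((\<lambda>r. X r \<omega>) \<longlongrightarrow> X t \<omega>) (at_right t)"
  shows "(\<lambda>(t, \<omega>). X t \<omega>) \<in> borel_measurable (borel \<Otimes>\<^sub>M M)"
proof -
  \<comment> \<open>The summand 1 places the grid point strictly to the right of t, as convergence
    along \<open>at_right\<close> requires.\<close>
  define r where "r n t = (of_int \<lfloor>real (Suc n) * t\<rfloor> + 1) / real (Suc n)" for n t
  have r: "t < r n t" "r n t \<le> t + 1 / real (Suc n)" for n t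
  proof -
    define m where "m = real (Suc n)"
    define z where "z = real_of_int \<lfloor>m * t\<rfloor>"
    have "m * t < z + 1" "z \<le> m * t" unfolding z_def by linarith+
    moreover have "m > 0" by (simp add: m_def)
    ultimately show "t < r n t" "r n t \<le> t + 1 / real (Suc n)"
      unfolding r_def m_def[symmetric] z_def[symmetric] by (auto simp: field_simps)
  qed
  have lim: "(\<lambda>n. X (r n t) \<omega>) \<longlonglongrightarrow> X t \<omega>" for t \<omega>
  proof -
    have "(\<lambda>n. t + 1 / real (Suc n)) \<longlonglongrightarrow> t + 0"
      by (intro tendsto_add tendsto_const) (rule LIMSEQ_Suc[OF lim_1_over_n])
    then have "(\<lambda>n. r n t) \<longlonglongrightarrow> t"
      using r by (intro tendsto_sandwich[of "\<lambda>_. t" "\<lambda>n. r n t" sequentially "\<lambda>n. t + 1 / real (Suc n)"]) (auto simp: less_imp_le)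
    then have "filterlim (\<lambda>n. r n t) (at_right t) sequentially"
      using r(1) by (intro tendsto_imp_filterlim_at_right always_eventually) auto
    then show ?thesis by (rule filterlim_compose[OF rc])
  qed
  show ?thesis
  proof (rule borel_measurable_LIMSEQ_real)
    show "(\<lambda>n. case z of (t, \<omega>) \<Rightarrow> X (r n t) \<omega>) \<longlonglongrightarrow> (case z of (t, \<omega>) \<Rightarrow> X t \<omega>)" for z
      using lim by (cases z) simp
    fix n
    have X_i: "(\<lambda>z. X ((of_int i + 1) / real (Suc n)) (snd z)) \<in> borel_measurable (borel \<Otimes>\<^sub>M M)" for i :: int
      by (rule measurable_compose[OF measurable_snd X])
    have "(\<lambda>z. \<lfloor>real (Suc n) * fst z\<rfloor>) \<in> measurable (borel \<Otimes>\<^sub>M M) (count_space UNIV)"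
      by measurable
    from measurable_compose_countable[OF X_i this] show "(\<lambda>z. case z of (t, \<omega>) \<Rightarrow> X (r n t) \<omega>) \<in> borel_measurable (borel \<Otimes>\<^sub>M M)"
      by (simp add: r_def case_prod_unfold)
  qed
qed

lemma levy_exponent_minus: "levy_exponent \<sigma> \<Lambda> (- p) = levy_exponent \<sigma> \<Lambda> p"
  by (simp add: levy_exponent_def)

text \<open>One null set contains all paths that do not start at 0 or fail to be right-continuous
  somewhere; on it X is set to 0. Times before 0 are frozen at 0, so right-continuity holds at every
  real time and X agrees with \<xi> simultaneously for all t \<ge> 0 off the null set.\<close>

lemma (in levy_process) regular_modification:
  assumes char_fun: "\<And>t p. t \<ge> 0 \<Longrightarrow> (CLINT \<omega>|M. exp (\<i> * of_real (p * \<xi> t \<omega>))) = exp (- of_real (t * \<Psi> p))"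
    and even: "\<And>p. \<Psi> (- p) = \<Psi> p"
    and int: "integrable lborel (\<lambda>p. 1 / (1 + \<Psi> p))"
  obtains X where "symmetric_levy_exponent M X \<Psi>" "AE \<omega> in M. \<forall>t\<ge>0. X t \<omega> = \<xi> t \<omega>"
proof -
  have "AE \<omega> in M. \<xi> 0 \<omega> = 0 \<and> (\<forall>t\<ge>0. ((\<lambda>r. \<xi> r \<omega>) \<longlongrightarrow> \<xi> t \<omega>) (at_right t))"
    using starts_at_0 cadlag_paths by eventually_elim auto
  then obtain N where N: "N \<in> null_sets M"
    "\<And>\<omega>. \<omega> \<in> space M - N \<Longrightarrow> \<xi> 0 \<omega> = 0 \<and> (\<forall>t\<ge>0. ((\<lambda>r. \<xi> r \<omega>) \<longlongrightarrow> \<xi> t \<omega>) (at_right t))"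
    by (elim AE_E3) auto
  define X where "X t \<omega> = (if \<omega> \<in> space M - N then \<xi> (max 0 t) \<omega> else 0)" for t \<omega>
  have AE_N: "AE \<omega> in M. \<omega> \<in> space M - N"
    using AE_not_in[OF N(1)] AE_space by eventually_elim auto
  have AE_eq: "AE \<omega> in M. \<forall>t\<ge>0. X t \<omega> = \<xi> t \<omega>"
    using AE_N by eventually_elim (simp add: X_def)
  have AE_eq1: "AE \<omega> in M. X t \<omega> = \<xi> t \<omega>" if "t \<ge> 0" for t
    using AE_eq by eventually_elim (use that in auto)
  have [measurable]: "N \<in> sets M" using N(1) by auto
  have xi_m [measurable]: "\<xi> (max 0 t) \<in> borel_measurable M" for t
    by (rule random_variable) simp
  have X_m [measurable]: "X t \<in> borel_measurable M" for t
    unfolding X_def by measurable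
  have xi_m' : "\<xi> t \<in> borel_measurable M" if "t \<ge> 0" for t using random_variable[OF that] .
  have rc: "((\<lambda>r. X r \<omega>) \<longlongrightarrow> X t \<omega>) (at_right t)" for t \<omega>
  proof (cases "\<omega> \<in> space M - N")
    case True
    show ?thesis
    proof (cases "t \<ge> 0")
      case t: True
      have "\<forall>\<^sub>F r in at_right t. \<xi> r \<omega> = X r \<omega>"
        unfolding eventually_at_right_field using True t by (intro exI[of _ "t + 1"]) (auto simp: X_def)
      moreover have "((\<lambda>r. \<xi> r \<omega>) \<longlongrightarrow> X t \<omega>) (at_right t)"
        using N(2)[OF True] True t by (simp add: X_def)
      ultimately show ?thesis by (rule Lim_transform_eventually[rotated])
    next
      case t: False
      have "\<forall>\<^sub>F r in at_right t. X t \<omega> = X r \<omega>"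
        unfolding eventually_at_right_field using True t by (intro exI[of _ 0]) (auto simp: X_def)
      then show ?thesis by (rule Lim_transform_eventually[OF tendsto_const])
    qed
  next
    case False
    then have "X r \<omega> = 0" for r unfolding X_def by (rule if_not_P)
    then show ?thesis by simp
  qed
  have "symmetric_levy_exponent M X \<Psi>"
  proof
    show "(\<lambda>(t, \<omega>). X t \<omega>) \<in> borel_measurable (borel \<Otimes>\<^sub>M M)"
      by (rule borel_measurable_pair_of_right_continuous[OF X_m rc])
    show "X 0 \<omega> = 0" for \<omega>
      using N(2)[of \<omega>] by (simp add: X_def)
    show "((\<lambda>r. X r \<omega>) \<longlongrightarrow> X t \<omega>) (at_right t)" for t \<omega> by (rule rc)
  next
    fix s :: "nat \<Rightarrow> real" and n :: nat assume s: "0 \<le> s 0" "mono s"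
    have s0: "0 \<le> s i" for i using monoD[OF s(2), of 0 i] s(1) by simp
    show "indep_vars (\<lambda>_. borel) (\<lambda>i \<omega>. X (s (Suc i)) \<omega> - X (s i) \<omega>) {..<n}"
    proof (rule indep_vars_cong_AE[OF indep_increments[OF s]])
      show "AE \<omega> in M. \<xi> (s (Suc i)) \<omega> - \<xi> (s i) \<omega> = X (s (Suc i)) \<omega> - X (s i) \<omega>" for i
        using AE_eq1[OF s0[of i]] AE_eq1[OF s0[of "Suc i"]] by eventually_elim simp
    qed auto
  next
    fix r t :: real assume rt: "0 \<le> r" "r \<le> t"
    have [measurable]: "\<xi> t \<in> borel_measurable M" "\<xi> r \<in> borel_measurable M" using rt by (auto intro: xi_m')
    have "distr M borel (\<lambda>\<omega>. X t \<omega> - X r \<omega>) = distr M borel (\<lambda>\<omega>. \<xi> t \<omega> - \<xi> r \<omega>)"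
    proof (rule distr_cong_AE)
      show "AE \<omega> in M. X t \<omega> - X r \<omega> = \<xi> t \<omega> - \<xi> r \<omega>"
        using AE_eq by eventually_elim (use rt in auto)
    qed auto
    also have "\<dots> = distr M borel (\<xi> (t - r))" by (rule stationary_increments[OF rt])
    also have "\<dots> = distr M borel (X (t - r))"
    proof (rule distr_cong_AE)
      show "AE \<omega> in M. \<xi> (t - r) \<omega> = X (t - r) \<omega>"
        using AE_eq by eventually_elim (use rt in auto)
    qed (use rt xi_m' in auto)
    finally show "distr M borel (\<lambda>\<omega>. X t \<omega> - X r \<omega>) = distr M borel (X (t - r))" .
  next
    have char: "(CLINT \<omega>|M. exp (\<i> * of_real (p * X t \<omega>))) = exp (- of_real (t * \<Psi> p))" if "t \<ge> 0" for t p
    proof -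
      have [measurable]: "\<xi> t \<in> borel_measurable M" using that by (rule xi_m')
      have "(CLINT \<omega>|M. exp (\<i> * of_real (p * X t \<omega>))) = (CLINT \<omega>|M. exp (\<i> * of_real (p * \<xi> t \<omega>)))"
      proof (rule integral_cong_AE)
        show "AE \<omega> in M. exp (\<i> * complex_of_real (p * X t \<omega>)) = exp (\<i> * of_real (p * \<xi> t \<omega>))"
          using AE_eq1[OF that] by eventually_elim simp
      qed measurable
      then show ?thesis using char_fun[OF that] by simp
    qed
    then show "(CLINT \<omega>|M. exp (\<i> * of_real (p * X t \<omega>))) = exp (- of_real (t * \<Psi> p))" if "t \<ge> 0" for t p
      using that .
    \<comment> \<open>The characteristic function of - X t is that of X t at the reflected argument,
      and \<Psi> is even.\<close>
    show "distr M borel (\<lambda>\<omega>. - X t \<omega>) = distr M borel (X t)" if t: "t \<ge> 0" for t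
    proof (rule Levy_uniqueness)
      show "char (distr M borel (\<lambda>\<omega>. - X t \<omega>)) = char (distr M borel (X t))"
      proof
        fix p
        have "char (distr M borel (\<lambda>\<omega>. - X t \<omega>)) p = (CLINT \<omega>|M. exp (\<i> * of_real ((- p) * X t \<omega>)))"
          unfolding char_def by (subst integral_distr) auto
        also have "\<dots> = (CLINT \<omega>|M. exp (\<i> * of_real (p * X t \<omega>)))"
          using char[OF t, of "- p"] char[OF t, of p] even by simp
        also have "\<dots> = char (distr M borel (X t)) p"
          unfolding char_def by (subst integral_distr) auto
        finally show "char (distr M borel (\<lambda>\<omega>. - X t \<omega>)) p = char (distr M borel (X t)) p" .
      qed
    qed auto
  qed (rule int)
  with AE_eq show thesis by (intro that)
qed

text \<open>By the occupation time formula the clock of a bump is the average of L t over a window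
  of radius 1 / (n + 1) around x - a, and L t is continuous in space.\<close>

lemma (in symmetric_levy_path) clock_bump_tendsto_local_time:
  assumes L: "continuous_local_time M X L" and t: "t \<ge> 0"
  shows "AE \<omega> in M. (\<lambda>n. clock (\<lambda>y. bump n (y - a)) x t \<omega>) \<longlonglongrightarrow> L t (x - a) \<omega>"
proof -
  have "AE \<omega> in M. \<forall>t\<ge>0. (\<forall>x. 0 \<le> L t x \<omega>) \<and> occupation_measure X t \<omega> = density lborel (\<lambda>x. ennreal (L t x \<omega>))"
    using L unfolding continuous_local_time_def by blast
  then have "AE \<omega> in M. (\<forall>y. 0 \<le> L t y \<omega>) \<and> occupation_measure X t \<omega> = density lborel (\<lambda>x. ennreal (L t x \<omega>))"
    by eventually_elim (use t in blast)
  moreover have "AE \<omega> in M. continuous_on ({0..} \<times> UNIV) (\<lambda>(t, x). L t x \<omega>)"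
    using L unfolding continuous_local_time_def by blast
  ultimately show ?thesis using AE_space
  proof eventually_elim
    fix \<omega>
    assume occ: "(\<forall>y. 0 \<le> L t y \<omega>) \<and> occupation_measure X t \<omega> = density lborel (\<lambda>x. ennreal (L t x \<omega>))"
      and cont: "continuous_on ({0..} \<times> UNIV) (\<lambda>(t, x). L t x \<omega>)" and \<omega>: "\<omega> \<in> space M"
    have "continuous_on UNIV (\<lambda>y. (\<lambda>(t, x). L t x \<omega>) (t, y))"
      by (rule continuous_on_compose2[OF cont]) (use t in \<open>auto intro!: continuous_intros\<close>)
    then have L_cont: "continuous_on UNIV (\<lambda>y. L t y \<omega>)" by simp
    then have L_m [measurable]: "(\<lambda>y. L t y \<omega>) \<in> borel_measurable borel"
      by (rule borel_measurable_continuous_onI)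
    have X_m: "(\<lambda>\<tau>. X \<tau> \<omega>) \<in> borel_measurable borel"
      using measurable_path[OF \<omega>, of "\<lambda>y. - y" 0 0] by simp
    have "clock (\<lambda>y. bump n (y - a)) x t \<omega> = (LBINT y. bump n (x - a - y) * L t y \<omega>)" for n
    proof -
      have "clock (\<lambda>y. bump n (y - a)) x t \<omega> = (LBINT \<tau>. indicator {0..<t} \<tau> *\<^sub>R bump n (x - a - X \<tau> \<omega>))"
        unfolding clock_def set_lebesgue_integral_def
      proof (rule integral_cong_AE)
        \<comment> \<open>The clock integrates over (0, t], the occupation measure over [0, t); the
          two differ only at the end points.\<close>
        have "AE \<tau> in lborel. \<tau> \<noteq> 0 \<and> \<tau> \<noteq> t"
          using AE_lborel_singleton[of "0 :: real"] AE_lborel_singleton[of t] by eventually_elim auto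
        then show "AE \<tau> in lborel. indicator {0<..t} \<tau> *\<^sub>R bump n (x - X \<tau> \<omega> - a) = indicator {0..<t} \<tau> *\<^sub>R bump n (x - a - X \<tau> \<omega>)"
          by eventually_elim (auto simp: indicator_def algebra_simps)
      qed (use X_m in measurable)
      also have "\<dots> = (\<integral>\<tau>. bump n (x - a - X \<tau> \<omega>) \<partial>restrict_space lborel {0..<t})"
        by (rule integral_restrict_space[symmetric]) simp
      also have "\<dots> = (\<integral>y. bump n (x - a - y) \<partial>occupation_measure X t \<omega>)"
        unfolding occupation_measure_def
        by (rule integral_distr[symmetric]) (use X_m in \<open>auto intro: measurable_restrict_space1\<close>)
      also have "\<dots> = (LBINT y. L t y \<omega> *\<^sub>R bump n (x - a - y))"
        using occ by (simp add: integral_density)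
      finally show ?thesis by (simp add: mult.commute)
    qed
    moreover have "(\<lambda>n. \<integral>y. bump n (x - a - y) * L t y \<omega> \<partial>lborel) \<longlonglongrightarrow> L t (x - a) \<omega>"
      using L_cont by (intro bump_average_tendsto) (auto simp: continuous_on_eq_continuous_at)
    ultimately show "(\<lambda>n. clock (\<lambda>y. bump n (y - a)) x t \<omega>) \<longlonglongrightarrow> L t (x - a) \<omega>" by simp
  qed
qed

text \<open>The occupation measure up to t sees the path only on [0, t), where the two versions
  agree almost surely for all times at once.\<close>

lemma continuous_local_time_cong_AE:
  assumes L: "continuous_local_time M \<xi> L" and eq: "AE \<omega> in M. \<forall>t\<ge>0. X t \<omega> = \<xi> t \<omega>"
  shows "continuous_local_time M X L"
  unfolding continuous_local_time_def
proof (intro conjI)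
  have "AE \<omega> in M. \<forall>t\<ge>0. (\<forall>x. 0 \<le> L t x \<omega>) \<and> occupation_measure \<xi> t \<omega> = density lborel (\<lambda>x. ennreal (L t x \<omega>))"
    using L by (simp add: continuous_local_time_def)
  with eq show "AE \<omega> in M. \<forall>t\<ge>0. (\<forall>x. 0 \<le> L t x \<omega>) \<and> occupation_measure X t \<omega> = density lborel (\<lambda>x. ennreal (L t x \<omega>))"
  proof eventually_elim
    fix \<omega> assume eq: "\<forall>t\<ge>0. X t \<omega> = \<xi> t \<omega>"
      and *: "\<forall>t\<ge>0. (\<forall>x. 0 \<le> L t x \<omega>) \<and> occupation_measure \<xi> t \<omega> = density lborel (\<lambda>x. ennreal (L t x \<omega>))"
    have "occupation_measure X t \<omega> = occupation_measure \<xi> t \<omega>" for t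
      unfolding occupation_measure_def using eq by (intro distr_cong) (auto simp: space_restrict_space)
    with * show "\<forall>t\<ge>0. (\<forall>x. 0 \<le> L t x \<omega>) \<and> occupation_measure X t \<omega> = density lborel (\<lambda>x. ennreal (L t x \<omega>))"
      by simp
  qed
qed (use L in \<open>auto simp: continuous_local_time_def\<close>)

section \<open>Transfer to complex-valued functions\<close>

context levy_local_time
begin

definition LTc :: "real \<Rightarrow> (real \<Rightarrow> complex) \<Rightarrow> real \<Rightarrow> complex" where
  "LTc t f x = (CLINT \<omega>|M. f (x - X t \<omega>) * of_real (exp (\<mu> * loc t x \<omega>)))"

lemma measurable_LTc [measurable]:
  assumes [measurable]: "f \<in> borel_measurable borel"
  shows "LTc t f \<in> borel_measurable borel"
  unfolding LTc_def by measurable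

lemma square_summable_Re_Im:
  assumes f: "square_integrable f"
  shows "square_summable (\<lambda>x. Re (f x))" "square_summable (\<lambda>x. Im (f x))"
proof -
  have [measurable]: "f \<in> borel_measurable borel" and i: "integrable lborel (\<lambda>x. (cmod (f x))\<^sup>2)"
    using f by (auto simp: square_integrable_def)
  have "integrable lborel (\<lambda>x. (Re (f x))\<^sup>2)" "integrable lborel (\<lambda>x. (Im (f x))\<^sup>2)"
    by (rule integrable_dominated[OF i]; simp add: cmod_power2)+
  then show "square_summable (\<lambda>x. Re (f x))" "square_summable (\<lambda>x. Im (f x))"
    by (auto simp: square_summable_def)
qed

lemma LTc_AE:
  assumes t: "t \<ge> 0" and f: "square_integrable f"
  shows "AE x in lborel. integrable M (\<lambda>\<omega>. f (x - X t \<omega>) * of_real (exp (\<mu> * loc t x \<omega>))) \<and>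
    LTc t f x = Complex (LT t (\<lambda>x. Re (f x)) x) (LT t (\<lambda>x. Im (f x)) x)"
  using AE_integrable_LT[OF t square_summable_Re_Im(1)[OF f]] AE_integrable_LT[OF t square_summable_Re_Im(2)[OF f]]
proof eventually_elim
  fix x
  assume i: "integrable M (\<lambda>\<omega>. Re (f (x - X t \<omega>)) * exp (\<mu> * loc t x \<omega>))"
    "integrable M (\<lambda>\<omega>. Im (f (x - X t \<omega>)) * exp (\<mu> * loc t x \<omega>))"
  have eq: "f (x - X t \<omega>) * of_real (exp (\<mu> * loc t x \<omega>)) = of_real (Re (f (x - X t \<omega>)) * exp (\<mu> * loc t x \<omega>)) +
      \<i> * of_real (Im (f (x - X t \<omega>)) * exp (\<mu> * loc t x \<omega>))" for \<omega>
    by (simp add: complex_eq_iff)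
  have int: "integrable M (\<lambda>\<omega>. f (x - X t \<omega>) * of_real (exp (\<mu> * loc t x \<omega>)))"
    unfolding eq using i by (intro Bochner_Integration.integrable_add integrable_mult_right integrable_of_real)
  moreover have "LTc t f x = Complex (LT t (\<lambda>x. Re (f x)) x) (LT t (\<lambda>x. Im (f x)) x)"
    unfolding LTc_def complex_eq_iff integral_Re[OF int, symmetric] integral_Im[OF int, symmetric] by (simp add: LT_def)
  ultimately show "integrable M (\<lambda>\<omega>. f (x - X t \<omega>) * of_real (exp (\<mu> * loc t x \<omega>))) \<and>
    LTc t f x = Complex (LT t (\<lambda>x. Re (f x)) x) (LT t (\<lambda>x. Im (f x)) x)" ..
qed

text \<open>At the real parameter \<nu> the function psi is real, so the projection acts separately
  on real and imaginary parts; translation by a does not change the norm.\<close>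

lemma ground_state_projection:
  assumes f: "square_integrable f"
  shows "L2_inner f (\<lambda>y. psi \<Psi> (of_real \<nu>) (y - a)) / of_real ((L2_norm (psi \<Psi> (of_real \<nu>)))\<^sup>2) * psi \<Psi> (of_real \<nu>) (x - a)
    = Complex (coef (\<lambda>x. Re (f x)) * ground x) (coef (\<lambda>x. Im (f x)) * ground x)"
proof -
  have psi: "psi \<Psi> (of_real \<nu>) y = of_real (green \<nu> y)" for y by (rule psi_eq_green[OF nu_pos])
  have "(L2_norm (psi \<Psi> (of_real \<nu>)))\<^sup>2 = (LBINT x. (green \<nu> x)\<^sup>2)"
    unfolding L2_norm_def psi by (subst real_sqrt_pow2) auto
  also have "\<dots> = (LBINT x. (ground x)\<^sup>2)"
    using integral_lborel_shift[of "\<lambda>x. (green \<nu> x)\<^sup>2" "- a"] by (simp add: ground_def)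
  finally have norm: "(L2_norm (psi \<Psi> (of_real \<nu>)))\<^sup>2 = (LBINT x. (ground x)\<^sup>2)" .
  have i: "integrable lborel (\<lambda>x. Re (f x) * ground x)" "integrable lborel (\<lambda>x. Im (f x) * ground x)"
    using square_summable_Re_Im[OF f] ground(3) by (auto intro: square_summable_mult)
  have eq: "f x * of_real (ground x) = of_real (Re (f x) * ground x) + \<i> * of_real (Im (f x) * ground x)" for x
    by (simp add: complex_eq_iff)
  have int: "integrable lborel (\<lambda>x. f x * of_real (ground x))"
    unfolding eq using i by (intro Bochner_Integration.integrable_add integrable_mult_right integrable_of_real)
  have "L2_inner f (\<lambda>y. psi \<Psi> (of_real \<nu>) (y - a)) = (CLBINT x. f x * of_real (ground x))"
    unfolding L2_inner_def psi by (simp add: ground_def)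
  also have "\<dots> = Complex (LBINT x. Re (f x) * ground x) (LBINT x. Im (f x) * ground x)"
    unfolding complex_eq_iff integral_Re[OF int, symmetric] integral_Im[OF int, symmetric] by simp
  finally show ?thesis
    unfolding norm psi by (simp add: complex_eq_iff coef_def ground_def Re_divide_of_real Im_divide_of_real)
qed

text \<open>The family u stands for the expectations formed with the given process and local time.
  They are matched with \<open>LTc\<close> for t \<ge> 0 only, since
  \<open>continuous_local_time\<close> constrains L at those times, and a limit at infinity sees no
  others.\<close>

lemma LTc_tendsto_L2:
  assumes f: "square_integrable f" and u: "\<And>t x. t \<ge> 0 \<Longrightarrow> u t x = LTc t f x"
  shows "tendsto_L2 (\<lambda>t x. of_real (exp (- \<nu> * t)) * u t x)
    (\<lambda>x. Complex (coef (\<lambda>x. Re (f x)) * ground x) (coef (\<lambda>x. Im (f x)) * ground x)) at_top"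
proof -
  define fr fi where "fr x = Re (f x)" and "fi x = Im (f x)" for x
  note fri = square_summable_Re_Im[OF f, folded fr_def fi_def]
  have [measurable]: "f \<in> borel_measurable borel" using f by (simp add: square_integrable_def)
  have [measurable]: "ground \<in> borel_measurable borel" "fr \<in> borel_measurable borel" "fi \<in> borel_measurable borel"
    using ground(3) fri by (auto simp: square_summable_def)
  define v where "v x = Complex (coef fr * ground x) (coef fi * ground x)" for x
  have v_eq: "v x = of_real (coef fr * ground x) + \<i> * of_real (coef fi * ground x)" for x
    by (simp add: v_def complex_eq_iff)
  have v_m [measurable]: "v \<in> borel_measurable borel" unfolding v_eq[abs_def] by measurable
  have v_sq: "square_integrable v"
    using ground(3) by (simp add: square_integrable_def v_m) (simp add: v_def cmod_power2 power_mult_distrib square_summable_def)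
  define U where "U t x = complex_of_real (exp (- \<nu> * t)) * u t x" for t x
  have U_m: "U t \<in> borel_measurable borel" if "t \<ge> 0" for t
    unfolding U_def using u[OF that] by simp
  have U_AE: "AE x in lborel. U t x = Complex (exp (- (\<nu> * t)) * LT t fr x) (exp (- (\<nu> * t)) * LT t fi x)" if "t \<ge> 0" for t
    using LTc_AE[OF that f] by eventually_elim (use that in \<open>simp add: U_def u complex_eq_iff fr_def[abs_def] fi_def[abs_def]\<close>)
  have U_sq: "square_integrable (U t)" if t: "t \<ge> 0" for t
  proof -
    have "integrable lborel (\<lambda>x. (cmod (U t x))\<^sup>2) \<longleftrightarrow>
        integrable lborel (\<lambda>x. (exp (- (\<nu> * t)) * LT t fr x)\<^sup>2 + (exp (- (\<nu> * t)) * LT t fi x)\<^sup>2)"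
    proof (rule integrable_cong_AE)
      show "AE x in lborel. (cmod (U t x))\<^sup>2 = (exp (- (\<nu> * t)) * LT t fr x)\<^sup>2 + (exp (- (\<nu> * t)) * LT t fi x)\<^sup>2"
        using U_AE[OF t] by eventually_elim (simp add: cmod_power2)
    qed (use U_m[OF t] in measurable)
    moreover have "integrable lborel (\<lambda>x. (exp (- (\<nu> * t)) * LT t fr x)\<^sup>2 + (exp (- (\<nu> * t)) * LT t fi x)\<^sup>2)"
      using LT_contraction(1)[OF t fri(1)] LT_contraction(1)[OF t fri(2)] by (simp add: square_summable_def)
    ultimately show ?thesis using U_m[OF t] by (simp add: square_integrable_def)
  qed
  have norm_eq: "L2_norm (\<lambda>x. U t x - v x) = sqrt ((LBINT x. (exp (- (\<nu> * t)) * LT t fr x - coef fr * ground x)\<^sup>2) +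
      (LBINT x. (exp (- (\<nu> * t)) * LT t fi x - coef fi * ground x)\<^sup>2))" if t: "t \<ge> 0" for t
  proof -
    have sq: "square_summable (\<lambda>x. exp (- (\<nu> * t)) * LT t h x - coef h * ground x)" if "square_summable h" for h
      using LT_contraction(1)[OF t that] ground(3) by (intro square_summable_diff square_summable_cmult[of ground])
    have "(LBINT x. (cmod (U t x - v x))\<^sup>2) = (LBINT x. (exp (- (\<nu> * t)) * LT t fr x - coef fr * ground x)\<^sup>2 +
       (exp (- (\<nu> * t)) * LT t fi x - coef fi * ground x)\<^sup>2)"
    proof (rule integral_cong_AE)
      show "AE x in lborel. (cmod (U t x - v x))\<^sup>2 = (exp (- (\<nu> * t)) * LT t fr x - coef fr * ground x)\<^sup>2 +
       (exp (- (\<nu> * t)) * LT t fi x - coef fi * ground x)\<^sup>2"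
        using U_AE[OF t] by eventually_elim (simp add: cmod_power2 v_def)
    qed (use U_m[OF t] in measurable)
    also have "\<dots> = (LBINT x. (exp (- (\<nu> * t)) * LT t fr x - coef fr * ground x)\<^sup>2) +
      (LBINT x. (exp (- (\<nu> * t)) * LT t fi x - coef fi * ground x)\<^sup>2)"
      using sq[OF fri(1)] sq[OF fri(2)] by (simp add: square_summable_def)
    finally show ?thesis by (simp add: L2_norm_def)
  qed
  have "((\<lambda>t. sqrt ((LBINT x. (exp (- (\<nu> * t)) * LT t fr x - coef fr * ground x)\<^sup>2) +
      (LBINT x. (exp (- (\<nu> * t)) * LT t fi x - coef fi * ground x)\<^sup>2))) \<longlongrightarrow> sqrt (0 + 0)) at_top"
    by (intro tendsto_intros LT_tendsto_ground fri)
  moreover have "\<forall>\<^sub>F t in at_top. sqrt ((LBINT x. (exp (- (\<nu> * t)) * LT t fr x - coef fr * ground x)\<^sup>2) +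
      (LBINT x. (exp (- (\<nu> * t)) * LT t fi x - coef fi * ground x)\<^sup>2)) = L2_norm (\<lambda>x. U t x - v x)"
    using eventually_ge_at_top[of 0] by eventually_elim (simp add: norm_eq)
  ultimately have "((\<lambda>t. L2_norm (\<lambda>x. U t x - v x)) \<longlongrightarrow> sqrt (0 + 0)) at_top"
    by (rule Lim_transform_eventually)
  then have "((\<lambda>t. L2_norm (\<lambda>x. U t x - v x)) \<longlongrightarrow> 0) at_top" by simp
  moreover have "\<forall>\<^sub>F t in at_top. square_integrable (U t)"
    using eventually_ge_at_top[of 0] by eventually_elim (rule U_sq)
  ultimately have "tendsto_L2 U v at_top"
    using v_sq unfolding tendsto_L2_def by blast
  then show ?thesis
    unfolding U_def[abs_def] v_def[abs_def] fr_def[abs_def] fi_def[abs_def] .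
qed

end

theorem theorem5p4:
  fixes M :: "'a measure" and \<xi> :: "real \<Rightarrow> 'a \<Rightarrow> real"
    and \<sigma> :: real and \<Lambda> :: "real measure" and \<Psi> :: "real \<Rightarrow> real"
    and L :: "real \<Rightarrow> real \<Rightarrow> 'a \<Rightarrow> real"
    and \<mu> a \<nu> :: real and f :: "real \<Rightarrow> complex"
  assumes levy: "levy_process M \<xi>"
    and Lambda: "symmetric_levy_measure \<Lambda>"
    and Psi: "\<Psi> = levy_exponent \<sigma> \<Lambda>"
    and char_fun: "\<And>t p. t \<ge> 0 \<Longrightarrow>
          (CLINT \<omega>|M. exp (\<i> * of_real (p * \<xi> t \<omega>))) = exp (- of_real (t * \<Psi> p))"
    and standing: "integrable lborel (\<lambda>p. 1 / (1 + \<Psi> p))"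
    and local_time: "continuous_local_time M \<xi> L"
    and mu: "\<mu> > 0"
    and nu: "\<nu> > 0" "of_real \<mu> * psi \<Psi> (of_real \<nu>) 0 = 1"
    and f: "square_integrable f"
  shows "(\<forall>t\<ge>0. AE x in lborel.
            integrable M (\<lambda>\<omega>. f (x - \<xi> t \<omega>) * of_real (exp (\<mu> * L t (x - a) \<omega>)))) \<and>
         tendsto_L2
           (\<lambda>t x. of_real (exp (- \<nu> * t)) *
              (CLINT \<omega>|M. f (x - \<xi> t \<omega>) * of_real (exp (\<mu> * L t (x - a) \<omega>))))
           (\<lambda>x. L2_inner f (\<lambda>y. psi \<Psi> (of_real \<nu>) (y - a))
                  / of_real ((L2_norm (psi \<Psi> (of_real \<nu>)))\<^sup>2)
                * psi \<Psi> (of_real \<nu>) (x - a))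
           at_top"
proof -
  interpret levy_process M \<xi> by (rule levy)
  obtain X where X: "symmetric_levy_exponent M X \<Psi>" and X_eq: "AE \<omega> in M. \<forall>t\<ge>0. X t \<omega> = \<xi> t \<omega>"
    using regular_modification[OF char_fun _ standing] levy_exponent_minus unfolding Psi by blast
  interpret symmetric_levy_exponent M X \<Psi> by (rule X)
  have L: "continuous_local_time M X L" by (rule continuous_local_time_cong_AE[OF local_time X_eq])
  have "complex_of_real (\<mu> * green \<nu> 0) = 1"
    using nu(2) psi_eq_green[OF nu(1), of 0] by simp
  then have critical: "\<mu> * green \<nu> 0 = 1" by (simp only: of_real_eq_1_iff)
  interpret levy_local_time M X \<Psi> a \<mu> \<nu>
  proof
    show "AE \<omega> in M. convergent (\<lambda>n. clock (\<lambda>y. bump n (y - a)) x t \<omega>)" if "t \<ge> 0" for t x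
      using clock_bump_tendsto_local_time[OF L that, of a x] by eventually_elim (auto simp: convergent_def)
  qed (use mu nu critical in auto)
  have [measurable]: "f \<in> borel_measurable borel" using f by (simp add: square_integrable_def)
  \<comment> \<open>Both L t (x - a) and loc t x are almost sure limits of the same bump clocks.
    Agreement for each fixed t and x is enough under the expectation.\<close>
  have AE_eq: "AE \<omega> in M. f (x - \<xi> t \<omega>) * of_real (exp (\<mu> * L t (x - a) \<omega>)) = f (x - X t \<omega>) * of_real (exp (\<mu> * loc t x \<omega>))"
    if t: "t \<ge> 0" for t x
    using X_eq clock_bump_tendsto_local_time[OF L t, of a x] clock_tendsto_loc[OF t, of x]
  proof eventually_elim
    fix \<omega>
    assume "\<forall>t\<ge>0. X t \<omega> = \<xi> t \<omega>" "(\<lambda>n. clock (\<lambda>y. bump n (y - a)) x t \<omega>) \<longlonglongrightarrow> L t (x - a) \<omega>"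
      "(\<lambda>n. clock (\<lambda>y. bump n (y - a)) x t \<omega>) \<longlonglongrightarrow> loc t x \<omega>"
    then have "X t \<omega> = \<xi> t \<omega>" "L t (x - a) \<omega> = loc t x \<omega>" using t LIMSEQ_unique by auto
    then show "f (x - \<xi> t \<omega>) * of_real (exp (\<mu> * L t (x - a) \<omega>)) = f (x - X t \<omega>) * of_real (exp (\<mu> * loc t x \<omega>))"
      by simp
  qed
  have meas: "(\<lambda>\<omega>. f (x - \<xi> t \<omega>) * of_real (exp (\<mu> * L t (x - a) \<omega>))) \<in> borel_measurable M"
    "(\<lambda>\<omega>. f (x - X t \<omega>) * of_real (exp (\<mu> * loc t x \<omega>))) \<in> borel_measurable M" if "t \<ge> 0" for t x
  proof -
    have [measurable]: "\<xi> t \<in> borel_measurable M" "L t (x - a) \<in> borel_measurable M"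
      using random_variable[OF that] local_time that by (auto simp: continuous_local_time_def)
    show "(\<lambda>\<omega>. f (x - \<xi> t \<omega>) * of_real (exp (\<mu> * L t (x - a) \<omega>))) \<in> borel_measurable M" by measurable
    show "(\<lambda>\<omega>. f (x - X t \<omega>) * of_real (exp (\<mu> * loc t x \<omega>))) \<in> borel_measurable M" by measurable
  qed
  have u: "(CLINT \<omega>|M. f (x - \<xi> t \<omega>) * of_real (exp (\<mu> * L t (x - a) \<omega>))) = LTc t f x" if "t \<ge> 0" for t x
    unfolding LTc_def by (rule integral_cong_AE[OF meas[OF that] AE_eq[OF that]])
  have int: "AE x in lborel. integrable M (\<lambda>\<omega>. f (x - \<xi> t \<omega>) * of_real (exp (\<mu> * L t (x - a) \<omega>)))" if t: "t \<ge> 0" for t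
    using LTc_AE[OF t f]
  proof eventually_elim
    fix x
    assume "integrable M (\<lambda>\<omega>. f (x - X t \<omega>) * of_real (exp (\<mu> * loc t x \<omega>))) \<and>
      LTc t f x = Complex (LT t (\<lambda>x. Re (f x)) x) (LT t (\<lambda>x. Im (f x)) x)"
    then show "integrable M (\<lambda>\<omega>. f (x - \<xi> t \<omega>) * of_real (exp (\<mu> * L t (x - a) \<omega>)))"
      using integrable_cong_AE[OF meas[OF t] AE_eq[OF t]] by blast
  qed
  show ?thesis
    unfolding ground_state_projection[OF f] using int LTc_tendsto_L2[OF f u] by blast
qed

end
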